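(* Let $\mathcal G$ and $\mathcal H$ be topologically principal, Hausdorff, étale groupoids with compact unit spaces, and let $p\in[1,\infty)\setminus\{2\}$. Then there is an isometric (algebra) isomorphism $F^p_\lambda(\mathcal G)\cong F^p_\lambda(\mathcal H)$ if and only if there is an isomorphism of topological groupoids $\mathcal G\cong\mathcal H$.
   Context: For a topological groupoid $\mathcal G$ with unit space $\mathcal G^{(0)}$, $\mathrm{dom}(\gamma)=\gamma^{-1}\gamma$, $\mathrm{ran}(\gamma)=\gamma\gamma^{-1}$; $\mathcal G$ is étale if $\mathrm{dom},\mathrm{ran}\colon\mathcal G\to\mathcal G^{(0)}$ are local homeomorphisms. It is topologically principal if the set of $x\in\mathcal G^{(0)}$ whose isotropy group $\{\gamma:\mathrm{dom}(\gamma)=\mathrm{ran}(\gamma)=x\}$ is trivial is dense in $\mathcal G^{(0)}$. Reduced groupoid $L^p$-operator algebra: $C_c(\mathcal G)$ carries the convolution $(f*g)(\gamma)=\sum_{\sigma\in\mathcal G\mathrm{dom}(\gamma)}f(\gamma\sigma^{-1})g(\sigma)$, where $\mathcal Gx=\{\sigma:\mathrm{dom}(\sigma)=x\}$. For $x\in\mathcal G^{(0)}$, $\lambda_x\colon C_c(\mathcal G)\to\mathcal B(\ell^p(\mathcal Gx))$ is given by left convolution, $(\lambda_x(f)\xi)(\gamma)=\sum_{\sigma\in\mathcal Gx}f(\gamma\sigma^{-1})\xi(\sigma)$. $F^p_\lambda(\mathcal G)$ is the completion of $C_c(\mathcal G)$ in the norm $\|f\|_\lambda=\sup_{x\in\mathcal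 G^{(0)}}\|\lambda_x(f)\|$. *)

theory Defs
  imports "HOL-Analysis.Analysis"
begin

section \<open>Topological groupoids\<close>

text \<open>
  The underlying set of a groupoid is the carrier of its topology. The product
  \<open>gmul\<close> is partial: it is meaningful only on the set \<open>gcomp\<close> of composable pairs.
\<close>

record 'a top_groupoid =
  gtop :: "'a topology"
  gcomp :: "('a \<times> 'a) set"
  gmul :: "'a \<Rightarrow> 'a \<Rightarrow> 'a"
  ginv :: "'a \<Rightarrow> 'a"

abbreviation arrows :: "'a top_groupoid \<Rightarrow> 'a set" where
  "arrows G \<equiv> topspace (gtop G)"

definition gdom :: "'a top_groupoid \<Rightarrow> 'a \<Rightarrow> 'a" where
  "gdom G \<gamma> = gmul G (ginv G \<gamma>) \<gamma>"

definition gran :: "'a top_groupoid \<Rightarrow> 'a \<Rightarrow> 'a" where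
  "gran G \<gamma> = gmul G \<gamma> (ginv G \<gamma>)"

definition units :: "'a top_groupoid \<Rightarrow> 'a set" where
  "units G = gdom G ` arrows G"

definition unit_top :: "'a top_groupoid \<Rightarrow> 'a topology" where
  "unit_top G = subtopology (gtop G) (units G)"

text \<open>
  The algebraic axioms are those of Hahn and Renault; they amount to a small category in
  which every arrow is invertible, with \<open>(\<gamma>, \<sigma>)\<close> composable iff \<open>gdom G \<gamma> = gran G \<sigma>\<close>.
\<close>

definition groupoid :: "'a top_groupoid \<Rightarrow> bool" where
  "groupoid G \<longleftrightarrow>
     gcomp G \<subseteq> arrows G \<times> arrows G \<and>
     (\<forall>(\<gamma>, \<sigma>) \<in> gcomp G. gmul G \<gamma> \<sigma> \<in> arrows G) \<and>
     (\<forall>\<gamma> \<in> arrows G. ginv G \<gamma> \<in> arrows G \<and> ginv G (ginv G \<gamma>) = \<gamma> \<and> (\<gamma>, ginv G \<gamma>) \<in> gcomp G) \<and>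
     (\<forall>\<gamma> \<sigma> \<tau>. (\<gamma>, \<sigma>) \<in> gcomp G \<and> (\<sigma>, \<tau>) \<in> gcomp G \<longrightarrow>
        (gmul G \<gamma> \<sigma>, \<tau>) \<in> gcomp G \<and> (\<gamma>, gmul G \<sigma> \<tau>) \<in> gcomp G \<and>
        gmul G (gmul G \<gamma> \<sigma>) \<tau> = gmul G \<gamma> (gmul G \<sigma> \<tau>)) \<and>
     (\<forall>(\<gamma>, \<sigma>) \<in> gcomp G.
        gmul G (ginv G \<gamma>) (gmul G \<gamma> \<sigma>) = \<sigma> \<and> gmul G (gmul G \<gamma> \<sigma>) (ginv G \<sigma>) = \<gamma>)"

definition topological_groupoid :: "'a top_groupoid \<Rightarrow> bool" where
  "topological_groupoid G \<longleftrightarrow>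
     groupoid G \<and>
     continuous_map (subtopology (prod_topology (gtop G) (gtop G)) (gcomp G)) (gtop G)
       (\<lambda>(\<gamma>, \<sigma>). gmul G \<gamma> \<sigma>) \<and>
     continuous_map (gtop G) (gtop G) (ginv G)"

definition local_homeomorphism :: "'a topology \<Rightarrow> 'b topology \<Rightarrow> ('a \<Rightarrow> 'b) \<Rightarrow> bool" where
  "local_homeomorphism X Y f \<longleftrightarrow>
     continuous_map X Y f \<and>
     (\<forall>x \<in> topspace X. \<exists>U. openin X U \<and> x \<in> U \<and> openin Y (f ` U) \<and>
        homeomorphic_map (subtopology X U) (subtopology Y (f ` U)) f)"

definition etale :: "'a top_groupoid \<Rightarrow> bool" where
  "etale G \<longleftrightarrow>
     local_homeomorphism (gtop G) (unit_top G) (gdom G) \<and>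
     local_homeomorphism (gtop G) (unit_top G) (gran G)"

definition isotropy :: "'a top_groupoid \<Rightarrow> 'a \<Rightarrow> 'a set" where
  "isotropy G x = {\<gamma> \<in> arrows G. gdom G \<gamma> = x \<and> gran G \<gamma> = x}"

definition topologically_principal :: "'a top_groupoid \<Rightarrow> bool" where
  "topologically_principal G \<longleftrightarrow>
     unit_top G closure_of {x \<in> units G. isotropy G x = {x}} = units G"

definition groupoid_hom :: "'a top_groupoid \<Rightarrow> 'b top_groupoid \<Rightarrow> ('a \<Rightarrow> 'b) \<Rightarrow> bool" where
  "groupoid_hom G H \<phi> \<longleftrightarrow>
     \<phi> ` arrows G \<subseteq> arrows H \<and>
     (\<forall>(\<gamma>, \<sigma>) \<in> gcomp G.
        (\<phi> \<gamma>, \<phi> \<sigma>) \<in> gcomp H \<and> \<phi> (gmul G \<gamma> \<sigma>) = gmul H (\<phi> \<gamma>) (\<phi> \<sigma>))"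

definition top_groupoid_isomorphic :: "'a top_groupoid \<Rightarrow> 'b top_groupoid \<Rightarrow> bool" where
  "top_groupoid_isomorphic G H \<longleftrightarrow>
     (\<exists>\<phi> \<psi>. homeomorphic_maps (gtop G) (gtop H) \<phi> \<psi> \<and> groupoid_hom G H \<phi> \<and> groupoid_hom H G \<psi>)"


section \<open>Normed algebras and their completions\<close>

record 'v normed_alg =
  acarrier :: "'v set"
  aadd :: "'v \<Rightarrow> 'v \<Rightarrow> 'v"
  ascale :: "complex \<Rightarrow> 'v \<Rightarrow> 'v"
  amul :: "'v \<Rightarrow> 'v \<Rightarrow> 'v"
  anorm :: "'v \<Rightarrow> real"

definition adist :: "'v normed_alg \<Rightarrow> 'v \<Rightarrow> 'v \<Rightarrow> real" where
  "adist A a b = anorm A (aadd A a (ascale A (- 1) b))"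

definition cauchy_seqs :: "'v normed_alg \<Rightarrow> (nat \<Rightarrow> 'v) set" where
  "cauchy_seqs A =
     {s. range s \<subseteq> acarrier A \<and> (\<forall>e>0. \<exists>N. \<forall>m\<ge>N. \<forall>n\<ge>N. adist A (s m) (s n) < e)}"

definition null_equiv :: "'v normed_alg \<Rightarrow> ((nat \<Rightarrow> 'v) \<times> (nat \<Rightarrow> 'v)) set" where
  "null_equiv A =
     {(s, t). s \<in> cauchy_seqs A \<and> t \<in> cauchy_seqs A \<and> (\<lambda>n. adist A (s n) (t n)) \<longlonglongrightarrow> 0}"

text \<open>
  The completion consists of classes of Cauchy sequences modulo null sequences. The unions
  and the image under \<open>the_elem\<close> range over representatives, all of which yield the same value.
\<close>

definition completion :: "'v normed_alg \<Rightarrow> (nat \<Rightarrow> 'v) set normed_alg" where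
  "completion A =
     \<lparr>acarrier = cauchy_seqs A // null_equiv A,
      aadd = (\<lambda>X Y. \<Union>s\<in>X. \<Union>t\<in>Y. null_equiv A `` {\<lambda>n. aadd A (s n) (t n)}),
      ascale = (\<lambda>c X. \<Union>s\<in>X. null_equiv A `` {\<lambda>n. ascale A c (s n)}),
      amul = (\<lambda>X Y. \<Union>s\<in>X. \<Union>t\<in>Y. null_equiv A `` {\<lambda>n. amul A (s n) (t n)}),
      anorm = (\<lambda>X. the_elem ((\<lambda>s. lim (\<lambda>n. anorm A (s n))) ` X))\<rparr>"

definition isometrically_isomorphic :: "'v normed_alg \<Rightarrow> 'w normed_alg \<Rightarrow> bool" where
  "isometrically_isomorphic A B \<longleftrightarrow>
     (\<exists>\<Phi>. bij_betw \<Phi> (acarrier A) (acarrier B) \<and>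
        (\<forall>a \<in> acarrier A. \<forall>b \<in> acarrier A. \<Phi> (aadd A a b) = aadd B (\<Phi> a) (\<Phi> b)) \<and>
        (\<forall>c. \<forall>a \<in> acarrier A. \<Phi> (ascale A c a) = ascale B c (\<Phi> a)) \<and>
        (\<forall>a \<in> acarrier A. \<forall>b \<in> acarrier A. \<Phi> (amul A a b) = amul B (\<Phi> a) (\<Phi> b)) \<and>
        (\<forall>a \<in> acarrier A. anorm B (\<Phi> a) = anorm A a))"


section \<open>Spaces of $p$-summable families\<close>

text \<open>Functions on a set \<open>S\<close> are represented by functions on the type that vanish off \<open>S\<close>.\<close>

definition lp_space :: "real \<Rightarrow> 'a set \<Rightarrow> ('a \<Rightarrow> complex) set" where
  "lp_space p S =
     {\<xi>. (\<forall>\<sigma>. \<sigma> \<notin> S \<longrightarrow> \<xi> \<sigma> = 0) \<and> (\<lambda>\<sigma>. cmod (\<xi> \<sigma>) powr p) summable_on S}"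

definition lp_norm :: "real \<Rightarrow> 'a set \<Rightarrow> ('a \<Rightarrow> complex) \<Rightarrow> real" where
  "lp_norm p S \<xi> = (\<Sum>\<^sub>\<infinity>\<sigma>\<in>S. cmod (\<xi> \<sigma>) powr p) powr (1 / p)"

definition lp_opnorm :: "real \<Rightarrow> 'a set \<Rightarrow> (('a \<Rightarrow> complex) \<Rightarrow> 'a \<Rightarrow> complex) \<Rightarrow> ennreal" where
  "lp_opnorm p S T =
     (SUP \<xi> \<in> {\<xi> \<in> lp_space p S. lp_norm p S \<xi> \<le> 1}. ennreal (lp_norm p S (T \<xi>)))"


section \<open>The reduced groupoid $L^p$-operator algebra\<close>

definition Cc :: "'a top_groupoid \<Rightarrow> ('a \<Rightarrow> complex) set" where
  "Cc G =
     {f. continuous_map (gtop G) euclidean f \<and> (\<forall>\<gamma>. \<gamma> \<notin> arrows G \<longrightarrow> f \<gamma> = 0) \<and>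
         compactin (gtop G) (gtop G closure_of {\<gamma> \<in> arrows G. f \<gamma> \<noteq> 0})}"

definition source_fibre :: "'a top_groupoid \<Rightarrow> 'a \<Rightarrow> 'a set" where
  "source_fibre G x = {\<sigma> \<in> arrows G. gdom G \<sigma> = x}"

text \<open>
  For an etale groupoid and \<open>f \<in> Cc G\<close>, only finitely many terms of the following two sums
  are nonzero.
\<close>

definition convolution ::
    "'a top_groupoid \<Rightarrow> ('a \<Rightarrow> complex) \<Rightarrow> ('a \<Rightarrow> complex) \<Rightarrow> 'a \<Rightarrow> complex" where
  "convolution G f g \<gamma> =
     (if \<gamma> \<in> arrows G
      then \<Sum>\<^sub>\<infinity>\<sigma>\<in>source_fibre G (gdom G \<gamma>). f (gmul G \<gamma> (ginv G \<sigma>)) * g \<sigma>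
      else 0)"

definition left_reg ::
    "'a top_groupoid \<Rightarrow> 'a \<Rightarrow> ('a \<Rightarrow> complex) \<Rightarrow> ('a \<Rightarrow> complex) \<Rightarrow> 'a \<Rightarrow> complex" where
  "left_reg G x f \<xi> \<gamma> =
     (if \<gamma> \<in> source_fibre G x
      then \<Sum>\<^sub>\<infinity>\<sigma>\<in>source_fibre G x. f (gmul G \<gamma> (ginv G \<sigma>)) * \<xi> \<sigma>
      else 0)"

text \<open>
  For an etale groupoid and \<open>f \<in> Cc G\<close> the supremum is finite. It is taken in the extended
  nonnegative reals so that the empty groupoid gets the norm $0$.
\<close>

definition lambda_norm :: "real \<Rightarrow> 'a top_groupoid \<Rightarrow> ('a \<Rightarrow> complex) \<Rightarrow> real" where
  "lambda_norm p G f =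
     enn2real (SUP x \<in> units G. lp_opnorm p (source_fibre G x) (left_reg G x f))"

definition Cc_algebra :: "real \<Rightarrow> 'a top_groupoid \<Rightarrow> ('a \<Rightarrow> complex) normed_alg" where
  "Cc_algebra p G =
     \<lparr>acarrier = Cc G,
      aadd = (\<lambda>f g \<gamma>. f \<gamma> + g \<gamma>),
      ascale = (\<lambda>c f \<gamma>. c * f \<gamma>),
      amul = convolution G,
      anorm = lambda_norm p G\<rparr>"

definition reduced_algebra ::
    "real \<Rightarrow> 'a top_groupoid \<Rightarrow> (nat \<Rightarrow> 'a \<Rightarrow> complex) set normed_alg" where
  "reduced_algebra p G = completion (Cc_algebra p G)"

end

(*
  An invertible isometry of l^p(S), p \<noteq> 2, sends vectors with disjoint supports to vectors with
  disjoint supports (equality case of Clarkson's inequality). If it is also within distance 1 of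
  the identity, its diagonal entries do not vanish, so it is diagonal. Hence the invertible
  isometries of the reduced algebra near the unit are unimodular functions on the unit space, and
  these span C(G0). An isometric isomorphism therefore maps C(G0) onto C(H0) and induces a
  homeomorphism of the unit spaces. A bump function n on a small bisection of G has an image whose
  support projects into the graph of the same partial homeomorphism of the unit space, because
  g * n * f = 0 can be tested with f, g in C(G0); topological principality turns this into
  injectivity of domain and range on the support. Relating an arrow in the support of n to an
  arrow with corresponding domain in the support of the image of n defines the isomorphism of
  groupoids.
*)
theory Submission imports Defs begin

section \<open>Groupoid algebra\<close>

text \<open>The completion consists of classes of Cauchy sequences, which have no supports. Since
  \<open>f \<gamma>\<close> is a matrix entry of a left regular representation, norm convergence
  forces pointwise convergence, and the completion can be realised as a space \<open>RA\<close> of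
  continuous functions on the arrows with the same convolution. Norm estimates are carried by
  \<open>opbound\<close>, a bound on all finite blocks of these matrices, because it is stable under
  pointwise limits. Two obstacles shape the reconstruction. The image of a compactly supported
  function is only known to lie in the completion, so its support is open but perhaps not relatively
  compact; compact support is therefore used on the source side only, and the conditions kept for
  later are symmetric in the two groupoids. Moreover the isomorphism is not assumed to respect an
  involution, so \<open>n\<close> has no adjoint to be paired with; a second bump function near the
  inverse arrows takes its place. Passing to the inverse isomorphism exchanges the groupoids and
  yields the reverse directions.\<close>

abbreviation gdiv :: "'a top_groupoid \<Rightarrow> 'a \<Rightarrow> 'a \<Rightarrow> 'a" where
  "gdiv G \<gamma> \<sigma> \<equiv> gmul G \<gamma> (ginv G \<sigma>)"

locale grpd =
  fixes G :: "'a top_groupoid"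
  assumes groupoid: "groupoid G"
begin

lemma inv_closed [simp]: "\<gamma> \<in> arrows G \<Longrightarrow> ginv G \<gamma> \<in> arrows G"
  and inv_inv [simp]: "\<gamma> \<in> arrows G \<Longrightarrow> ginv G (ginv G \<gamma>) = \<gamma>"
  and comp_inv: "\<gamma> \<in> arrows G \<Longrightarrow> (\<gamma>, ginv G \<gamma>) \<in> gcomp G"
  and comp_mul: "(\<gamma>, \<sigma>) \<in> gcomp G \<Longrightarrow> gmul G \<gamma> \<sigma> \<in> arrows G"
  and comp_arrows: "(\<gamma>, \<sigma>) \<in> gcomp G \<Longrightarrow> \<gamma> \<in> arrows G" "(\<gamma>, \<sigma>) \<in> gcomp G \<Longrightarrow> \<sigma> \<in> arrows G"
  and comp_assoc: "(\<gamma>, \<sigma>) \<in> gcomp G \<Longrightarrow> (\<sigma>, \<tau>) \<in> gcomp G \<Longrightarrow>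
        (gmul G \<gamma> \<sigma>, \<tau>) \<in> gcomp G \<and> (\<gamma>, gmul G \<sigma> \<tau>) \<in> gcomp G \<and>
        gmul G (gmul G \<gamma> \<sigma>) \<tau> = gmul G \<gamma> (gmul G \<sigma> \<tau>)"
  and comp_cancel: "(\<gamma>, \<sigma>) \<in> gcomp G \<Longrightarrow> gmul G (ginv G \<gamma>) (gmul G \<gamma> \<sigma>) = \<sigma>"
    "(\<gamma>, \<sigma>) \<in> gcomp G \<Longrightarrow> gmul G (gmul G \<gamma> \<sigma>) (ginv G \<sigma>) = \<gamma>"
proof -
  note g = groupoid[unfolded groupoid_def]
  show "\<gamma> \<in> arrows G \<Longrightarrow> ginv G \<gamma> \<in> arrows G" "\<gamma> \<in> arrows G \<Longrightarrow> ginv G (ginv G \<gamma>) = \<gamma>"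
    "\<gamma> \<in> arrows G \<Longrightarrow> (\<gamma>, ginv G \<gamma>) \<in> gcomp G"
    using g by blast+
  show "(\<gamma>, \<sigma>) \<in> gcomp G \<Longrightarrow> gmul G \<gamma> \<sigma> \<in> arrows G" "(\<gamma>, \<sigma>) \<in> gcomp G \<Longrightarrow> \<gamma> \<in> arrows G"
    "(\<gamma>, \<sigma>) \<in> gcomp G \<Longrightarrow> \<sigma> \<in> arrows G"
    "(\<gamma>, \<sigma>) \<in> gcomp G \<Longrightarrow> gmul G (ginv G \<gamma>) (gmul G \<gamma> \<sigma>) = \<sigma>"
    "(\<gamma>, \<sigma>) \<in> gcomp G \<Longrightarrow> gmul G (gmul G \<gamma> \<sigma>) (ginv G \<sigma>) = \<gamma>"
    using g by blast+
  show "(\<gamma>, \<sigma>) \<in> gcomp G \<Longrightarrow> (\<sigma>, \<tau>) \<in> gcomp G \<Longrightarrow>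
        (gmul G \<gamma> \<sigma>, \<tau>) \<in> gcomp G \<and> (\<gamma>, gmul G \<sigma> \<tau>) \<in> gcomp G \<and>
        gmul G (gmul G \<gamma> \<sigma>) \<tau> = gmul G \<gamma> (gmul G \<sigma> \<tau>)"
    using g by blast
qed

lemma comp_inv': "\<gamma> \<in> arrows G \<Longrightarrow> (ginv G \<gamma>, \<gamma>) \<in> gcomp G"
  using comp_inv[of "ginv G \<gamma>"] by simp

text \<open>The axioms leave composability abstract. Forwards, \<open>gdom G \<gamma>\<close> acts
  as a left identity on \<open>\<sigma>\<close>, and cancelling \<open>\<sigma>\<close> on the right
  identifies it with \<open>gran G \<sigma>\<close>. Backwards, \<open>\<gamma>\<close> is
  composable with \<open>gdom G \<gamma> = gran G \<sigma>\<close>, which is composable with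
  \<open>\<sigma>\<close>; the associativity axiom then makes \<open>\<gamma>\<close>, being its own
  product with its domain, composable with \<open>\<sigma>\<close>.\<close>

lemma comp_iff: "(\<gamma>, \<sigma>) \<in> gcomp G \<longleftrightarrow> \<gamma> \<in> arrows G \<and> \<sigma> \<in> arrows G \<and> gdom G \<gamma> = gran G \<sigma>"
proof
  assume c: "(\<gamma>, \<sigma>) \<in> gcomp G"
  have a: "\<gamma> \<in> arrows G" "\<sigma> \<in> arrows G" using comp_arrows[OF c] by auto
  have 1: "(gdom G \<gamma>, \<sigma>) \<in> gcomp G" "gmul G (gdom G \<gamma>) \<sigma> = \<sigma>"
    using comp_assoc[OF comp_inv'[OF a(1)] c] comp_cancel[OF c] by (auto simp: gdom_def)
  have "gdom G \<gamma> = gran G \<sigma>"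
    using comp_cancel(2)[OF 1(1)] 1(2) by (simp add: gran_def)
  with a show "\<gamma> \<in> arrows G \<and> \<sigma> \<in> arrows G \<and> gdom G \<gamma> = gran G \<sigma>" by simp
next
  assume a: "\<gamma> \<in> arrows G \<and> \<sigma> \<in> arrows G \<and> gdom G \<gamma> = gran G \<sigma>"
  have 1: "(\<gamma>, gdom G \<gamma>) \<in> gcomp G" "gmul G \<gamma> (gdom G \<gamma>) = \<gamma>"
    using a comp_assoc[OF comp_inv comp_inv', of \<gamma>] comp_cancel(2)[OF comp_inv, of \<gamma>]
    by (auto simp: gdom_def)
  have 2: "(gran G \<sigma>, \<sigma>) \<in> gcomp G"
    using a comp_assoc[OF comp_inv comp_inv', of \<sigma>] by (auto simp: gran_def)
  show "(\<gamma>, \<sigma>) \<in> gcomp G"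
    using comp_assoc[OF 1(1), of \<sigma>] 2 a 1(2) by auto
qed

lemma mul_closed [simp]:
  "\<gamma> \<in> arrows G \<Longrightarrow> \<sigma> \<in> arrows G \<Longrightarrow> gdom G \<gamma> = gran G \<sigma> \<Longrightarrow> gmul G \<gamma> \<sigma> \<in> arrows G"
  by (simp add: comp_iff comp_mul)

lemma dom_inv [simp]: "\<gamma> \<in> arrows G \<Longrightarrow> gdom G (ginv G \<gamma>) = gran G \<gamma>"
  and ran_inv [simp]: "\<gamma> \<in> arrows G \<Longrightarrow> gran G (ginv G \<gamma>) = gdom G \<gamma>"
  by (simp_all add: gdom_def gran_def)

lemma dom_closed [simp]: "\<gamma> \<in> arrows G \<Longrightarrow> gdom G \<gamma> \<in> arrows G"
  and ran_closed [simp]: "\<gamma> \<in> arrows G \<Longrightarrow> gran G \<gamma> \<in> arrows G"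
  using comp_mul comp_inv comp_inv' by (auto simp: gdom_def gran_def)

lemma mul_assoc:
  assumes "\<gamma> \<in> arrows G" "\<sigma> \<in> arrows G" "\<tau> \<in> arrows G" "gdom G \<gamma> = gran G \<sigma>" "gdom G \<sigma> = gran G \<tau>"
  shows "gmul G (gmul G \<gamma> \<sigma>) \<tau> = gmul G \<gamma> (gmul G \<sigma> \<tau>)"
  using comp_assoc[of \<gamma> \<sigma> \<tau>] assms by (simp add: comp_iff)

lemma dom_mul [simp]:
  assumes "\<gamma> \<in> arrows G" "\<sigma> \<in> arrows G" "gdom G \<gamma> = gran G \<sigma>"
  shows "gdom G (gmul G \<gamma> \<sigma>) = gdom G \<sigma>"
proof -
  have "(gmul G \<gamma> \<sigma>, ginv G \<sigma>) \<in> gcomp G"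
    using comp_assoc[of \<gamma> \<sigma> "ginv G \<sigma>"] assms by (simp add: comp_iff)
  then show ?thesis using assms by (simp add: comp_iff)
qed

lemma ran_mul [simp]:
  assumes "\<gamma> \<in> arrows G" "\<sigma> \<in> arrows G" "gdom G \<gamma> = gran G \<sigma>"
  shows "gran G (gmul G \<gamma> \<sigma>) = gran G \<gamma>"
proof -
  have "(ginv G \<gamma>, gmul G \<gamma> \<sigma>) \<in> gcomp G"
    using comp_assoc[of "ginv G \<gamma>" \<gamma> \<sigma>] assms by (simp add: comp_iff)
  then show ?thesis using assms by (simp add: comp_iff)
qed

lemma dom_dom [simp]: "\<gamma> \<in> arrows G \<Longrightarrow> gdom G (gdom G \<gamma>) = gdom G \<gamma>"
  and ran_dom [simp]: "\<gamma> \<in> arrows G \<Longrightarrow> gran G (gdom G \<gamma>) = gdom G \<gamma>"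
  and dom_ran [simp]: "\<gamma> \<in> arrows G \<Longrightarrow> gdom G (gran G \<gamma>) = gran G \<gamma>"
  and ran_ran [simp]: "\<gamma> \<in> arrows G \<Longrightarrow> gran G (gran G \<gamma>) = gran G \<gamma>"
proof -
  show *: "\<gamma> \<in> arrows G \<Longrightarrow> gdom G (gdom G \<gamma>) = gdom G \<gamma>" for \<gamma>
    using dom_mul[of "ginv G \<gamma>" \<gamma>] by (simp flip: gdom_def)
  show **: "\<gamma> \<in> arrows G \<Longrightarrow> gran G (gdom G \<gamma>) = gdom G \<gamma>" for \<gamma>
    using ran_mul[of "ginv G \<gamma>" \<gamma>] by (simp flip: gdom_def)
  show "\<gamma> \<in> arrows G \<Longrightarrow> gdom G (gran G \<gamma>) = gran G \<gamma>" using *[of "ginv G \<gamma>"] by simp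
  show "\<gamma> \<in> arrows G \<Longrightarrow> gran G (gran G \<gamma>) = gran G \<gamma>" using **[of "ginv G \<gamma>"] by simp
qed

lemma mul_inv_cancel [simp]:
  assumes "\<gamma> \<in> arrows G" "\<sigma> \<in> arrows G"
  shows "gdom G \<gamma> = gran G \<sigma> \<Longrightarrow> gmul G (ginv G \<gamma>) (gmul G \<gamma> \<sigma>) = \<sigma>"
    and "gdom G \<gamma> = gran G \<sigma> \<Longrightarrow> gmul G (gmul G \<gamma> \<sigma>) (ginv G \<sigma>) = \<gamma>"
    and "gdom G \<gamma> = gdom G \<sigma> \<Longrightarrow> gmul G (gdiv G \<gamma> \<sigma>) \<sigma> = \<gamma>"
  using assms comp_cancel[of \<gamma> \<sigma>] comp_cancel(2)[of \<gamma> "ginv G \<sigma>"] by (auto simp: comp_iff)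

lemma mul_dom [simp]: "\<gamma> \<in> arrows G \<Longrightarrow> gmul G \<gamma> (gdom G \<gamma>) = \<gamma>"
  and ran_mul_self [simp]: "\<gamma> \<in> arrows G \<Longrightarrow> gmul G (gran G \<gamma>) \<gamma> = \<gamma>"
  using mul_inv_cancel(1)[of "ginv G \<gamma>" "\<gamma>"] mul_inv_cancel(3)[of "\<gamma>" "\<gamma>"]
  by (auto simp: gdom_def gran_def)

lemma gdiv_self [simp]: "gdiv G \<gamma> \<gamma> = gran G \<gamma>"
  by (simp add: gran_def)

lemma inv_mul_self [simp]: "gmul G (ginv G \<gamma>) \<gamma> = gdom G \<gamma>"
  by (simp add: gdom_def)

lemma units_iff: "x \<in> units G \<longleftrightarrow> x \<in> arrows G \<and> gdom G x = x"
  by (metis dom_closed dom_dom image_iff units_def)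

lemma units_arrows [simp]: "x \<in> units G \<Longrightarrow> x \<in> arrows G"
  and dom_unit [simp]: "x \<in> units G \<Longrightarrow> gdom G x = x"
  and ran_unit [simp]: "x \<in> units G \<Longrightarrow> gran G x = x"
  and dom_units [simp]: "\<gamma> \<in> arrows G \<Longrightarrow> gdom G \<gamma> \<in> units G"
  and ran_units [simp]: "\<gamma> \<in> arrows G \<Longrightarrow> gran G \<gamma> \<in> units G"
  by (auto simp: units_iff) (metis ran_dom)

lemma inv_unit [simp]: "x \<in> units G \<Longrightarrow> ginv G x = x"
  by (metis dom_unit gdom_def mul_dom inv_closed dom_inv ran_unit units_arrows)

lemma left_cancel:
  assumes "\<gamma> \<in> arrows G" "\<sigma> \<in> arrows G" "\<tau> \<in> arrows G" "gdom G \<gamma> = gran G \<sigma>" "gdom G \<gamma> = gran G \<tau>"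
    "gmul G \<gamma> \<sigma> = gmul G \<gamma> \<tau>"
  shows "\<sigma> = \<tau>"
  by (metis assms mul_inv_cancel(1))

lemma right_cancel:
  assumes "\<gamma> \<in> arrows G" "\<sigma> \<in> arrows G" "\<tau> \<in> arrows G" "gdom G \<sigma> = gran G \<gamma>" "gdom G \<tau> = gran G \<gamma>"
    "gmul G \<sigma> \<gamma> = gmul G \<tau> \<gamma>"
  shows "\<sigma> = \<tau>"
  by (metis assms mul_inv_cancel(2))

lemma inv_mul:
  assumes "\<gamma> \<in> arrows G" "\<sigma> \<in> arrows G" "gdom G \<gamma> = gran G \<sigma>"
  shows "ginv G (gmul G \<gamma> \<sigma>) = gmul G (ginv G \<sigma>) (ginv G \<gamma>)"
proof (rule left_cancel[of "gmul G \<gamma> \<sigma>"])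
  have "gmul G (gmul G \<gamma> \<sigma>) (gmul G (ginv G \<sigma>) (ginv G \<gamma>)) =
        gmul G (gmul G (gmul G \<gamma> \<sigma>) (ginv G \<sigma>)) (ginv G \<gamma>)"
    by (rule mul_assoc[symmetric]) (use assms in auto)
  also have "\<dots> = gran G \<gamma>" using assms by simp
  also have "\<dots> = gmul G (gmul G \<gamma> \<sigma>) (ginv G (gmul G \<gamma> \<sigma>))"
    using assms by simp
  finally show "gmul G (gmul G \<gamma> \<sigma>) (ginv G (gmul G \<gamma> \<sigma>)) =
      gmul G (gmul G \<gamma> \<sigma>) (gmul G (ginv G \<sigma>) (ginv G \<gamma>))" by simp
qed (use assms in auto)

lemma fibre_iff [simp]: "\<sigma> \<in> source_fibre G x \<longleftrightarrow> \<sigma> \<in> arrows G \<and> gdom G \<sigma> = x"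
  by (simp add: source_fibre_def)

lemma gdiv_closed [simp]:
  assumes "\<gamma> \<in> arrows G" "\<sigma> \<in> arrows G" "gdom G \<gamma> = gdom G \<sigma>"
  shows "gdiv G \<gamma> \<sigma> \<in> arrows G" "gdom G (gdiv G \<gamma> \<sigma>) = gran G \<sigma>" "gran G (gdiv G \<gamma> \<sigma>) = gran G \<gamma>"
  using assms by auto

lemma gdiv_inj1:
  assumes "\<gamma> \<in> arrows G" "\<sigma> \<in> arrows G" "\<tau> \<in> arrows G" "gdom G \<gamma> = gdom G \<sigma>" "gdom G \<tau> = gdom G \<sigma>"
    "gdiv G \<gamma> \<sigma> = gdiv G \<tau> \<sigma>"
  shows "\<gamma> = \<tau>"
  by (metis assms mul_inv_cancel(3))

lemma gdiv_inj2:
  assumes "\<gamma> \<in> arrows G" "\<sigma> \<in> arrows G" "\<tau> \<in> arrows G" "gdom G \<gamma> = gdom G \<sigma>" "gdom G \<gamma> = gdom G \<tau>"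
    "gdiv G \<gamma> \<sigma> = gdiv G \<gamma> \<tau>"
  shows "\<sigma> = \<tau>"
  by (metis assms left_cancel inv_closed inv_inv ran_inv)

text \<open>Left convolution by \<open>f\<close> has the matrix with entry
  \<open>f (gdiv G \<gamma> \<sigma>)\<close> in row \<open>\<gamma>\<close> and column
  \<open>\<sigma>\<close>. Units label exactly its diagonal, so functions on the unit space act
  diagonally.\<close>

lemma gdiv_unit:
  assumes "\<gamma> \<in> arrows G" "\<sigma> \<in> arrows G" "gdom G \<gamma> = gdom G \<sigma>"
  shows "gdiv G \<gamma> \<sigma> \<in> units G \<longleftrightarrow> \<gamma> = \<sigma>"
proof
  assume u: "gdiv G \<gamma> \<sigma> \<in> units G"
  then have "gdiv G \<gamma> \<sigma> = gran G \<sigma>" using assms by (metis dom_unit gdiv_closed(2))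
  then show "\<gamma> = \<sigma>" using assms by (metis mul_inv_cancel(3) ran_mul_self)
qed (use assms in auto)

text \<open>These rules for quotients turn convolution of functions into multiplication of their
  matrices.\<close>

lemma gdiv_mul:
  assumes "\<gamma> \<in> arrows G" "\<sigma> \<in> arrows G" "\<tau> \<in> arrows G" "gdom G \<gamma> = gdom G \<sigma>" "gdom G \<tau> = gdom G \<sigma>"
  shows "gmul G (gdiv G \<gamma> \<tau>) (gdiv G \<tau> \<sigma>) = gdiv G \<gamma> \<sigma>"
    and "gdiv G (gdiv G \<gamma> \<sigma>) (gdiv G \<tau> \<sigma>) = gdiv G \<gamma> \<tau>"
proof -
  have "gmul G (gdiv G \<gamma> \<tau>) (gdiv G \<tau> \<sigma>) = gmul G (gmul G (gdiv G \<gamma> \<tau>) \<tau>) (ginv G \<sigma>)"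
    using assms by (subst mul_assoc) auto
  then show 1: "gmul G (gdiv G \<gamma> \<tau>) (gdiv G \<tau> \<sigma>) = gdiv G \<gamma> \<sigma>" using assms by simp
  have "gdiv G (gdiv G \<gamma> \<sigma>) (gdiv G \<tau> \<sigma>) = gdiv G (gmul G (gdiv G \<gamma> \<tau>) (gdiv G \<tau> \<sigma>)) (gdiv G \<tau> \<sigma>)"
    using 1 by simp
  then show "gdiv G (gdiv G \<gamma> \<sigma>) (gdiv G \<tau> \<sigma>) = gdiv G \<gamma> \<tau>"
    using assms by simp
qed

text \<open>Right translation by the inverse of \<open>\<sigma>\<close>; it reindexes a convolution
  sum over the fibre of \<open>gran G \<sigma>\<close> by the fibre that contains
  \<open>\<sigma>\<close>.\<close>

lemma bij_gdiv:
  assumes "\<sigma> \<in> source_fibre G x"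
  shows "bij_betw (\<lambda>\<tau>. gdiv G \<tau> \<sigma>) (source_fibre G x) (source_fibre G (gran G \<sigma>))"
proof (rule bij_betw_byWitness[where f' = "\<lambda>\<tau>. gmul G \<tau> \<sigma>"])
qed (use assms in \<open>auto simp: gran_def[symmetric]\<close>)

end

section \<open>Topology of etale groupoids\<close>

lemma continuous_map_euclidean_compose:
  assumes "continuous_map X euclidean f" "continuous_on UNIV F"
  shows "continuous_map X euclidean (\<lambda>x. F (f x))"
  using continuous_map_compose[OF assms(1), of euclidean F] assms(2) by (simp add: o_def)

lemma continuous_map_mult_algebra:
  fixes f g :: "'a \<Rightarrow> 'b::real_normed_algebra"
  assumes "continuous_map X euclidean f" "continuous_map X euclidean g"
  shows "continuous_map X euclidean (\<lambda>x. f x * g x)"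
  using assms unfolding continuous_map_atin limitin_canonical_iff by (auto intro: tendsto_mult)

text \<open>The open sets \<open>U\<close> and the complement of \<open>K\<close> cover the space,
  and \<open>g\<close> is zero on the second. This is how a function given on an open set and
  extended by zero is shown to be continuous.\<close>

lemma continuous_map_locally_zero:
  fixes g :: "'a \<Rightarrow> 'b::real_normed_vector"
  assumes "openin X U" "closedin X K" "K \<subseteq> U" "continuous_map (subtopology X U) euclidean g"
    and "\<And>x. x \<in> topspace X \<Longrightarrow> g x \<noteq> 0 \<Longrightarrow> x \<in> K"
  shows "continuous_map X euclidean g"
proof (rule pasting_lemma[where I = "{True, False}" and T = "\<lambda>b. if b then U else topspace X - K"
      and f = "\<lambda>b. if b then g else (\<lambda>_. 0)"])
  show "openin X (if i then U else topspace X - K)" for i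
    using assms by (auto intro: openin_diff)
  show "continuous_map (subtopology X (if i then U else topspace X - K)) euclidean
      (if i then g else (\<lambda>_. 0))" for i
    using assms(4) by auto
  show "\<exists>j. j \<in> {True, False} \<and> x \<in> (if j then U else topspace X - K) \<and>
      g x = (if j then g else (\<lambda>_. 0)) x" if "x \<in> topspace X" for x
    using assms(3,5) that by (cases "x \<in> K") (auto intro: exI[of _ False] exI[of _ True])
qed (use assms(5) in \<open>auto split: if_splits\<close>)

lemma local_homeomorphism_open_map:
  assumes "local_homeomorphism X Y f"
  shows "open_map X Y f"
  unfolding open_map_def
proof (intro allI impI)
  fix U assume U: "openin X U"
  show "openin Y (f ` U)"
  proof (subst openin_subopen, clarify)
    fix x assume x: "x \<in> U"
    then have "x \<in> topspace X" using U openin_subset by blast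
    then obtain V where V: "openin X V" "x \<in> V" "openin Y (f ` V)"
      "homeomorphic_map (subtopology X V) (subtopology Y (f ` V)) f"
      using assms unfolding local_homeomorphism_def by blast
    have "openin (subtopology X V) (U \<inter> V)"
      using U V by (simp add: openin_subtopology_Int)
    then have "openin (subtopology Y (f ` V)) (f ` (U \<inter> V))"
      using homeomorphic_imp_open_map[OF V(4)] unfolding open_map_def by blast
    then have "openin Y (f ` (U \<inter> V))" using V(3) openin_trans_full by blast
    then show "\<exists>T. openin Y T \<and> f x \<in> T \<and> T \<subseteq> f ` U" using x V by blast
  qed
qed

text \<open>In an etale groupoid domain and range are continuous open maps, so injectivity already
  makes them homeomorphisms from \<open>U\<close> onto open sets of units.\<close>

definition bisection :: "'a top_groupoid \<Rightarrow> 'a set \<Rightarrow> bool" where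
  "bisection G U \<longleftrightarrow> openin (gtop G) U \<and> inj_on (gdom G) U \<and> inj_on (gran G) U"

locale etale_grpd = grpd G for G :: "'a top_groupoid" +
  assumes topological: "topological_groupoid G" and Hausdorff: "Hausdorff_space (gtop G)"
    and etale: "etale G" and compact: "compact_space (unit_top G)"
begin

lemma continuous_mul:
  "continuous_map (subtopology (prod_topology (gtop G) (gtop G)) (gcomp G)) (gtop G)
     (\<lambda>(\<gamma>, \<sigma>). gmul G \<gamma> \<sigma>)"
  and continuous_inv: "continuous_map (gtop G) (gtop G) (ginv G)"
  using topological by (auto simp: topological_groupoid_def)

lemma continuous_mul_compose:
  assumes "continuous_map X (gtop G) a" "continuous_map X (gtop G) b"
    and "\<And>x. x \<in> topspace X \<Longrightarrow> gdom G (a x) = gran G (b x)"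
  shows "continuous_map X (gtop G) (\<lambda>x. gmul G (a x) (b x))"
proof -
  have "continuous_map X (subtopology (prod_topology (gtop G) (gtop G)) (gcomp G)) (\<lambda>x. (a x, b x))"
    using assms continuous_map_image_subset_topspace[OF assms(1)]
      continuous_map_image_subset_topspace[OF assms(2)]
    by (intro continuous_map_into_subtopology continuous_map_pairedI) (auto simp: comp_iff image_subset_iff Pi_iff)
  from continuous_map_compose[OF this continuous_mul] show ?thesis by (simp add: o_def)
qed

lemma topspace_unit_top [simp]: "topspace (unit_top G) = units G"
  by (auto simp: unit_top_def)

lemma continuous_dom_unit: "continuous_map (gtop G) (unit_top G) (gdom G)"
  and continuous_ran_unit: "continuous_map (gtop G) (unit_top G) (gran G)"
  using etale by (auto simp: etale_def local_homeomorphism_def)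

lemma continuous_dom: "continuous_map (gtop G) (gtop G) (gdom G)"
  and continuous_ran: "continuous_map (gtop G) (gtop G) (gran G)"
  using continuous_dom_unit continuous_ran_unit
  unfolding unit_top_def by (simp_all only: continuous_map_in_subtopology)

lemma closedin_units: "closedin (gtop G) (units G)"
proof -
  have "units G = {x \<in> topspace (gtop G). gdom G x = id x}"
    unfolding id_apply using units_iff by blast
  then show ?thesis
    using closedin_continuous_maps_eq[OF Hausdorff continuous_dom continuous_map_id] by (simp only:)
qed

lemma ex_bisection:
  assumes "openin (gtop G) W" "\<gamma> \<in> W"
  shows "\<exists>U. bisection G U \<and> \<gamma> \<in> U \<and> U \<subseteq> W"
proof -
  have g: "\<gamma> \<in> topspace (gtop G)" using assms openin_subset by blast
  obtain U where U: "openin (gtop G) U" "\<gamma> \<in> U" 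
     "homeomorphic_map (subtopology (gtop G) U) (subtopology (unit_top G) (gdom G ` U)) (gdom G)"
    using etale g unfolding etale_def local_homeomorphism_def by blast
  obtain V where V: "openin (gtop G) V" "\<gamma> \<in> V" 
     "homeomorphic_map (subtopology (gtop G) V) (subtopology (unit_top G) (gran G ` V)) (gran G)"
    using etale g unfolding etale_def local_homeomorphism_def by blast
  have "inj_on (gdom G) U" "inj_on (gran G) V"
    using homeomorphic_imp_injective_map[OF U(3)] homeomorphic_imp_injective_map[OF V(3)]
      openin_subset[OF U(1)] openin_subset[OF V(1)] by (simp_all add: Int_absorb1)
  then have "inj_on (gdom G) (U \<inter> V \<inter> W)" "inj_on (gran G) (U \<inter> V \<inter> W)"
    by (auto simp: inj_on_def)
  then have "bisection G (U \<inter> V \<inter> W)"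
    using U(1) V(1) assms(1) unfolding bisection_def by blast
  then show ?thesis using U V assms by blast
qed

text \<open>Near a unit, an arrow and its domain both lie in one bisection. They have the same
  domain, so they coincide, and the arrow is a unit.\<close>

lemma openin_units: "openin (gtop G) (units G)"
proof (subst openin_subopen, clarify)
  fix x assume x: "x \<in> units G"
  then obtain U where U: "bisection G U" "x \<in> U"
    using ex_bisection[of "topspace (gtop G)" x] by auto
  let ?V = "U \<inter> {\<gamma> \<in> topspace (gtop G). gdom G \<gamma> \<in> U}"
  have "openin (gtop G) ?V"
    using U openin_continuous_map_preimage[OF continuous_dom] unfolding bisection_def by blast
  moreover have "?V \<subseteq> units G"
  proof
    fix \<gamma> assume g: "\<gamma> \<in> ?V"
    then have "gdom G \<gamma> = \<gamma>"
      using U unfolding bisection_def by (auto dest: inj_onD[of _ _ "gdom G \<gamma>" \<gamma>])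
    then show "\<gamma> \<in> units G" using g units_iff[of \<gamma>] by blast
  qed
  ultimately show "\<exists>T. openin (gtop G) T \<and> x \<in> T \<and> T \<subseteq> units G" using x U by fastforce
qed

lemma bisection_units: "bisection G (units G)"
  using openin_units by (auto simp: bisection_def inj_on_def)

lemma openin_dom_image: "openin (gtop G) U \<Longrightarrow> openin (gtop G) (gdom G ` U)"
  using local_homeomorphism_open_map[of "gtop G" "unit_top G" "gdom G"] etale openin_units
  unfolding etale_def open_map_def unit_top_def by (metis openin_trans_full)

lemma compactin_units: "compactin (gtop G) (units G)"
  using compact by (auto simp: unit_top_def compactin_subspace)

lemma Hausdorff_units: "Hausdorff_space (unit_top G)"
  using Hausdorff by (simp add: unit_top_def Hausdorff_space_subtopology)

lemma normal_units: "normal_space (unit_top G)"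
  using compact Hausdorff_units compact_Hausdorff_or_regular_imp_normal_space by blast

definition section_of :: "'a set \<Rightarrow> 'a \<Rightarrow> 'a" where
  "section_of U = inv_into U (gdom G)"

text \<open>Continuity is openness of the domain map: the points that the section sends into an open
  \<open>O'\<close> form the domain image of \<open>O' \<inter> U\<close>.\<close>

lemma section_of:
  assumes "bisection G U"
  shows "continuous_map (subtopology (gtop G) (gdom G ` U)) (gtop G) (section_of U)"
    and "\<gamma> \<in> U \<Longrightarrow> section_of U (gdom G \<gamma>) = \<gamma>"
    and "x \<in> gdom G ` U \<Longrightarrow> section_of U x \<in> U"
    and "x \<in> gdom G ` U \<Longrightarrow> gdom G (section_of U x) = x"
proof -
  have U: "openin (gtop G) U" "inj_on (gdom G) U" "U \<subseteq> arrows G"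
    using assms openin_subset by (auto simp: bisection_def)
  show 1: "\<gamma> \<in> U \<Longrightarrow> section_of U (gdom G \<gamma>) = \<gamma>" for \<gamma>
    using U by (simp add: section_of_def)
  then show 2: "x \<in> gdom G ` U \<Longrightarrow> section_of U x \<in> U"
    and 3: "x \<in> gdom G ` U \<Longrightarrow> gdom G (section_of U x) = x" for x by auto
  show "continuous_map (subtopology (gtop G) (gdom G ` U)) (gtop G) (section_of U)"
    unfolding continuous_map_def
  proof (intro conjI allI impI)
    show "section_of U \<in> topspace (subtopology (gtop G) (gdom G ` U)) \<rightarrow> topspace (gtop G)"
      using 2 U by auto
    fix O' assume "openin (gtop G) O'"
    then have "openin (gtop G) (gdom G ` (O' \<inter> U))" using U openin_dom_image by blast
    moreover have "{x \<in> topspace (subtopology (gtop G) (gdom G ` U)). section_of U x \<in> O'} =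
        gdom G ` (O' \<inter> U)"
      using 1 U by (auto 0 3)
    ultimately show "openin (subtopology (gtop G) (gdom G ` U))
        {x \<in> topspace (subtopology (gtop G) (gdom G ` U)). section_of U x \<in> O'}"
      by (simp add: openin_open_subtopology openin_dom_image U image_mono)
  qed
qed

text \<open>Urysohn's lemma is applied on the unit space, which is compact Hausdorff and hence
  normal. The function obtained there on the domain of a bisection is carried to the bisection along
  the domain map.\<close>

lemma real_bump:
  assumes "openin (gtop G) W" "\<gamma> \<in> W"
  obtains k :: "'a \<Rightarrow> real" and K U where
    "continuous_map (gtop G) euclidean k" "\<And>\<sigma>. 0 \<le> k \<sigma>" "0 < k \<gamma>"
    "\<And>\<sigma>. k \<sigma> \<noteq> 0 \<Longrightarrow> \<sigma> \<in> K" "compactin (gtop G) K" "K \<subseteq> U" "U \<subseteq> W" "bisection G U"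
proof -
  obtain U where U: "bisection G U" "\<gamma> \<in> U" "U \<subseteq> W" using ex_bisection[OF assms] by blast
  then have U': "openin (gtop G) U" "U \<subseteq> arrows G" by (auto simp: bisection_def openin_subset)
  let ?V = "gdom G ` U"
  have oV: "openin (gtop G) ?V" "?V \<subseteq> units G" using U' openin_dom_image by auto
  have V: "openin (unit_top G) ?V"
    using oV unfolding unit_top_def by (simp add: openin_open_subtopology openin_units)
  have cV: "closedin (unit_top G) (units G - ?V)" using V openin_closedin_eq[of "unit_top G" "gdom G ` U"] by simp
  have x: "gdom G \<gamma> \<in> units G" using U U' by auto
  have cx: "closedin (unit_top G) {gdom G \<gamma>}"
    using closedin_Hausdorff_singleton[OF Hausdorff_units] x by simp
  have dj: "disjnt (units G - ?V) {gdom G \<gamma>}" using U by (auto simp: disjnt_def)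
  obtain f :: "'a \<Rightarrow> real" where f: "continuous_map (unit_top G) euclideanreal f"
     "f ` (units G - ?V) \<subseteq> {0}" "f ` {gdom G \<gamma>} \<subseteq> {1}"
    by (rule Urysohn_lemma_alt[OF normal_units cV cx dj])
  \<comment> \<open>Cutting at the level 1/2 gives a compact set inside the domain of
    \<open>U\<close>. Its lift contains the support of \<open>k\<close>, whose value at
    \<open>\<gamma>\<close> is still 1/2.\<close>
  define C where "C = {x \<in> units G. f x \<in> {1/2..}}"
  have C: "closedin (unit_top G) C"
    using closedin_continuous_map_preimage[OF f(1), of "{1/2..}"] by (simp add: C_def)
  then have C': "compactin (gtop G) C"
    using closedin_compact_space[OF compact C] by (simp add: unit_top_def compactin_subtopology)
  have CV: "C \<subseteq> ?V"
  proof
    fix z assume z: "z \<in> C"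
    show "z \<in> ?V"
    proof (rule ccontr)
      assume "z \<notin> ?V"
      then have "f z = 0" using f(2) z by (auto simp: C_def)
      then show False using z by (auto simp: C_def)
    qed
  qed
  let ?K = "section_of U ` C"
  have K: "compactin (gtop G) ?K"
    by (rule image_compactin[OF _ section_of(1)[OF U(1)]]) (use C' CV in \<open>simp add: compactin_subtopology\<close>)
  have KU: "?K \<subseteq> U" using CV section_of(3)[OF U(1)] by blast
  have Kc: "closedin (gtop G) ?K" using K Hausdorff compactin_imp_closedin by blast
  define k where "k = (\<lambda>\<sigma>. if \<sigma> \<in> U then max 0 (f (gdom G \<sigma>) - 1/2) else 0)"
  have k0: "\<sigma> \<in> ?K" if "k \<sigma> \<noteq> 0" for \<sigma>
  proof -
    have s: "\<sigma> \<in> U" "f (gdom G \<sigma>) \<ge> 1/2" using that by (auto simp: k_def split: if_splits)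
    then have "gdom G \<sigma> \<in> C" using U' by (auto simp: C_def)
    then show ?thesis using section_of(2)[OF U(1) s(1)] by (metis image_eqI)
  qed
  have "continuous_map (gtop G) euclidean k"
  proof (rule continuous_map_locally_zero[OF U'(1) Kc KU])
    have c1: "continuous_map (gtop G) euclideanreal (f \<circ> gdom G)"
      by (rule continuous_map_compose[OF continuous_dom_unit f(1)])
    have c2: "continuous_on UNIV (\<lambda>t::real. max 0 (t - 1/2))"
      by (intro continuous_intros)
    have "continuous_map (gtop G) euclideanreal (\<lambda>\<sigma>. max 0 (f (gdom G \<sigma>) - 1/2))"
      using continuous_map_euclidean_compose[OF c1 c2] by simp
    then have "continuous_map (subtopology (gtop G) U) euclideanreal (\<lambda>\<sigma>. max 0 (f (gdom G \<sigma>) - 1/2))"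
      by (rule continuous_map_from_subtopology)
    then show "continuous_map (subtopology (gtop G) U) euclidean k"
      by (rule continuous_map_eq) (auto simp: k_def)
  qed (use k0 in blast)
  then show ?thesis
    using that[of k ?K U] k0 K KU U f(3) by (auto simp: k_def)
qed

section \<open>Compactly supported functions and partitions of unity\<close>

lemma CcI:
  assumes "continuous_map (gtop G) euclidean f" "compactin (gtop G) K" "\<And>\<gamma>. f \<gamma> \<noteq> 0 \<Longrightarrow> \<gamma> \<in> K"
  shows "f \<in> Cc G"
proof -
  have "closedin (gtop G) K" "K \<subseteq> arrows G"
    using assms Hausdorff compactin_imp_closedin compactin_subset_topspace by blast+
  moreover have "gtop G closure_of {\<gamma> \<in> arrows G. f \<gamma> \<noteq> 0} \<subseteq> K"
    using assms calculation by (intro closure_of_minimal) auto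
  ultimately show ?thesis
    using assms(1,3) closed_compactin[OF assms(2), of "gtop G closure_of {\<gamma> \<in> arrows G. f \<gamma> \<noteq> 0}"]
    unfolding Cc_def by auto
qed

lemma CcE:
  assumes "f \<in> Cc G"
  obtains K where "compactin (gtop G) K" "\<And>\<gamma>. f \<gamma> \<noteq> 0 \<Longrightarrow> \<gamma> \<in> K"
    "continuous_map (gtop G) euclidean f"
proof (rule that)
  show "compactin (gtop G) (gtop G closure_of {\<gamma> \<in> arrows G. f \<gamma> \<noteq> 0})"
    "continuous_map (gtop G) euclidean f"
    using assms by (auto simp: Cc_def)
  show "\<gamma> \<in> gtop G closure_of {\<gamma> \<in> arrows G. f \<gamma> \<noteq> 0}" if "f \<gamma> \<noteq> 0" for \<gamma>
    using that assms closure_of_subset[of "{\<gamma> \<in> arrows G. f \<gamma> \<noteq> 0}" "gtop G"]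
    by (auto simp: Cc_def)
qed

lemma Cc_continuous: "f \<in> Cc G \<Longrightarrow> continuous_map (gtop G) euclidean f"
  and Cc_zero: "f \<in> Cc G \<Longrightarrow> \<gamma> \<notin> arrows G \<Longrightarrow> f \<gamma> = 0"
  by (auto simp: Cc_def)

lemma zero_Cc: "(\<lambda>_. 0) \<in> Cc G"
  by (auto simp: Cc_def)

lemma add_Cc: assumes "f \<in> Cc G" "g \<in> Cc G" shows "(\<lambda>\<gamma>. f \<gamma> + g \<gamma>) \<in> Cc G"
proof -
  obtain K where K: "compactin (gtop G) K" "\<And>\<gamma>. f \<gamma> \<noteq> 0 \<Longrightarrow> \<gamma> \<in> K"
    "continuous_map (gtop G) euclidean f" using CcE[OF assms(1)] by blast
  obtain L where L: "compactin (gtop G) L" "\<And>\<gamma>. g \<gamma> \<noteq> 0 \<Longrightarrow> \<gamma> \<in> L"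
    "continuous_map (gtop G) euclidean g" using CcE[OF assms(2)] by blast
  show ?thesis
  proof (rule CcI)
    show "compactin (gtop G) (K \<union> L)" using K L by (simp add: compactin_Un)
    show "\<gamma> \<in> K \<union> L" if "f \<gamma> + g \<gamma> \<noteq> 0" for \<gamma>
      using that K(2)[of \<gamma>] L(2)[of \<gamma>] by (cases "f \<gamma> = 0") auto
  qed (use K L in \<open>auto intro: continuous_map_add\<close>)
qed

lemma mult_Cc:
  assumes "f \<in> Cc G" "continuous_map (gtop G) euclidean g"
  shows "(\<lambda>\<gamma>. g \<gamma> * f \<gamma>) \<in> Cc G"
proof -
  obtain K where K: "compactin (gtop G) K" "\<And>\<gamma>. f \<gamma> \<noteq> 0 \<Longrightarrow> \<gamma> \<in> K"
    "continuous_map (gtop G) euclidean f" using CcE[OF assms(1)] by blast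
  show ?thesis
    by (rule CcI[OF continuous_map_mult_algebra[OF assms(2) K(3)] K(1)]) (use K in auto)
qed

lemma scale_Cc: "f \<in> Cc G \<Longrightarrow> (\<lambda>\<gamma>. c * f \<gamma>) \<in> Cc G"
  using mult_Cc[of f "\<lambda>_. c"] by simp

lemma Cc_units:
  assumes "continuous_map (gtop G) euclidean f" "\<And>\<gamma>. f \<gamma> \<noteq> 0 \<Longrightarrow> \<gamma> \<in> units G"
  shows "f \<in> Cc G"
  using CcI[OF assms(1) compactin_units assms(2)] .

text \<open>The open bisection \<open>U\<close> around the compact \<open>K\<close> leaves a margin,
  so that functions built along a section of \<open>U\<close> extend continuously by zero.\<close>

definition bisection_supported :: "('a \<Rightarrow> complex) \<Rightarrow> bool" where
  "bisection_supported k \<longleftrightarrow> k \<in> Cc G \<and>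
     (\<exists>K U. compactin (gtop G) K \<and> (\<forall>\<gamma>. k \<gamma> \<noteq> 0 \<longrightarrow> \<gamma> \<in> K) \<and> K \<subseteq> U \<and> bisection G U)"

text \<open>A partition of unity. Finitely many nonnegative bumps on bisections have a sum
  \<open>s\<close> that is positive on the compact set \<open>L\<close> carrying \<open>g\<close>,
  and \<open>g\<close> is the sum of the pieces \<open>g / s * k\<close>.\<close>

lemma Cc_induct [consumes 1, case_names zero add bisection]:
  assumes g: "g \<in> Cc G" and P0: "P (\<lambda>_. 0)"
    and Padd: "\<And>f g. f \<in> Cc G \<Longrightarrow> g \<in> Cc G \<Longrightarrow> P f \<Longrightarrow> P g \<Longrightarrow> P (\<lambda>\<gamma>. f \<gamma> + g \<gamma>)"
    and Pbis: "\<And>k. bisection_supported k \<Longrightarrow> P k"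
  shows "P g"
proof -
  obtain L where L: "compactin (gtop G) L" "\<And>\<gamma>. g \<gamma> \<noteq> 0 \<Longrightarrow> \<gamma> \<in> L"
    "continuous_map (gtop G) euclidean g" using CcE[OF g] by blast
  have LG: "L \<subseteq> arrows G" using L compactin_subset_topspace by blast
  define B where "B = {k :: 'a \<Rightarrow> real. continuous_map (gtop G) euclidean k \<and> (\<forall>\<sigma>. 0 \<le> k \<sigma>) \<and>
    (\<exists>K U. compactin (gtop G) K \<and> (\<forall>\<gamma>. k \<gamma> \<noteq> 0 \<longrightarrow> \<gamma> \<in> K) \<and> K \<subseteq> U \<and> bisection G U)}"
  let ?O = "\<lambda>k :: 'a \<Rightarrow> real. {\<gamma> \<in> arrows G. k \<gamma> \<in> {0<..}}"
  have "\<exists>F. finite F \<and> F \<subseteq> ?O ` B \<and> L \<subseteq> \<Union> F"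
  proof -
    have "\<And>V. V \<in> ?O ` B \<Longrightarrow> openin (gtop G) V"
      using openin_continuous_map_preimage[of "gtop G" euclideanreal _ "{0<..}"]
      by (fastforce simp: B_def)
    moreover have "L \<subseteq> \<Union> (?O ` B)"
    proof
      fix \<gamma> assume "\<gamma> \<in> L"
      then have g: "\<gamma> \<in> topspace (gtop G)" using LG by blast
      obtain k :: "'a \<Rightarrow> real" and K U where
        "continuous_map (gtop G) euclidean k" "\<And>\<sigma>. 0 \<le> k \<sigma>" "0 < k \<gamma>"
        "\<And>\<sigma>. k \<sigma> \<noteq> 0 \<Longrightarrow> \<sigma> \<in> K" "compactin (gtop G) K" "K \<subseteq> U" "bisection G U"
        using real_bump[OF openin_topspace g] by metis
      then have "k \<in> B" "\<gamma> \<in> ?O k" using g unfolding B_def by blast+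
      then show "\<gamma> \<in> \<Union> (?O ` B)" by blast
    qed
    ultimately show ?thesis using L(1) unfolding compactin_def by meson
  qed
  then obtain F where F: "finite F" "F \<subseteq> ?O ` B" "L \<subseteq> \<Union> F" by blast
  obtain I where I: "I \<subseteq> B" "finite I" "F = ?O ` I"
    using finite_subset_image[OF F(1,2)] by blast
  then have I: "finite I" "I \<subseteq> B" "L \<subseteq> \<Union> (?O ` I)" using F by auto
  define s where "s = (\<lambda>\<gamma>. \<Sum>k\<in>I. k \<gamma>)"
  have sL: "s \<gamma> > 0" if \<gamma>: "\<gamma> \<in> L" for \<gamma>
  proof -
    obtain k where k: "k \<in> I" "k \<gamma> > 0" using I(3) \<gamma> by auto
    show ?thesis unfolding s_def using k I by (intro sum_pos2[of I k]) (auto simp: B_def)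
  qed
  have sc: "continuous_map (gtop G) euclidean s"
    unfolding s_def using I by (intro continuous_map_sum) (auto simp: B_def)
  \<comment> \<open>Where \<open>s\<close> vanishes so does \<open>g\<close>, hence \<open>q\<close>
    is zero there. Continuity holds because the closed set \<open>L\<close>, outside which
    \<open>q\<close> vanishes, lies in the open set where \<open>s\<close> is positive.\<close>
  define q where "q = (\<lambda>\<gamma>. g \<gamma> / of_real (s \<gamma>))"
  have qc: "continuous_map (gtop G) euclidean q"
  proof (rule continuous_map_locally_zero)
    show "openin (gtop G) {\<gamma> \<in> arrows G. s \<gamma> \<in> {0<..}}"
      using sc by (intro openin_continuous_map_preimage[where Y = euclideanreal]) auto
    show "closedin (gtop G) L" using L Hausdorff compactin_imp_closedin by blast
    show "L \<subseteq> {\<gamma> \<in> arrows G. s \<gamma> \<in> {0<..}}" using sL LG by auto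
    have "continuous_map (subtopology (gtop G) {\<gamma> \<in> arrows G. s \<gamma> \<in> {0<..}}) euclidean g"
      using L(3) continuous_map_from_subtopology by blast
    moreover have "continuous_map (subtopology (gtop G) {\<gamma> \<in> arrows G. s \<gamma> \<in> {0<..}}) euclidean s"
      using sc continuous_map_from_subtopology by blast
    ultimately show "continuous_map (subtopology (gtop G) {\<gamma> \<in> arrows G. s \<gamma> \<in> {0<..}}) euclidean q"
      unfolding q_def continuous_map_atin limitin_canonical_iff
      by (fastforce intro!: tendsto_divide tendsto_of_real)
  qed (use L(2) in \<open>auto simp: q_def\<close>)
  have bs: "bisection_supported (\<lambda>\<gamma>. q \<gamma> * of_real (k \<gamma>))" if k: "k \<in> I" for k
  proof -
    obtain K U where K: "compactin (gtop G) K" "\<forall>\<gamma>. k \<gamma> \<noteq> 0 \<longrightarrow> \<gamma> \<in> K" "K \<subseteq> U" "bisection G U"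
      "continuous_map (gtop G) euclidean k"
      using I(2) k unfolding B_def by blast
    have "continuous_map (gtop G) euclidean (\<lambda>\<gamma>. of_real (k \<gamma>) :: complex)"
      by (rule continuous_map_euclidean_compose[OF K(5)]) (intro continuous_intros)
    then have "(\<lambda>\<gamma>. q \<gamma> * of_real (k \<gamma>)) \<in> Cc G"
      using K by (intro CcI[OF continuous_map_mult_algebra[OF qc] K(1)]) auto
    moreover have "\<forall>\<gamma>. q \<gamma> * of_real (k \<gamma>) \<noteq> 0 \<longrightarrow> \<gamma> \<in> K" using K(2) by auto
    ultimately show ?thesis
      unfolding bisection_supported_def using K(1,3,4) by blast
  qed
  have "(\<lambda>\<gamma>. \<Sum>k\<in>J. q \<gamma> * of_real (k \<gamma>)) \<in> Cc G \<and> P (\<lambda>\<gamma>. \<Sum>k\<in>J. q \<gamma> * of_real (k \<gamma>))"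
    if "J \<subseteq> I" for J
  proof -
    have "finite J" using that I finite_subset by blast
    then show ?thesis using that
    proof (induction J)
      case empty
      then show ?case using P0 zero_Cc by simp
    next
      case (insert k J)
      have "bisection_supported (\<lambda>\<gamma>. q \<gamma> * of_real (k \<gamma>))" using insert bs by auto
      then show ?case
        using insert Padd[OF _ _ Pbis, of "\<lambda>\<gamma>. q \<gamma> * of_real (k \<gamma>)" "\<lambda>\<gamma>. \<Sum>k\<in>J. q \<gamma> * of_real (k \<gamma>)"]
          add_Cc[of "\<lambda>\<gamma>. q \<gamma> * of_real (k \<gamma>)" "\<lambda>\<gamma>. \<Sum>k\<in>J. q \<gamma> * of_real (k \<gamma>)"]
        by (auto simp: bisection_supported_def)
    qed
  qed
  from this[OF order_refl] have "P (\<lambda>\<gamma>. \<Sum>k\<in>I. q \<gamma> * of_real (k \<gamma>))" by blast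
  moreover have "(\<lambda>\<gamma>. \<Sum>k\<in>I. q \<gamma> * of_real (k \<gamma>)) = g"
  proof
    fix \<gamma>
    have "(\<Sum>k\<in>I. q \<gamma> * of_real (k \<gamma>)) = q \<gamma> * of_real (s \<gamma>)"
      by (simp add: s_def sum_distrib_left)
    also have "\<dots> = g \<gamma>" using sL[of \<gamma>] L(2)[of \<gamma>] by (cases "g \<gamma> = 0") (auto simp: q_def)
    finally show "(\<Sum>k\<in>I. q \<gamma> * of_real (k \<gamma>)) = g \<gamma>" .
  qed
  ultimately show ?thesis by simp
qed

text \<open>A bisection meets each fibre of the domain map at most once, and \<open>g\<close> is a
  finite sum of functions on bisections.\<close>

lemma finite_Cc_fibre:
  assumes "g \<in> Cc G"
  shows "finite {\<sigma> \<in> source_fibre G x. g \<sigma> \<noteq> 0}"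
  using assms
proof (induction rule: Cc_induct)
  case (add f g)
  show ?case by (rule finite_subset[OF _ finite_UnI[OF add(3,4)]]) auto
next
  case (bisection k)
  then obtain U where U: "\<And>\<gamma>. k \<gamma> \<noteq> 0 \<Longrightarrow> \<gamma> \<in> U" "inj_on (gdom G) U"
    unfolding bisection_supported_def bisection_def by blast
  have "inj_on (gdom G) {\<sigma> \<in> source_fibre G x. k \<sigma> \<noteq> 0}"
    by (rule inj_on_subset[OF U(2)]) (use U in auto)
  then show ?case by (rule inj_on_finite[of _ _ "{x}"]) auto
qed simp

section \<open>Convolution of compactly supported functions\<close>

lemma convolution_single:
  assumes "\<gamma> \<in> arrows G" "\<sigma> \<in> arrows G" "gdom G \<sigma> = gdom G \<gamma>"
    and "\<And>\<tau>. \<tau> \<in> arrows G \<Longrightarrow> gdom G \<tau> = gdom G \<gamma> \<Longrightarrow> f (gdiv G \<gamma> \<tau>) \<noteq> 0 \<Longrightarrow> g \<tau> \<noteq> 0 \<Longrightarrow> \<tau> = \<sigma>"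
  shows "convolution G f g \<gamma> = f (gdiv G \<gamma> \<sigma>) * g \<sigma>"
proof -
  have "(\<Sum>\<^sub>\<infinity>\<tau>\<in>source_fibre G (gdom G \<gamma>). f (gdiv G \<gamma> \<tau>) * g \<tau>) = (\<Sum>\<^sub>\<infinity>\<tau>\<in>{\<sigma>}. f (gdiv G \<gamma> \<tau>) * g \<tau>)"
  proof (rule infsum_cong_neutral)
    fix \<tau> assume t: "\<tau> \<in> source_fibre G (gdom G \<gamma>) - {\<sigma>}"
    then show "f (gdiv G \<gamma> \<tau>) * g \<tau> = 0" using assms(4)[of \<tau>] by auto
  qed (use assms(2,3) in auto)
  then show ?thesis using assms(1) by (simp add: convolution_def)
qed

lemma convolution_nonzero:
  assumes "convolution G f g \<gamma> \<noteq> 0"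
  obtains \<sigma> where "\<gamma> \<in> arrows G" "\<sigma> \<in> arrows G" "gdom G \<sigma> = gdom G \<gamma>" "f (gdiv G \<gamma> \<sigma>) \<noteq> 0" "g \<sigma> \<noteq> 0"
proof -
  have g: "\<gamma> \<in> arrows G" using assms by (auto simp: convolution_def split: if_splits)
  have "\<exists>\<sigma>\<in>source_fibre G (gdom G \<gamma>). f (gdiv G \<gamma> \<sigma>) * g \<sigma> \<noteq> 0"
  proof (rule ccontr)
    assume "\<not> ?thesis"
    then have "(\<Sum>\<^sub>\<infinity>\<sigma>\<in>source_fibre G (gdom G \<gamma>). f (gdiv G \<gamma> \<sigma>) * g \<sigma>) = 0"
      by (intro infsum_0) auto
    then show False using assms g by (simp add: convolution_def)
  qed
  then show ?thesis using that g by auto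
qed

text \<open>At \<open>\<gamma>\<close> only one term survives, at the point of \<open>U\<close> over
  the domain of \<open>\<gamma>\<close>, and this point depends continuously on
  \<open>\<gamma>\<close>. The support lies in the set of products of \<open>L\<close> and
  \<open>K\<close>, which is compact because composability is a closed condition on pairs.\<close>

lemma convolution_Cc_bisection:
  assumes f: "f \<in> Cc G" and k: "bisection_supported k"
  shows "convolution G f k \<in> Cc G"
proof -
  obtain K U where K: "compactin (gtop G) K" "\<And>\<gamma>. k \<gamma> \<noteq> 0 \<Longrightarrow> \<gamma> \<in> K" "K \<subseteq> U" "bisection G U"
    "k \<in> Cc G" using k unfolding bisection_supported_def by blast
  obtain L where L: "compactin (gtop G) L" "\<And>\<gamma>. f \<gamma> \<noteq> 0 \<Longrightarrow> \<gamma> \<in> L"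
    "continuous_map (gtop G) euclidean f" using CcE[OF f] by blast
  have U: "U \<subseteq> arrows G" "openin (gtop G) U" "inj_on (gdom G) U"
    using K(4) openin_subset by (auto simp: bisection_def)
  let ?V = "{\<gamma> \<in> arrows G. gdom G \<gamma> \<in> gdom G ` U}"
  let ?C = "{\<gamma> \<in> arrows G. gdom G \<gamma> \<in> gdom G ` K}"
  let ?s = "\<lambda>\<gamma>. section_of U (gdom G \<gamma>)"
  note sec = section_of[OF K(4)]
  have conv: "convolution G f k \<gamma> = f (gdiv G \<gamma> (?s \<gamma>)) * k (?s \<gamma>)" if "\<gamma> \<in> ?V" for \<gamma>
  proof (rule convolution_single)
    fix \<tau> assume "gdom G \<tau> = gdom G \<gamma>" "k \<tau> \<noteq> 0"
    then show "\<tau> = ?s \<gamma>" using sec(2)[of \<tau>] K by auto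
  qed (use that sec(3,4)[of "gdom G \<gamma>"] U in auto)
  have cont: "continuous_map (gtop G) euclidean (convolution G f k)"
  proof (rule continuous_map_locally_zero)
    show oV: "openin (gtop G) ?V"
      using openin_continuous_map_preimage[OF continuous_dom openin_dom_image[OF U(2)]] .
    have "compactin (gtop G) (gdom G ` K)" using image_compactin[OF K(1) continuous_dom] .
    then have "closedin (gtop G) (gdom G ` K)" using Hausdorff compactin_imp_closedin by blast
    from closedin_continuous_map_preimage[OF continuous_dom this]
    show "closedin (gtop G) ?C" .
    show "?C \<subseteq> ?V" using K by auto
    have cs: "continuous_map (subtopology (gtop G) ?V) (gtop G) ?s"
    proof -
      have "continuous_map (subtopology (gtop G) ?V) (subtopology (gtop G) (gdom G ` U)) (gdom G)"
        by (intro continuous_map_into_subtopology continuous_map_from_subtopology continuous_dom) auto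
      from continuous_map_compose[OF this sec(1)] show ?thesis by (simp add: o_def)
    qed
    have ci: "continuous_map (subtopology (gtop G) ?V) (gtop G) (\<lambda>\<gamma>. ginv G (?s \<gamma>))"
      using continuous_map_compose[OF cs continuous_inv] by (simp add: o_def)
    have ct: "continuous_map (subtopology (gtop G) ?V) (gtop G) (\<lambda>\<gamma>. \<gamma>)"
      using continuous_map_from_subtopology[OF continuous_map_id] by (simp add: id_def)
    have cd: "continuous_map (subtopology (gtop G) ?V) (gtop G) (\<lambda>\<gamma>. gdiv G \<gamma> (?s \<gamma>))"
    proof (rule continuous_mul_compose[OF ct ci])
      fix \<gamma> assume "\<gamma> \<in> topspace (subtopology (gtop G) ?V)"
      then have g: "gdom G \<gamma> \<in> gdom G ` U" by auto
      then have "?s \<gamma> \<in> arrows G" using sec(3)[OF g] U by blast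
      then show "gdom G \<gamma> = gran G (ginv G (?s \<gamma>))" using sec(4)[OF g] by simp
    qed
    have "continuous_map (subtopology (gtop G) ?V) euclidean (\<lambda>\<gamma>. f (gdiv G \<gamma> (?s \<gamma>)) * k (?s \<gamma>))"
      using continuous_map_mult_algebra[OF continuous_map_compose[OF cd L(3)]
          continuous_map_compose[OF cs Cc_continuous[OF K(5)]]] by (simp add: o_def)
    then show "continuous_map (subtopology (gtop G) ?V) euclidean (convolution G f k)"
      by (rule continuous_map_eq) (use conv in auto)
    show "\<gamma> \<in> ?C" if nz: "convolution G f k \<gamma> \<noteq> 0" for \<gamma>
    proof -
      obtain \<sigma> where "\<gamma> \<in> arrows G" "gdom G \<sigma> = gdom G \<gamma>" "k \<sigma> \<noteq> 0"
        using convolution_nonzero[OF nz] by metis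
      then show ?thesis using K(2)[of \<sigma>] by (metis (mono_tags, lifting) image_eqI mem_Collect_eq)
    qed
  qed
  let ?LK = "(L \<times> K) \<inter> gcomp G"
  let ?GG = "prod_topology (gtop G) (gtop G)"
  have LK: "L \<subseteq> arrows G" "K \<subseteq> arrows G" using L K compactin_subset_topspace by blast+
  have closed: "closedin ?GG (gcomp G)"
  proof -
    have "gcomp G = {z \<in> topspace ?GG. (gdom G \<circ> fst) z = (gran G \<circ> snd) z}"
      by (auto simp: comp_iff)
    moreover have "closedin ?GG {z \<in> topspace ?GG. (gdom G \<circ> fst) z = (gran G \<circ> snd) z}"
      by (intro closedin_continuous_maps_eq[OF Hausdorff] continuous_map_compose[where X' = "gtop G"]
          continuous_map_fst continuous_map_snd continuous_dom continuous_ran)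
    ultimately show ?thesis by simp
  qed
  have "compactin ?GG ?LK"
    using L K closed by (intro compact_Int_closedin) (auto simp: compactin_Times)
  then have "compactin (subtopology ?GG (gcomp G)) ?LK"
    by (simp add: compactin_subtopology)
  then have "compactin (gtop G) ((\<lambda>(\<gamma>, \<sigma>). gmul G \<gamma> \<sigma>) ` ?LK)"
    by (rule image_compactin[OF _ continuous_mul])
  then show ?thesis
  proof (rule CcI[OF cont])
    fix \<gamma> assume nz: "convolution G f k \<gamma> \<noteq> 0"
    obtain \<sigma> where s: "\<gamma> \<in> arrows G" "\<sigma> \<in> arrows G" "gdom G \<sigma> = gdom G \<gamma>" "f (gdiv G \<gamma> \<sigma>) \<noteq> 0" "k \<sigma> \<noteq> 0"
      using convolution_nonzero[OF nz] by metis
    then have "(gdiv G \<gamma> \<sigma>, \<sigma>) \<in> ?LK" "\<gamma> = gmul G (gdiv G \<gamma> \<sigma>) \<sigma>"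
      using K(2)[of \<sigma>] L(2)[of "gdiv G \<gamma> \<sigma>"] by (auto simp: comp_iff)
    then show "\<gamma> \<in> (\<lambda>(\<gamma>, \<sigma>). gmul G \<gamma> \<sigma>) ` ?LK" by (metis (mono_tags, lifting) case_prod_conv image_eqI)
  qed
qed

lemma convolution_Cc:
  assumes f: "f \<in> Cc G" and g: "g \<in> Cc G"
  shows "convolution G f g \<in> Cc G"
  using g
proof (induction rule: Cc_induct)
  case zero
  have "convolution G f (\<lambda>_. 0) = (\<lambda>_. 0)" by (auto simp: convolution_def)
  then show ?case using zero_Cc by simp
next
  case (add h k)
  have "convolution G f (\<lambda>\<gamma>. h \<gamma> + k \<gamma>) = (\<lambda>\<gamma>. convolution G f h \<gamma> + convolution G f k \<gamma>)"
  proof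
    fix \<gamma>
    have s: "(\<lambda>\<sigma>. f (gdiv G \<gamma> \<sigma>) * u \<sigma>) summable_on source_fibre G x" if "u \<in> Cc G" for u x
    proof -
      have "(\<lambda>\<sigma>. f (gdiv G \<gamma> \<sigma>) * u \<sigma>) summable_on {\<sigma> \<in> source_fibre G x. u \<sigma> \<noteq> 0}"
        using finite_Cc_fibre[OF that] by simp
      then show ?thesis by (rule summable_on_cong_neutral[THEN iffD1, rotated -1]) auto
    qed
    show "convolution G f (\<lambda>\<gamma>. h \<gamma> + k \<gamma>) \<gamma> = convolution G f h \<gamma> + convolution G f k \<gamma>"
      using infsum_add[OF s[OF add(1)] s[OF add(2)]]
      by (simp add: convolution_def distrib_left)
  qed
  then show ?case using add_Cc[OF add(3,4)] by simp
next
  case (bisection k)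
  then show ?case using convolution_Cc_bisection f by blast
qed

end

section \<open>Finite matrix bounds for the left regular representations\<close>

text \<open>Convexity up to the boundary point 0. If \<open>x\<close> or \<open>y\<close> is 0, the
  claim reduces to \<open>(v * z) powr p \<le> v * z powr p\<close>, which follows from
  \<open>v powr p \<le> v\<close> on the unit interval.\<close>

lemma powr_convex_nonneg:
  fixes x y u p :: real
  assumes "1 \<le> p" "0 \<le> x" "0 \<le> y" "0 \<le> u" "u \<le> 1"
  shows "(u * x + (1 - u) * y) powr p \<le> u * x powr p + (1 - u) * y powr p"
proof -
  have small: "(v * z) powr p \<le> v * z powr p" if "0 \<le> v" "v \<le> 1" "0 \<le> z" for v z :: real
  proof -
    have "v powr p \<le> v powr 1" using that assms(1) by (intro powr_mono') auto
    then have "v powr p \<le> v" using that by simp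
    then have "v powr p * z powr p \<le> v * z powr p" using that by (intro mult_right_mono) auto
    then show ?thesis using that by (simp add: powr_mult)
  qed
  show ?thesis
  proof (cases "x = 0 \<or> y = 0")
    case True
    then show ?thesis using small[of u x] small[of "1 - u" y] assms by auto
  next
    case False
    then show ?thesis
      using convex_onD[OF powr_convex[OF assms(1)], of "1 - u" x y] assms by simp
  qed
qed

lemma infsum_sum:
  fixes h :: "'b \<Rightarrow> 'a \<Rightarrow> complex"
  assumes "finite F" "\<And>j. j \<in> F \<Longrightarrow> (\<lambda>i. h i j) summable_on A"
  shows "(\<Sum>\<^sub>\<infinity>i\<in>A. \<Sum>j\<in>F. h i j) = (\<Sum>j\<in>F. \<Sum>\<^sub>\<infinity>i\<in>A. h i j)"
proof -
  have "(\<lambda>i. \<Sum>j\<in>F. h i j) summable_on A \<and>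
      (\<Sum>\<^sub>\<infinity>i\<in>A. \<Sum>j\<in>F. h i j) = (\<Sum>j\<in>F. \<Sum>\<^sub>\<infinity>i\<in>A. h i j)"
    using assms by (induction F) (auto simp: infsum_add summable_on_add)
  then show ?thesis ..
qed

section \<open>Norms of finite families and Minkowski's inequality\<close>

definition lpn :: "real \<Rightarrow> 'a set \<Rightarrow> ('a \<Rightarrow> complex) \<Rightarrow> real" where
  "lpn p E \<xi> = (\<Sum>i\<in>E. cmod (\<xi> i) powr p) powr (1 / p)"

lemma lpn_nonneg [simp]: "0 \<le> lpn p E \<xi>"
  by (simp add: lpn_def)

lemma lpn_powr: "1 \<le> p \<Longrightarrow> lpn p E \<xi> powr p = (\<Sum>i\<in>E. cmod (\<xi> i) powr p)"
  by (simp add: lpn_def powr_powr sum_nonneg)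

lemma lpn_le_iff:
  assumes "1 \<le> p" "0 \<le> B"
  shows "lpn p E \<xi> \<le> B \<longleftrightarrow> (\<Sum>i\<in>E. cmod (\<xi> i) powr p) \<le> B powr p"
  using assms powr_mono2[of p "lpn p E \<xi>" B] powr_less_mono2[of p B "lpn p E \<xi>"]
  by (force simp: lpn_powr[symmetric])

lemma lpn_mono_norm:
  assumes "1 \<le> p" "\<And>i. i \<in> E \<Longrightarrow> cmod (\<xi> i) \<le> cmod (\<eta> i)"
  shows "lpn p E \<xi> \<le> lpn p E \<eta>"
  unfolding lpn_def using assms
  by (intro powr_mono2 sum_mono sum_nonneg) auto

lemma lpn_cong: "(\<And>i. i \<in> E \<Longrightarrow> cmod (\<xi> i) = cmod (\<eta> i)) \<Longrightarrow> lpn p E \<xi> = lpn p E \<eta>"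
  unfolding lpn_def by (metis (mono_tags, lifting) sum.cong)

lemma lpn_mono_set: "1 \<le> p \<Longrightarrow> finite F \<Longrightarrow> E \<subseteq> F \<Longrightarrow> lpn p E \<xi> \<le> lpn p F \<xi>"
  unfolding lpn_def by (intro powr_mono2 sum_mono2 sum_nonneg) auto

lemma lpn_single [simp]: "1 \<le> p \<Longrightarrow> lpn p {i} \<xi> = cmod (\<xi> i)"
  by (simp add: lpn_def powr_powr)

lemma lpn_scale: "1 \<le> p \<Longrightarrow> lpn p E (\<lambda>i. c * \<xi> i) = cmod c * lpn p E \<xi>"
  by (simp add: lpn_def norm_mult powr_mult sum_distrib_left[symmetric] powr_powr sum_nonneg)

lemma lpn_zero_iff: "1 \<le> p \<Longrightarrow> finite E \<Longrightarrow> lpn p E \<xi> = 0 \<longleftrightarrow> (\<forall>i\<in>E. \<xi> i = 0)"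
  by (simp add: lpn_def sum_nonneg_eq_0_iff)

text \<open>Minkowski's inequality from convexity of the power function: up to the factor
  \<open>s + t\<close>, the sum is a convex combination of the two normalised vectors, with weights
  proportional to their norms. A zero norm is treated apart because normalising divides by
  it.\<close>

lemma lpn_triangle:
  assumes p: "1 \<le> p" and E: "finite E"
  shows "lpn p E (\<lambda>i. \<xi> i + \<eta> i) \<le> lpn p E \<xi> + lpn p E \<eta>"
proof (cases "lpn p E \<xi> = 0 \<or> lpn p E \<eta> = 0")
  case True
  then show ?thesis
  proof
    assume "lpn p E \<xi> = 0"
    then have "lpn p E (\<lambda>i. \<xi> i + \<eta> i) = lpn p E \<eta>" using lpn_zero_iff[OF p E] by (intro lpn_cong) auto
    then show ?thesis by simp
  next
    assume "lpn p E \<eta> = 0"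
    then have "lpn p E (\<lambda>i. \<xi> i + \<eta> i) = lpn p E \<xi>" using lpn_zero_iff[OF p E] by (intro lpn_cong) auto
    then show ?thesis by simp
  qed
next
  case False
  define s t u where "s = lpn p E \<xi>" and "t = lpn p E \<eta>" and "u = s / (s + t)"
  have st: "s > 0" "t > 0" using False lpn_nonneg[of p E] by (auto simp: s_def t_def less_le)
  have u: "0 \<le> u" "u \<le> 1" using st by (auto simp: u_def)
  have u1: "(s + t) * u = s" "(s + t) * (1 - u) = t" using st by (simp_all add: u_def field_simps)
  have "(\<Sum>i\<in>E. cmod (\<xi> i + \<eta> i) powr p) \<le>
      (\<Sum>i\<in>E. (s + t) powr p * (u * (cmod (\<xi> i) powr p / s powr p) + (1 - u) * (cmod (\<eta> i) powr p / t powr p)))"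
  proof (rule sum_mono)
    fix i
    have "cmod (\<xi> i + \<eta> i) powr p \<le> (cmod (\<xi> i) + cmod (\<eta> i)) powr p"
      using p by (intro powr_mono2 norm_triangle_ineq) auto
    also have "cmod (\<xi> i) + cmod (\<eta> i) = (s + t) * (u * (cmod (\<xi> i) / s) + (1 - u) * (cmod (\<eta> i) / t))"
      using st by (simp add: distrib_left mult.assoc[symmetric] u1 del: mult_cancel_right1)
    also have "\<dots> powr p = (s + t) powr p * (u * (cmod (\<xi> i) / s) + (1 - u) * (cmod (\<eta> i) / t)) powr p"
      using st u by (intro powr_mult)
    also have "\<dots> \<le> (s + t) powr p * (u * (cmod (\<xi> i) / s) powr p + (1 - u) * (cmod (\<eta> i) / t) powr p)"
      using st u p by (intro mult_left_mono powr_convex_nonneg) auto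
    finally show "cmod (\<xi> i + \<eta> i) powr p \<le> (s + t) powr p *
        (u * (cmod (\<xi> i) powr p / s powr p) + (1 - u) * (cmod (\<eta> i) powr p / t powr p))"
      using st by (simp add: powr_divide)
  qed
  also have "\<dots> = (s + t) powr p * (u * ((\<Sum>i\<in>E. cmod (\<xi> i) powr p) / s powr p) +
      (1 - u) * ((\<Sum>i\<in>E. cmod (\<eta> i) powr p) / t powr p))"
    by (simp add: sum_distrib_left sum.distrib sum_divide_distrib algebra_simps)
  also have "\<dots> = (s + t) powr p"
    using st by (simp add: s_def t_def lpn_powr[OF p, symmetric])
  finally show ?thesis using st p by (simp add: lpn_le_iff flip: s_def t_def)
qed

lemma tendsto_lpn:
  assumes "1 \<le> p" "finite E" "\<And>i. i \<in> E \<Longrightarrow> ((\<lambda>n. \<xi> n i) \<longlongrightarrow> \<eta> i) F"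
  shows "((\<lambda>n. lpn p E (\<xi> n)) \<longlongrightarrow> lpn p E \<eta>) F"
  unfolding lpn_def using assms
  by (intro tendsto_powr2 tendsto_sum tendsto_norm tendsto_const) (auto intro!: always_eventually sum_nonneg)

text \<open>The operator norm of the left regular representations, tested on finite blocks of their
  matrices and uniformly over all fibres. No summability enters, so the notion applies to arbitrary
  functions, and each single inequality looks at finitely many values.\<close>

definition opbound :: "real \<Rightarrow> 'a top_groupoid \<Rightarrow> real \<Rightarrow> ('a \<Rightarrow> complex) \<Rightarrow> bool" where
  "opbound p G C f \<longleftrightarrow> 0 \<le> C \<and> (\<forall>x\<in>units G. \<forall>E F \<xi>. finite E \<and> finite F \<and>
     E \<subseteq> source_fibre G x \<and> F \<subseteq> source_fibre G x \<longrightarrow>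
     lpn p E (\<lambda>\<gamma>. \<Sum>\<sigma>\<in>F. f (gdiv G \<gamma> \<sigma>) * \<xi> \<sigma>) \<le> C * lpn p F \<xi>)"

lemma opboundI:
  assumes "0 \<le> C" "\<And>x E F \<xi>. x \<in> units G \<Longrightarrow> finite E \<Longrightarrow> finite F \<Longrightarrow> E \<subseteq> source_fibre G x \<Longrightarrow>
    F \<subseteq> source_fibre G x \<Longrightarrow> lpn p E (\<lambda>\<gamma>. \<Sum>\<sigma>\<in>F. f (gdiv G \<gamma> \<sigma>) * \<xi> \<sigma>) \<le> C * lpn p F \<xi>"
  shows "opbound p G C f"
  using assms unfolding opbound_def by blast

lemma opboundD:
  assumes "opbound p G C f" "x \<in> units G" "finite E" "finite F" "E \<subseteq> source_fibre G x"
    "F \<subseteq> source_fibre G x"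
  shows "lpn p E (\<lambda>\<gamma>. \<Sum>\<sigma>\<in>F. f (gdiv G \<gamma> \<sigma>) * \<xi> \<sigma>) \<le> C * lpn p F \<xi>"
  using assms unfolding opbound_def by blast

lemma opbound_nonneg: "opbound p G C f \<Longrightarrow> 0 \<le> C"
  by (simp add: opbound_def)

locale lp_grpd = grpd G for G :: "'a top_groupoid" +
  fixes p :: real
  assumes p1: "1 \<le> p"
begin

lemma fibre_gdiv:
  "E \<subseteq> source_fibre G x \<Longrightarrow> F \<subseteq> source_fibre G x \<Longrightarrow> \<gamma> \<in> E \<Longrightarrow> \<sigma> \<in> F \<Longrightarrow> gdiv G \<gamma> \<sigma> \<in> arrows G"
  using gdiv_closed(1)[of \<gamma> \<sigma>] unfolding source_fibre_def by blast

lemma opbound_mono: "opbound p G C f \<Longrightarrow> C \<le> D \<Longrightarrow> opbound p G D f"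
  unfolding opbound_def by (meson lpn_nonneg mult_right_mono order_trans)

lemma opbound_zero: "opbound p G 0 (\<lambda>_. 0)"
  using p1 by (simp add: opbound_def lpn_def)

lemma opbound_cong:
  assumes "opbound p G C f" "\<And>\<gamma>. \<gamma> \<in> arrows G \<Longrightarrow> f \<gamma> = g \<gamma>"
  shows "opbound p G C g"
proof (rule opboundI)
  fix x E F \<xi>
  assume a: "x \<in> units G" "finite E" "finite F" "E \<subseteq> source_fibre G x" "F \<subseteq> source_fibre G x"
  have "lpn p E (\<lambda>\<gamma>. \<Sum>\<sigma>\<in>F. g (gdiv G \<gamma> \<sigma>) * \<xi> \<sigma>) = lpn p E (\<lambda>\<gamma>. \<Sum>\<sigma>\<in>F. f (gdiv G \<gamma> \<sigma>) * \<xi> \<sigma>)"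
    by (intro lpn_cong arg_cong[of _ _ cmod] sum.cong refl) (simp add: assms(2) fibre_gdiv[OF a(4,5)])
  then show "lpn p E (\<lambda>\<gamma>. \<Sum>\<sigma>\<in>F. g (gdiv G \<gamma> \<sigma>) * \<xi> \<sigma>) \<le> C * lpn p F \<xi>"
    using opboundD[OF assms(1) a] by simp
qed (use assms opbound_nonneg in blast)

text \<open>The value \<open>f \<gamma>\<close> is the entry in row \<open>\<gamma>\<close> and
  column \<open>gdom G \<gamma>\<close>. This is what turns abstract limits into functions on the
  arrows.\<close>

lemma opbound_pointwise:
  assumes "opbound p G C f" "\<gamma> \<in> arrows G"
  shows "cmod (f \<gamma>) \<le> C"
proof -
  show ?thesis
    using opboundD[OF assms(1), of "gdom G \<gamma>" "{\<gamma>}" "{gdom G \<gamma>}" "\<lambda>_. 1"] assms(2) p1 by simp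
qed

lemma opbound_add:
  assumes "opbound p G C f" "opbound p G D g"
  shows "opbound p G (C + D) (\<lambda>\<gamma>. f \<gamma> + g \<gamma>)"
proof (rule opboundI)
  fix x E F \<xi>
  assume a: "x \<in> units G" "finite E" "finite F" "E \<subseteq> source_fibre G x" "F \<subseteq> source_fibre G x"
  have "lpn p E (\<lambda>\<gamma>. \<Sum>\<sigma>\<in>F. (f (gdiv G \<gamma> \<sigma>) + g (gdiv G \<gamma> \<sigma>)) * \<xi> \<sigma>) \<le>
     lpn p E (\<lambda>\<gamma>. \<Sum>\<sigma>\<in>F. f (gdiv G \<gamma> \<sigma>) * \<xi> \<sigma>) + lpn p E (\<lambda>\<gamma>. \<Sum>\<sigma>\<in>F. g (gdiv G \<gamma> \<sigma>) * \<xi> \<sigma>)"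
    using lpn_triangle[OF p1 a(2)] by (simp add: distrib_right sum.distrib)
  also have "\<dots> \<le> C * lpn p F \<xi> + D * lpn p F \<xi>"
    using opboundD[OF assms(1) a] opboundD[OF assms(2) a] by (rule add_mono)
  finally show "lpn p E (\<lambda>\<gamma>. \<Sum>\<sigma>\<in>F. (f (gdiv G \<gamma> \<sigma>) + g (gdiv G \<gamma> \<sigma>)) * \<xi> \<sigma>) \<le> (C + D) * lpn p F \<xi>"
    by (simp add: distrib_right)
qed (use assms[THEN opbound_nonneg] in simp)

lemma opbound_scale:
  assumes "opbound p G C f"
  shows "opbound p G (cmod c * C) (\<lambda>\<gamma>. c * f \<gamma>)"
proof (rule opboundI)
  fix x E F \<xi>
  assume a: "x \<in> units G" "finite E" "finite F" "E \<subseteq> source_fibre G x" "F \<subseteq> source_fibre G x"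
  have "lpn p E (\<lambda>\<gamma>. \<Sum>\<sigma>\<in>F. c * f (gdiv G \<gamma> \<sigma>) * \<xi> \<sigma>) =
     lpn p E (\<lambda>\<gamma>. c * (\<Sum>\<sigma>\<in>F. f (gdiv G \<gamma> \<sigma>) * \<xi> \<sigma>))"
    by (simp add: sum_distrib_left mult.assoc)
  also have "\<dots> \<le> cmod c * (C * lpn p F \<xi>)"
    unfolding lpn_scale[OF p1] by (intro mult_left_mono opboundD[OF assms a]) auto
  finally show "lpn p E (\<lambda>\<gamma>. \<Sum>\<sigma>\<in>F. c * f (gdiv G \<gamma> \<sigma>) * \<xi> \<sigma>) \<le> cmod c * C * lpn p F \<xi>"
    by (simp add: mult.assoc)
qed (use assms[THEN opbound_nonneg] in simp)

text \<open>A finite block involves finitely many values, so pointwise convergence is enough to pass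
  to the limit. This takes the place of completeness of a space of operators.\<close>

lemma opbound_limit:
  assumes "\<And>n. opbound p G (C n) (f n)" "C \<longlonglongrightarrow> D" "\<And>\<gamma>. \<gamma> \<in> arrows G \<Longrightarrow> (\<lambda>n. f n \<gamma>) \<longlonglongrightarrow> g \<gamma>"
  shows "opbound p G D g"
proof (rule opboundI)
  show "0 \<le> D" using assms(1,2) opbound_nonneg by (metis LIMSEQ_le_const)
  fix x E F \<xi>
  assume a: "x \<in> units G" "finite E" "finite F" "E \<subseteq> source_fibre G x" "F \<subseteq> source_fibre G x"
  have 1: "(\<lambda>n. lpn p E (\<lambda>\<gamma>. \<Sum>\<sigma>\<in>F. f n (gdiv G \<gamma> \<sigma>) * \<xi> \<sigma>)) \<longlonglongrightarrow> lpn p E (\<lambda>\<gamma>. \<Sum>\<sigma>\<in>F. g (gdiv G \<gamma> \<sigma>) * \<xi> \<sigma>)"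
    by (intro tendsto_lpn p1 a tendsto_sum tendsto_mult tendsto_const assms(3) fibre_gdiv[OF a(4,5)])
  have 2: "(\<lambda>n. C n * lpn p F \<xi>) \<longlonglongrightarrow> D * lpn p F \<xi>"
    by (intro tendsto_intros assms)
  show "lpn p E (\<lambda>\<gamma>. \<Sum>\<sigma>\<in>F. g (gdiv G \<gamma> \<sigma>) * \<xi> \<sigma>) \<le> D * lpn p F \<xi>"
    using LIMSEQ_le[OF 1 2] opboundD[OF assms(1) a] by blast
qed

text \<open>Injectivity of the range leaves at most one nonzero entry in each row, injectivity of
  the domain at most one in each column. Such a matrix is a weighted partial permutation, whose norm
  is controlled by its largest weight.\<close>

lemma opbound_bisection:
  assumes "inj_on (gdom G) U" "inj_on (gran G) U" "\<And>\<gamma>. \<gamma> \<in> arrows G \<Longrightarrow> f \<gamma> \<noteq> 0 \<Longrightarrow> \<gamma> \<in> U"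
    and M: "\<And>\<gamma>. \<gamma> \<in> arrows G \<Longrightarrow> cmod (f \<gamma>) \<le> M" and "0 \<le> M"
  shows "opbound p G M f"
proof (rule opboundI)
  fix x E F \<xi>
  assume a: "x \<in> units G" "finite E" "finite F" "E \<subseteq> source_fibre G x" "F \<subseteq> source_fibre G x"
  let ?T = "\<lambda>\<gamma>. \<Sum>\<sigma>\<in>F. f (gdiv G \<gamma> \<sigma>) * \<xi> \<sigma>"
  define E' where "E' = {\<gamma>\<in>E. \<exists>\<sigma>\<in>F. f (gdiv G \<gamma> \<sigma>) \<noteq> 0}"
  \<comment> \<open>The column of the only nonzero entry in row \<open>\<gamma>\<close>; it is
    meaningful on \<open>E'\<close>, where such an entry exists.\<close>
  define s where "s = (\<lambda>\<gamma>. SOME \<sigma>. \<sigma> \<in> F \<and> f (gdiv G \<gamma> \<sigma>) \<noteq> 0)"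
  have s: "s \<gamma> \<in> F" "f (gdiv G \<gamma> (s \<gamma>)) \<noteq> 0" if "\<gamma> \<in> E'" for \<gamma>
    using someI_ex[of "\<lambda>\<sigma>. \<sigma> \<in> F \<and> f (gdiv G \<gamma> \<sigma>) \<noteq> 0"] that unfolding s_def E'_def by blast+
  have fib: "\<gamma> \<in> arrows G" "gdom G \<gamma> = x" if "\<gamma> \<in> E \<union> F" for \<gamma> using a that by auto
  have uniq: "\<sigma> = \<tau>" if "\<gamma> \<in> E" "\<sigma> \<in> F" "\<tau> \<in> F" "f (gdiv G \<gamma> \<sigma>) \<noteq> 0" "f (gdiv G \<gamma> \<tau>) \<noteq> 0" for \<gamma> \<sigma> \<tau>
  proof -
    have "gdiv G \<gamma> \<sigma> \<in> U" "gdiv G \<gamma> \<tau> \<in> U" using that assms(3) fibre_gdiv[OF a(4,5)] by auto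
    moreover have "gran G (gdiv G \<gamma> \<sigma>) = gran G (gdiv G \<gamma> \<tau>)"
      using gdiv_closed(3)[of \<gamma> \<sigma>] gdiv_closed(3)[of \<gamma> \<tau>] that(1-3) fib by simp
    ultimately have "gdiv G \<gamma> \<sigma> = gdiv G \<gamma> \<tau>" using inj_onD[OF assms(2)] by blast
    then show ?thesis using gdiv_inj2[of \<gamma> \<sigma> \<tau>] that fib by auto
  qed
  have inj: "inj_on s E'"
  proof (rule inj_onI)
    fix \<gamma> \<gamma>' assume g: "\<gamma> \<in> E'" "\<gamma>' \<in> E'" "s \<gamma> = s \<gamma>'"
    then have e: "\<gamma> \<in> E" "\<gamma>' \<in> E" by (auto simp: E'_def)
    have "gdiv G \<gamma> (s \<gamma>) \<in> U" "gdiv G \<gamma>' (s \<gamma>) \<in> U"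
      using s[OF g(1)] s[OF g(2)] g(3) e assms(3) fibre_gdiv[OF a(4,5)] by auto
    moreover have f3: "\<gamma> \<in> arrows G" "\<gamma>' \<in> arrows G" "s \<gamma> \<in> arrows G"
      "gdom G \<gamma> = gdom G (s \<gamma>)" "gdom G \<gamma>' = gdom G (s \<gamma>)"
      using e s(1)[OF g(1)] fib[of \<gamma>] fib[of \<gamma>'] fib[of "s \<gamma>"] by simp_all
    moreover have "gdom G (gdiv G \<gamma> (s \<gamma>)) = gdom G (gdiv G \<gamma>' (s \<gamma>))"
      using gdiv_closed(2)[OF f3(1,3,4)] gdiv_closed(2)[OF f3(2,3,5)] by (simp only:)
    ultimately have "gdiv G \<gamma> (s \<gamma>) = gdiv G \<gamma>' (s \<gamma>)"
      using inj_onD[OF assms(1)] by blast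
    then show "\<gamma> = \<gamma>'" using gdiv_inj1[OF f3(1,3,2) f3(4,5)] by blast
  qed
  have T: "?T \<gamma> = f (gdiv G \<gamma> (s \<gamma>)) * \<xi> (s \<gamma>)" if g: "\<gamma> \<in> E'" for \<gamma>
  proof -
    have "?T \<gamma> = (\<Sum>\<sigma>\<in>{s \<gamma>}. f (gdiv G \<gamma> \<sigma>) * \<xi> \<sigma>)"
    proof (rule sum.mono_neutral_right[OF a(3)])
      show "{s \<gamma>} \<subseteq> F" using s[OF g] by simp
      have "\<gamma> \<in> E" using g by (simp add: E'_def)
      then show "\<forall>\<sigma>\<in>F - {s \<gamma>}. f (gdiv G \<gamma> \<sigma>) * \<xi> \<sigma> = 0"
        using uniq[of \<gamma> _ "s \<gamma>"] s[OF g] mult_eq_0_iff by blast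
    qed
    then show ?thesis by simp
  qed
  have T0: "?T \<gamma> = 0" if "\<gamma> \<in> E - E'" for \<gamma>
    using that by (intro sum.neutral) (auto simp: E'_def)
  have E': "E' \<subseteq> E" by (auto simp: E'_def)
  have "(\<Sum>\<gamma>\<in>E. cmod (?T \<gamma>) powr p) = (\<Sum>\<gamma>\<in>E'. cmod (?T \<gamma>) powr p)"
    using T0 E' a by (intro sum.mono_neutral_right) auto
  also have "\<dots> \<le> (\<Sum>\<gamma>\<in>E'. M powr p * cmod (\<xi> (s \<gamma>)) powr p)"
  proof (rule sum_mono)
    fix \<gamma> assume g: "\<gamma> \<in> E'"
    have "gdiv G \<gamma> (s \<gamma>) \<in> arrows G" using s[OF g] g E' fibre_gdiv[OF a(4,5)] by blast
    then have "cmod (?T \<gamma>) \<le> M * cmod (\<xi> (s \<gamma>))"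
      unfolding T[OF g] norm_mult by (intro mult_right_mono M) auto
    then have "cmod (?T \<gamma>) powr p \<le> (M * cmod (\<xi> (s \<gamma>))) powr p"
      using p1 by (intro powr_mono2) auto
    then show "cmod (?T \<gamma>) powr p \<le> M powr p * cmod (\<xi> (s \<gamma>)) powr p"
      using assms(5) by (simp add: powr_mult)
  qed
  also have "\<dots> = M powr p * (\<Sum>\<sigma>\<in>s ` E'. cmod (\<xi> \<sigma>) powr p)"
    using inj by (simp add: sum.reindex sum_distrib_left)
  also have "\<dots> \<le> M powr p * (\<Sum>\<sigma>\<in>F. cmod (\<xi> \<sigma>) powr p)"
    using s(1) a by (intro mult_left_mono sum_mono2) auto
  also have "\<dots> = (M * lpn p F \<xi>) powr p"
    using assms(5) p1 by (simp add: powr_mult lpn_powr)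
  finally show "lpn p E ?T \<le> M * lpn p F \<xi>"
    using assms(5) p1 by (simp add: lpn_le_iff)
qed (use assms in simp)

text \<open>Absolute summability is obtained without the dual exponent: a one-row block, applied to
  a vector with suitable phases, already produces the sum of the moduli.\<close>

lemma row_summable:
  assumes f: "opbound p G C f" and \<gamma>: "\<gamma> \<in> arrows G"
    and B: "\<And>T. finite T \<Longrightarrow> T \<subseteq> source_fibre G (gdom G \<gamma>) \<Longrightarrow> lpn p T \<xi> \<le> B"
  shows "(\<lambda>\<sigma>. norm (f (gdiv G \<gamma> \<sigma>) * \<xi> \<sigma>)) summable_on source_fibre G (gdom G \<gamma>)"
  unfolding abs_summable_iff_bdd_above
proof (rule bdd_aboveI2[where M = "C * B"], clarify)
  fix T assume T: "T \<subseteq> source_fibre G (gdom G \<gamma>)" "finite T"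
  \<comment> \<open>The phases cancel those of the row entries, so the row times
    \<open>\<zeta>\<close> is the sum of moduli, while \<open>\<zeta>\<close> is nowhere larger than
    \<open>\<xi>\<close>.\<close>
  define \<zeta> where "\<zeta> = (\<lambda>\<sigma>. cnj (sgn (f (gdiv G \<gamma> \<sigma>))) * of_real (cmod (\<xi> \<sigma>)))"
  have ph: "z * cnj (sgn z) = of_real (cmod z)" for z
    using complex_norm_square[of z]
    by (cases "z = 0") (simp_all add: sgn_eq power2_eq_square nonzero_divide_eq_eq)
  have "(\<Sum>\<sigma>\<in>T. norm (f (gdiv G \<gamma> \<sigma>) * \<xi> \<sigma>)) = cmod (of_real (\<Sum>\<sigma>\<in>T. norm (f (gdiv G \<gamma> \<sigma>) * \<xi> \<sigma>)))"
    by (simp add: sum_nonneg del: of_real_sum)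
  also have "of_real (\<Sum>\<sigma>\<in>T. norm (f (gdiv G \<gamma> \<sigma>) * \<xi> \<sigma>)) = (\<Sum>\<sigma>\<in>T. f (gdiv G \<gamma> \<sigma>) * \<zeta> \<sigma>)"
    by (simp add: \<zeta>_def norm_mult mult.assoc[symmetric] ph)
  also have "cmod \<dots> = lpn p {\<gamma>} (\<lambda>\<gamma>. \<Sum>\<sigma>\<in>T. f (gdiv G \<gamma> \<sigma>) * \<zeta> \<sigma>)"
    using p1 by simp
  also have "\<dots> \<le> C * lpn p T \<zeta>"
    using \<gamma> T by (intro opboundD[OF f, of "gdom G \<gamma>"]) auto
  also have "lpn p T \<zeta> \<le> lpn p T \<xi>"
    using p1 by (intro lpn_mono_norm) (auto simp: \<zeta>_def norm_mult norm_sgn)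
  also have "lpn p T \<xi> \<le> B" using B T by simp
  finally show "(\<Sum>\<sigma>\<in>T. norm (f (gdiv G \<gamma> \<sigma>) * \<xi> \<sigma>)) \<le> C * B"
    using opbound_nonneg[OF f] by (simp add: mult_left_mono)
qed

text \<open>The passage from finite blocks to whole vectors. For a fixed finite set of rows, the
  values on finite truncations of \<open>\<xi>\<close> converge along the finite subsets of the
  fibre, and each of them obeys the bound.\<close>

lemma apply_bound:
  assumes f: "opbound p G C f" and x: "x \<in> units G" and E: "finite E" "E \<subseteq> source_fibre G x"
    and B: "\<And>T. finite T \<Longrightarrow> T \<subseteq> source_fibre G x \<Longrightarrow> lpn p T \<xi> \<le> B"
  shows "lpn p E (\<lambda>\<gamma>. \<Sum>\<^sub>\<infinity>\<sigma>\<in>source_fibre G x. f (gdiv G \<gamma> \<sigma>) * \<xi> \<sigma>) \<le> C * B"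
proof (rule tendsto_upperbound)
  show "((\<lambda>T. lpn p E (\<lambda>\<gamma>. \<Sum>\<sigma>\<in>T. f (gdiv G \<gamma> \<sigma>) * \<xi> \<sigma>)) \<longlongrightarrow>
      lpn p E (\<lambda>\<gamma>. \<Sum>\<^sub>\<infinity>\<sigma>\<in>source_fibre G x. f (gdiv G \<gamma> \<sigma>) * \<xi> \<sigma>)) (finite_subsets_at_top (source_fibre G x))"
  proof (intro tendsto_lpn p1 E infsum_tendsto)
    fix \<gamma> assume "\<gamma> \<in> E"
    then have "\<gamma> \<in> arrows G" "gdom G \<gamma> = x" using E by auto
    then show "(\<lambda>\<sigma>. f (gdiv G \<gamma> \<sigma>) * \<xi> \<sigma>) summable_on source_fibre G x"
      using row_summable[OF f, of \<gamma> \<xi> B] B abs_summable_summable by metis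
  qed
  show "\<forall>\<^sub>F T in finite_subsets_at_top (source_fibre G x).
      lpn p E (\<lambda>\<gamma>. \<Sum>\<sigma>\<in>T. f (gdiv G \<gamma> \<sigma>) * \<xi> \<sigma>) \<le> C * B"
  proof (rule eventually_finite_subsets_at_top_weakI)
    fix T assume T: "finite T" "T \<subseteq> source_fibre G x"
    have "lpn p E (\<lambda>\<gamma>. \<Sum>\<sigma>\<in>T. f (gdiv G \<gamma> \<sigma>) * \<xi> \<sigma>) \<le> C * lpn p T \<xi>"
      using opboundD[OF f x E(1) T(1) E(2) T(2)] .
    also have "\<dots> \<le> C * B" using B T opbound_nonneg[OF f] by (simp add: mult_left_mono)
    finally show "lpn p E (\<lambda>\<gamma>. \<Sum>\<sigma>\<in>T. f (gdiv G \<gamma> \<sigma>) * \<xi> \<sigma>) \<le> C * B" .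
  qed
qed simp

text \<open>A column is the image of a basis vector, which has norm 1.\<close>

lemma column_bound:
  assumes g: "opbound p G D g" and \<sigma>: "\<sigma> \<in> arrows G" and T: "finite T" "T \<subseteq> source_fibre G (gdom G \<sigma>)"
  shows "lpn p T (\<lambda>\<tau>. g (gdiv G \<tau> \<sigma>)) \<le> D"
  using opboundD[OF g, of "gdom G \<sigma>" T "{\<sigma>}" "\<lambda>_. 1"] \<sigma> T p1 by simp

text \<open>The matrix of a convolution is the product of the two matrices: translating the
  summation variable by \<open>\<sigma>\<close> lets the middle index run through the fibre of
  \<open>\<sigma>\<close>.\<close>

lemma convolution_gdiv:
  assumes "\<gamma> \<in> arrows G" "\<sigma> \<in> arrows G" "gdom G \<gamma> = gdom G \<sigma>"
  shows "convolution G f g (gdiv G \<gamma> \<sigma>) =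
    (\<Sum>\<^sub>\<infinity>\<tau>\<in>source_fibre G (gdom G \<sigma>). f (gdiv G \<gamma> \<tau>) * g (gdiv G \<tau> \<sigma>))"
proof -
  have "convolution G f g (gdiv G \<gamma> \<sigma>) =
    (\<Sum>\<^sub>\<infinity>\<rho>\<in>source_fibre G (gran G \<sigma>). f (gdiv G (gdiv G \<gamma> \<sigma>) \<rho>) * g \<rho>)"
    using assms by (simp add: convolution_def)
  also have "\<dots> = (\<Sum>\<^sub>\<infinity>\<tau>\<in>source_fibre G (gdom G \<sigma>). f (gdiv G (gdiv G \<gamma> \<sigma>) (gdiv G \<tau> \<sigma>)) * g (gdiv G \<tau> \<sigma>))"
    by (rule infsum_reindex_bij_betw[symmetric, OF bij_gdiv]) (use assms in simp)
  also have "\<dots> = (\<Sum>\<^sub>\<infinity>\<tau>\<in>source_fibre G (gdom G \<sigma>). f (gdiv G \<gamma> \<tau>) * g (gdiv G \<tau> \<sigma>))"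
    by (rule infsum_cong) (use assms gdiv_mul(2)[of \<gamma> \<sigma>] in auto)
  finally show ?thesis .
qed

lemma convolution_summable:
  assumes f: "opbound p G C f" and g: "opbound p G D g" and "\<gamma> \<in> arrows G" "\<sigma> \<in> arrows G" "gdom G \<gamma> = gdom G \<sigma>"
  shows "(\<lambda>\<tau>. f (gdiv G \<gamma> \<tau>) * g (gdiv G \<tau> \<sigma>)) summable_on source_fibre G (gdom G \<sigma>)"
proof -
  have "(\<lambda>\<tau>. norm (f (gdiv G \<gamma> \<tau>) * g (gdiv G \<tau> \<sigma>))) summable_on source_fibre G (gdom G \<gamma>)"
    by (rule row_summable[OF f assms(3), where B = D], rule column_bound[OF g assms(4)])
       (simp_all only: assms(5))
  then show ?thesis using abs_summable_summable assms(5) by metis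
qed

lemma convolution_summable':
  assumes f: "opbound p G C f" and g: "opbound p G D g" and "\<gamma> \<in> arrows G"
  shows "(\<lambda>\<tau>. f (gdiv G \<gamma> \<tau>) * g \<tau>) summable_on source_fibre G (gdom G \<gamma>)"
proof -
  have "(\<lambda>\<tau>. f (gdiv G \<gamma> \<tau>) * g (gdiv G \<tau> (gdom G \<gamma>))) summable_on source_fibre G (gdom G \<gamma>)"
    using convolution_summable[OF f g assms(3), of "gdom G \<gamma>"] assms by simp
  moreover have "gdiv G \<tau> (gdom G \<gamma>) = \<tau>" if "\<tau> \<in> source_fibre G (gdom G \<gamma>)" for \<tau>
    using that assms(3) mul_dom[of \<tau>] by simp
  then have "(\<lambda>\<tau>. f (gdiv G \<gamma> \<tau>) * g (gdiv G \<tau> (gdom G \<gamma>))) summable_on source_fibre G (gdom G \<gamma>) \<longleftrightarrow>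
      (\<lambda>\<tau>. f (gdiv G \<gamma> \<tau>) * g \<tau>) summable_on source_fibre G (gdom G \<gamma>)"
    by (intro summable_on_cong) (simp only:)
  ultimately show ?thesis by blast
qed

text \<open>The vector between the two factors may have infinitely many nonzero coordinates, but its
  finite truncations have norm at most \<open>D * lpn p F \<xi>\<close>, which is what
  \<open>apply_bound\<close> asks for. The finite sum over \<open>F\<close> is first moved inside
  the infinite one.\<close>

lemma opbound_convolution:
  assumes f: "opbound p G C f" and g: "opbound p G D g"
  shows "opbound p G (C * D) (convolution G f g)"
proof (rule opboundI)
  show "0 \<le> C * D" using f g opbound_nonneg by (metis mult_nonneg_nonneg)
  fix x E F \<xi>
  assume a: "x \<in> units G" "finite E" "finite F" "E \<subseteq> source_fibre G x" "F \<subseteq> source_fibre G x"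
  have fib: "\<gamma> \<in> arrows G" "gdom G \<gamma> = x" if "\<gamma> \<in> E \<union> F" for \<gamma> using a that by auto
  have "lpn p E (\<lambda>\<gamma>. \<Sum>\<sigma>\<in>F. convolution G f g (gdiv G \<gamma> \<sigma>) * \<xi> \<sigma>) =
     lpn p E (\<lambda>\<gamma>. \<Sum>\<^sub>\<infinity>\<tau>\<in>source_fibre G x. f (gdiv G \<gamma> \<tau>) * (\<Sum>\<sigma>\<in>F. g (gdiv G \<tau> \<sigma>) * \<xi> \<sigma>))"
  proof (intro lpn_cong arg_cong[of _ _ cmod])
    fix \<gamma> assume \<gamma>: "\<gamma> \<in> E"
    have s: "(\<lambda>\<tau>. f (gdiv G \<gamma> \<tau>) * g (gdiv G \<tau> \<sigma>)) summable_on source_fibre G x" if "\<sigma> \<in> F" for \<sigma>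
      using convolution_summable[OF f g, of \<gamma> \<sigma>] fib \<gamma> that by auto
    have "(\<Sum>\<sigma>\<in>F. convolution G f g (gdiv G \<gamma> \<sigma>) * \<xi> \<sigma>) =
       (\<Sum>\<sigma>\<in>F. (\<Sum>\<^sub>\<infinity>\<tau>\<in>source_fibre G x. f (gdiv G \<gamma> \<tau>) * g (gdiv G \<tau> \<sigma>)) * \<xi> \<sigma>)"
    proof (rule sum.cong[OF refl])
      fix \<sigma> assume "\<sigma> \<in> F"
      then show "convolution G f g (gdiv G \<gamma> \<sigma>) * \<xi> \<sigma> =
          (\<Sum>\<^sub>\<infinity>\<tau>\<in>source_fibre G x. f (gdiv G \<gamma> \<tau>) * g (gdiv G \<tau> \<sigma>)) * \<xi> \<sigma>"
        using convolution_gdiv[of \<gamma> \<sigma> f g] \<gamma> fib[of \<gamma>] fib[of \<sigma>] by simp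
    qed
    also have "\<dots> = (\<Sum>\<sigma>\<in>F. \<Sum>\<^sub>\<infinity>\<tau>\<in>source_fibre G x. f (gdiv G \<gamma> \<tau>) * g (gdiv G \<tau> \<sigma>) * \<xi> \<sigma>)"
      by (intro sum.cong refl infsum_cmult_left[symmetric] s)
    also have "\<dots> = (\<Sum>\<^sub>\<infinity>\<tau>\<in>source_fibre G x. \<Sum>\<sigma>\<in>F. f (gdiv G \<gamma> \<tau>) * g (gdiv G \<tau> \<sigma>) * \<xi> \<sigma>)"
      by (rule infsum_sum[symmetric]) (use a in \<open>auto intro: summable_on_cmult_left s\<close>)
    finally show "(\<Sum>\<sigma>\<in>F. convolution G f g (gdiv G \<gamma> \<sigma>) * \<xi> \<sigma>) =
      (\<Sum>\<^sub>\<infinity>\<tau>\<in>source_fibre G x. f (gdiv G \<gamma> \<tau>) * (\<Sum>\<sigma>\<in>F. g (gdiv G \<tau> \<sigma>) * \<xi> \<sigma>))"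
      by (simp add: sum_distrib_left mult.assoc)
  qed
  also have "\<dots> \<le> C * (D * lpn p F \<xi>)"
    by (rule apply_bound[OF f a(1,2,4)]) (rule opboundD[OF g a(1) _ a(3) _ a(5)])
  finally show "lpn p E (\<lambda>\<gamma>. \<Sum>\<sigma>\<in>F. convolution G f g (gdiv G \<gamma> \<sigma>) * \<xi> \<sigma>) \<le> C * D * lpn p F \<xi>"
    by (simp add: mult.assoc)
qed

lemma lp_norm_bounds:
  assumes "\<And>E. finite E \<Longrightarrow> E \<subseteq> S \<Longrightarrow> lpn p E \<xi> \<le> B" "0 \<le> B"
  shows "(\<lambda>\<sigma>. cmod (\<xi> \<sigma>) powr p) summable_on S" "lp_norm p S \<xi> \<le> B"
    "\<And>E. finite E \<Longrightarrow> E \<subseteq> S \<Longrightarrow> lpn p E \<xi> \<le> lp_norm p S \<xi>"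
proof -
  have b: "(\<Sum>\<sigma>\<in>E. cmod (\<xi> \<sigma>) powr p) \<le> B powr p" if "finite E" "E \<subseteq> S" for E
    using assms that p1 by (simp add: lpn_le_iff)
  show s: "(\<lambda>\<sigma>. cmod (\<xi> \<sigma>) powr p) summable_on S"
    by (rule nonneg_bdd_above_summable_on) (use b in \<open>auto intro!: bdd_aboveI2\<close>)
  have "(\<Sum>\<^sub>\<infinity>\<sigma>\<in>S. cmod (\<xi> \<sigma>) powr p) \<le> B powr p"
    by (rule infsum_le_finite_sums[OF s b])
  then have "lp_norm p S \<xi> \<le> (B powr p) powr (1 / p)"
    unfolding lp_norm_def using p1 by (intro powr_mono2 infsum_nonneg) auto
  then show "lp_norm p S \<xi> \<le> B" using p1 assms(2) by (simp add: powr_powr)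
  show "lpn p E \<xi> \<le> lp_norm p S \<xi>" if "finite E" "E \<subseteq> S" for E
    unfolding lp_norm_def lpn_def using p1 that
    by (intro powr_mono2 finite_sum_le_infsum s sum_nonneg) auto
qed

text \<open>Taken together, \<open>lambda_norm p G f\<close> is the least constant for which
  \<open>opbound\<close> holds. The assumed bound \<open>C\<close> keeps the supremum finite;
  \<open>enn2real\<close> would turn an infinite one into 0.\<close>

lemma opbound_lambda_norm:
  assumes f: "opbound p G C f"
  shows "lambda_norm p G f \<le> C" and "opbound p G (lambda_norm p G f) f"
proof -
  let ?S = "SUP x \<in> units G. lp_opnorm p (source_fibre G x) (left_reg G x f)"
  have C: "0 \<le> C" using opbound_nonneg[OF f] .
  have fin: "lpn p E (left_reg G x f \<xi>) \<le> C * B"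
    if "x \<in> units G" "finite E" "E \<subseteq> source_fibre G x"
      "\<And>T. finite T \<Longrightarrow> T \<subseteq> source_fibre G x \<Longrightarrow> lpn p T \<xi> \<le> B" for x E \<xi> B
  proof -
    have "lpn p E (left_reg G x f \<xi>) =
        lpn p E (\<lambda>\<gamma>. \<Sum>\<^sub>\<infinity>\<sigma>\<in>source_fibre G x. f (gdiv G \<gamma> \<sigma>) * \<xi> \<sigma>)"
      using that(3) by (intro lpn_cong) (auto simp: left_reg_def)
    then show ?thesis using apply_bound[OF f that] by simp
  qed
  have le: "lp_norm p (source_fibre G x) (left_reg G x f \<xi>) \<le> C"
    if x: "x \<in> units G" and xi: "\<xi> \<in> lp_space p (source_fibre G x)" "lp_norm p (source_fibre G x) \<xi> \<le> 1" for x \<xi>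
  proof -
    have "lpn p T \<xi> \<le> 1" if "finite T" "T \<subseteq> source_fibre G x" for T
    proof -
      have "lpn p T \<xi> \<le> lp_norm p (source_fibre G x) \<xi>"
        unfolding lp_norm_def lpn_def using p1 that xi(1)
        by (intro powr_mono2 finite_sum_le_infsum sum_nonneg) (auto simp: lp_space_def)
      then show ?thesis using xi(2) by simp
    qed
    then have "lpn p E (left_reg G x f \<xi>) \<le> C" if "finite E" "E \<subseteq> source_fibre G x" for E
      using fin[OF x that, of \<xi> 1] by simp
    then show ?thesis using lp_norm_bounds(2) C by blast
  qed
  have S: "?S \<le> ennreal C"
    unfolding lp_opnorm_def using le by (intro SUP_least) (auto intro: ennreal_leI)
  then have fS: "?S < top" using le_less_trans[OF S] by simp
  show l: "lambda_norm p G f \<le> C"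
    using enn2real_mono[OF S] C by (simp add: lambda_norm_def)
  have L: "ennreal (lambda_norm p G f) = ?S"
    using fS by (simp add: lambda_norm_def)
  show "opbound p G (lambda_norm p G f) f"
  proof (rule opboundI)
    show L0: "0 \<le> lambda_norm p G f" by (simp add: lambda_norm_def)
    fix x E F \<xi>
    assume a: "x \<in> units G" "finite E" "finite F" "E \<subseteq> source_fibre G x" "F \<subseteq> source_fibre G x"
    show "lpn p E (\<lambda>\<gamma>. \<Sum>\<sigma>\<in>F. f (gdiv G \<gamma> \<sigma>) * \<xi> \<sigma>) \<le> lambda_norm p G f * lpn p F \<xi>"
    proof (cases "lpn p F \<xi> = 0")
      case True
      then show ?thesis using opboundD[OF f a, of \<xi>] by simp
    next
      case False
      let ?n = "lpn p F \<xi>"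
      have n: "?n > 0" using False lpn_nonneg[of p F \<xi>] by linarith
      \<comment> \<open>The supremum behind \<open>lp_opnorm\<close> runs over the unit ball of
        vectors on the whole fibre, so \<open>\<xi>\<close> is scaled to norm 1 and extended by zero
        outside \<open>F\<close>.\<close>
      define \<eta> where "\<eta> = (\<lambda>\<sigma>. if \<sigma> \<in> F then of_real (1 / ?n) * \<xi> \<sigma> else 0)"
      have "lpn p F \<eta> = lpn p F (\<lambda>\<sigma>. of_real (1 / ?n) * \<xi> \<sigma>)"
        by (rule lpn_cong) (simp add: \<eta>_def)
      then have nF: "lpn p F \<eta> = 1" using n unfolding lpn_scale[OF p1] by (simp add: norm_divide)
      have fT: "lpn p T \<eta> \<le> 1" if "finite T" for T
      proof -
        have "lpn p T \<eta> \<le> lpn p (T \<union> F) \<eta>" using that a p1 by (intro lpn_mono_set) auto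
        also have "\<dots> = lpn p F \<eta>"
          unfolding lpn_def using that a
          by (intro arg_cong[of _ _ "\<lambda>t. t powr (1 / p)"] sum.mono_neutral_right) (auto simp: \<eta>_def)
        finally show ?thesis using nF by simp
      qed
      note b = lp_norm_bounds[of "source_fibre G x" \<eta> 1, OF fT]
      have "\<eta> \<in> lp_space p (source_fibre G x)"
        using b(1) a(5) by (auto simp: lp_space_def \<eta>_def)
      then have "ennreal (lp_norm p (source_fibre G x) (left_reg G x f \<eta>)) \<le>
          lp_opnorm p (source_fibre G x) (left_reg G x f)"
        unfolding lp_opnorm_def using b(2) by (intro SUP_upper) auto
      also have "\<dots> \<le> ?S" using a(1) by (rule SUP_upper)
      finally have l1: "lp_norm p (source_fibre G x) (left_reg G x f \<eta>) \<le> lambda_norm p G f"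
        using L0 by (simp flip: L)
      have fC: "lpn p E' (left_reg G x f \<eta>) \<le> C" if "finite E'" "E' \<subseteq> source_fibre G x" for E'
        using fin[OF a(1) that fT] by simp
      have b2: "lpn p E (left_reg G x f \<eta>) \<le> lp_norm p (source_fibre G x) (left_reg G x f \<eta>)"
        using fC C a(2,4) by (rule lp_norm_bounds(3))
      have "lpn p E (\<lambda>\<gamma>. \<Sum>\<sigma>\<in>F. f (gdiv G \<gamma> \<sigma>) * \<xi> \<sigma>) = lpn p E (\<lambda>\<gamma>. of_real ?n * left_reg G x f \<eta> \<gamma>)"
      proof (rule lpn_cong)
        fix \<gamma> assume "\<gamma> \<in> E"
        then have "left_reg G x f \<eta> \<gamma> = (\<Sum>\<^sub>\<infinity>\<sigma>\<in>source_fibre G x. f (gdiv G \<gamma> \<sigma>) * \<eta> \<sigma>)"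
          using a(4) by (auto simp: left_reg_def)
        also have "\<dots> = (\<Sum>\<^sub>\<infinity>\<sigma>\<in>F. f (gdiv G \<gamma> \<sigma>) * \<eta> \<sigma>)"
          using a(5) by (intro infsum_cong_neutral) (auto simp: \<eta>_def)
        also have "\<dots> = (\<Sum>\<sigma>\<in>F. f (gdiv G \<gamma> \<sigma>) * (of_real (1 / ?n) * \<xi> \<sigma>))"
          using a(3) by (simp add: \<eta>_def)
        finally have "of_real ?n * left_reg G x f \<eta> \<gamma> = (\<Sum>\<sigma>\<in>F. f (gdiv G \<gamma> \<sigma>) * \<xi> \<sigma>)"
          using n by (simp add: sum_distrib_left)
        then show "cmod (\<Sum>\<sigma>\<in>F. f (gdiv G \<gamma> \<sigma>) * \<xi> \<sigma>) = cmod (of_real ?n * left_reg G x f \<eta> \<gamma>)" by simp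
      qed
      also have "\<dots> = ?n * lpn p E (left_reg G x f \<eta>)"
        unfolding lpn_scale[OF p1] using n by simp
      also have "\<dots> \<le> ?n * lambda_norm p G f"
        using b2 l1 n by (intro mult_left_mono) auto
      finally show ?thesis by (simp add: mult.commute)
    qed
  qed
qed

end

section \<open>The completion as an algebra of functions\<close>

text \<open>Convergence in the reduced norm to a function that need not be compactly supported. The
  error is measured by \<open>opbound\<close> because \<open>lambda_norm\<close> reports 0 for an
  infinite norm.\<close>

definition approx :: "real \<Rightarrow> 'a top_groupoid \<Rightarrow> (nat \<Rightarrow> 'a \<Rightarrow> complex) \<Rightarrow> ('a \<Rightarrow> complex) \<Rightarrow> bool" where
  "approx p G s f \<longleftrightarrow> (\<forall>n. s n \<in> Cc G) \<and> (\<forall>\<gamma>. \<gamma> \<notin> arrows G \<longrightarrow> f \<gamma> = 0) \<and>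
     (\<exists>C. C \<longlonglongrightarrow> 0 \<and> (\<forall>n. opbound p G (C n) (\<lambda>\<gamma>. s n \<gamma> - f \<gamma>)))"

text \<open>A concrete model of the reduced algebra: its elements are functions on the arrows, so
  they have values and supports.\<close>

definition RA :: "real \<Rightarrow> 'a top_groupoid \<Rightarrow> ('a \<Rightarrow> complex) set" where
  "RA p G = {f. \<exists>s. approx p G s f}"

definition RA_algebra :: "real \<Rightarrow> 'a top_groupoid \<Rightarrow> ('a \<Rightarrow> complex) normed_alg" where
  "RA_algebra p G =
     \<lparr>acarrier = RA p G,
      aadd = (\<lambda>f g \<gamma>. f \<gamma> + g \<gamma>),
      ascale = (\<lambda>c f \<gamma>. c * f \<gamma>),
      amul = convolution G,
      anorm = lambda_norm p G\<rparr>"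

lemma lambda_norm_nonneg [simp]: "0 \<le> lambda_norm p G f"
  by (simp add: lambda_norm_def)

locale red_grpd = etale_grpd G + lp_grpd G p for G :: "'a top_groupoid" and p :: real
begin

abbreviation bdd :: "('a \<Rightarrow> complex) \<Rightarrow> bool" where
  "bdd f \<equiv> \<exists>C. opbound p G C f"

lemma bdd_norm: "bdd f \<Longrightarrow> opbound p G (lambda_norm p G f) f"
  using opbound_lambda_norm(2) by blast

lemma opbound_uminus: "opbound p G C f \<Longrightarrow> opbound p G C (\<lambda>\<gamma>. - f \<gamma>)"
  using opbound_scale[of C f "-1"] by simp

lemma opbound_diff:
  "opbound p G C f \<Longrightarrow> opbound p G D g \<Longrightarrow> opbound p G (C + D) (\<lambda>\<gamma>. f \<gamma> - g \<gamma>)"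
  using opbound_add[of C f D "\<lambda>\<gamma>. - g \<gamma>"] opbound_uminus by simp

lemma opbound_minus_commute:
  "opbound p G C (\<lambda>\<gamma>. f \<gamma> - g \<gamma>) \<Longrightarrow> opbound p G C (\<lambda>\<gamma>. g \<gamma> - f \<gamma>)"
  using opbound_uminus[of C "\<lambda>\<gamma>. f \<gamma> - g \<gamma>"] by simp

lemma opbound_trans_diff:
  "opbound p G C (\<lambda>\<gamma>. f \<gamma> - g \<gamma>) \<Longrightarrow> opbound p G D (\<lambda>\<gamma>. g \<gamma> - h \<gamma>) \<Longrightarrow>
    opbound p G (C + D) (\<lambda>\<gamma>. f \<gamma> - h \<gamma>)"
  using opbound_add[of C "\<lambda>\<gamma>. f \<gamma> - g \<gamma>" D "\<lambda>\<gamma>. g \<gamma> - h \<gamma>"] by simp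

lemma opbound_plus_diff:
  "opbound p G C (\<lambda>\<gamma>. f \<gamma> - g \<gamma>) \<Longrightarrow> opbound p G D g \<Longrightarrow> opbound p G (C + D) f"
  using opbound_add[of C "\<lambda>\<gamma>. f \<gamma> - g \<gamma>" D g] by simp

text \<open>On a bisection the bound is any bound for the modulus, which exists by compactness;
  general functions are finite sums of such pieces.\<close>

lemma Cc_bdd: "f \<in> Cc G \<Longrightarrow> bdd f"
proof (induction rule: Cc_induct)
  case zero
  then show ?case using opbound_zero by blast
next
  case (add f g)
  then show ?case using opbound_add by blast
next
  case (bisection k)
  then obtain K U where K: "compactin (gtop G) K" "\<And>\<gamma>. k \<gamma> \<noteq> 0 \<Longrightarrow> \<gamma> \<in> K" "K \<subseteq> U" "bisection G U"
    "k \<in> Cc G" unfolding bisection_supported_def by blast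
  have "compactin euclidean (k ` K)"
    using image_compactin[OF K(1) Cc_continuous[OF K(5)]] .
  then have "bounded (k ` K)" using compact_imp_bounded by simp
  then obtain M where M: "M > 0" "\<And>z. z \<in> k ` K \<Longrightarrow> cmod z \<le> M" unfolding bounded_pos by blast
  have "opbound p G M k"
  proof (rule opbound_bisection)
    show "inj_on (gdom G) U" "inj_on (gran G) U" using K(4) by (auto simp: bisection_def)
    show "cmod (k \<gamma>) \<le> M" for \<gamma>
      using K(2)[of \<gamma>] M by (cases "k \<gamma> = 0") auto
  qed (use K M in auto)
  then show ?case by blast
qed

lemma approxI:
  assumes "\<And>n. s n \<in> Cc G" "\<And>\<gamma>. \<gamma> \<notin> arrows G \<Longrightarrow> f \<gamma> = 0" "C \<longlonglongrightarrow> 0"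
    "\<And>n. opbound p G (C n) (\<lambda>\<gamma>. s n \<gamma> - f \<gamma>)"
  shows "approx p G s f"
  using assms unfolding approx_def by blast

lemma approxE:
  assumes "approx p G s f"
  obtains C where "C \<longlonglongrightarrow> 0" "\<And>n. opbound p G (C n) (\<lambda>\<gamma>. s n \<gamma> - f \<gamma>)"
    "\<And>n. s n \<in> Cc G" "\<And>\<gamma>. \<gamma> \<notin> arrows G \<Longrightarrow> f \<gamma> = 0"
  using assms unfolding approx_def by blast

lemma approx_bdd: assumes "approx p G s f" shows "bdd f"
proof -
  obtain C where C: "\<And>n. opbound p G (C n) (\<lambda>\<gamma>. s n \<gamma> - f \<gamma>)" "\<And>n. s n \<in> Cc G"
    using approxE[OF assms] by metis
  obtain D where "opbound p G D (s 0)" using Cc_bdd C by blast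
  then show ?thesis using opbound_plus_diff[OF opbound_minus_commute[OF C(1)[of 0]]] by blast
qed

lemma RA_bdd: "f \<in> RA p G \<Longrightarrow> bdd f"
  using approx_bdd by (auto simp: RA_def)

lemma RA_norm: "f \<in> RA p G \<Longrightarrow> opbound p G (lambda_norm p G f) f"
  using RA_bdd bdd_norm by blast

lemma RA_zero: "f \<in> RA p G \<Longrightarrow> \<gamma> \<notin> arrows G \<Longrightarrow> f \<gamma> = 0"
  by (auto simp: RA_def approx_def)

lemma approx_const: "f \<in> Cc G \<Longrightarrow> approx p G (\<lambda>_. f) f"
  by (rule approxI[where C = "\<lambda>_. 0"]) (auto simp: Cc_zero opbound_zero)

lemma Cc_RA: "f \<in> Cc G \<Longrightarrow> f \<in> RA p G"
  using approx_const by (auto simp: RA_def)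

lemma approx_pointwise:
  assumes "approx p G s f" shows "(\<lambda>n. s n \<gamma>) \<longlonglongrightarrow> f \<gamma>"
proof (cases "\<gamma> \<in> arrows G")
  case True
  obtain C where C: "C \<longlonglongrightarrow> 0" "\<And>n. opbound p G (C n) (\<lambda>\<gamma>. s n \<gamma> - f \<gamma>)"
    using approxE[OF assms] by metis
  have "(\<lambda>n. s n \<gamma> - f \<gamma>) \<longlonglongrightarrow> 0"
    by (rule Lim_null_comparison[OF always_eventually C(1)])
       (use opbound_pointwise[OF C(2) True] in auto)
  then show ?thesis using LIM_zero_iff by blast
next
  case False
  then have "s n \<gamma> = 0" "f \<gamma> = 0" for n using assms Cc_zero by (auto simp: approx_def)
  then show ?thesis by simp
qed

lemma approx_unique: "approx p G s f \<Longrightarrow> approx p G s g \<Longrightarrow> f = g"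
  using approx_pointwise LIMSEQ_unique by blast

text \<open>\<open>opbound\<close> dominates every value, so the approximation by
  \<open>Cc G\<close> is uniform, and a uniform limit of continuous functions is continuous.\<close>

lemma RA_continuous:
  assumes "f \<in> RA p G" shows "continuous_map (gtop G) euclidean f"
  unfolding continuous_map_atin limitin_canonical_iff
proof (intro ballI tendstoI)
  fix \<gamma> and e :: real assume \<gamma>: "\<gamma> \<in> arrows G" and e: "0 < e"
  obtain s where s: "approx p G s f" using assms by (auto simp: RA_def)
  obtain C where C: "C \<longlonglongrightarrow> 0" "\<And>n. opbound p G (C n) (\<lambda>\<gamma>. s n \<gamma> - f \<gamma>)" "\<And>n. s n \<in> Cc G"
    using approxE[OF s] by metis
  have "\<forall>\<^sub>F n in sequentially. C n < e / 3" using order_tendstoD(2)[OF C(1), of "e / 3"] e by simp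
  then obtain n where n: "C n < e / 3" by (meson eventually_sequentially order_refl)
  have b: "dist (s n \<sigma>) (f \<sigma>) < e / 3" if "\<sigma> \<in> arrows G" for \<sigma>
    using opbound_pointwise[OF C(2) that, of n] n by (simp add: dist_norm)
  have "(s n \<longlongrightarrow> s n \<gamma>) (atin (gtop G) \<gamma>)"
    using Cc_continuous[OF C(3)[of n]] \<gamma> unfolding continuous_map_atin limitin_canonical_iff by blast
  then have "\<forall>\<^sub>F \<sigma> in atin (gtop G) \<gamma>. dist (s n \<sigma>) (s n \<gamma>) < e / 3"
    using e by (intro tendstoD) auto
  moreover have "\<forall>\<^sub>F \<sigma> in atin (gtop G) \<gamma>. \<sigma> \<in> arrows G"
    unfolding eventually_atin by (metis Diff_iff openin_topspace)
  ultimately show "\<forall>\<^sub>F \<sigma> in atin (gtop G) \<gamma>. dist (f \<sigma>) (f \<gamma>) < e"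
  proof eventually_elim
    case (elim \<sigma>)
    have "dist (f \<sigma>) (f \<gamma>) \<le> dist (s n \<sigma>) (f \<sigma>) + (dist (s n \<sigma>) (s n \<gamma>) + dist (s n \<gamma>) (f \<gamma>))"
      by (metis add_left_mono dist_triangle dist_triangle3 order_trans dist_commute)
    then show ?case using elim b[of \<sigma>] b[OF \<gamma>] by linarith
  qed
qed

lemma convolution_add_left:
  assumes "bdd f" "bdd g" "bdd h"
  shows "convolution G (\<lambda>\<gamma>. f \<gamma> + g \<gamma>) h = (\<lambda>\<gamma>. convolution G f h \<gamma> + convolution G g h \<gamma>)"
proof
  fix \<gamma>
  show "convolution G (\<lambda>\<gamma>. f \<gamma> + g \<gamma>) h \<gamma> = convolution G f h \<gamma> + convolution G g h \<gamma>"
    using assms infsum_add[OF convolution_summable'[of _ f _ h \<gamma>] convolution_summable'[of _ g _ h \<gamma>]]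
    by (auto simp: convolution_def distrib_right)
qed

lemma convolution_add_right:
  assumes "bdd f" "bdd g" "bdd h"
  shows "convolution G h (\<lambda>\<gamma>. f \<gamma> + g \<gamma>) = (\<lambda>\<gamma>. convolution G h f \<gamma> + convolution G h g \<gamma>)"
proof
  fix \<gamma>
  show "convolution G h (\<lambda>\<gamma>. f \<gamma> + g \<gamma>) \<gamma> = convolution G h f \<gamma> + convolution G h g \<gamma>"
    using assms infsum_add[OF convolution_summable'[of _ h _ f \<gamma>] convolution_summable'[of _ h _ g \<gamma>]]
    by (auto simp: convolution_def distrib_left)
qed

text \<open>The telescoping identity behind joint continuity of convolution.\<close>

lemma convolution_diff:
  assumes "bdd f" "bdd g" "bdd h" "bdd k"
  shows "convolution G f g \<gamma> - convolution G h k \<gamma> =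
    convolution G (\<lambda>\<gamma>. f \<gamma> - h \<gamma>) g \<gamma> + convolution G h (\<lambda>\<gamma>. g \<gamma> - k \<gamma>) \<gamma>"
proof -
  have b: "bdd (\<lambda>\<gamma>. f \<gamma> - h \<gamma>)" "bdd (\<lambda>\<gamma>. g \<gamma> - k \<gamma>)" using opbound_diff assms by blast+
  have "convolution G f g \<gamma> = convolution G (\<lambda>\<gamma>. f \<gamma> - h \<gamma>) g \<gamma> + convolution G h g \<gamma>"
    using convolution_add_left[OF b(1) assms(3,2)] by (simp add: fun_eq_iff)
  moreover have "convolution G h g \<gamma> = convolution G h (\<lambda>\<gamma>. g \<gamma> - k \<gamma>) \<gamma> + convolution G h k \<gamma>"
    using convolution_add_right[OF b(2) assms(4,3)] by (simp add: fun_eq_iff)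
  ultimately show ?thesis by simp
qed

lemma approx_add:
  assumes "approx p G s f" "approx p G t g"
  shows "approx p G (\<lambda>n \<gamma>. s n \<gamma> + t n \<gamma>) (\<lambda>\<gamma>. f \<gamma> + g \<gamma>)"
proof -
  obtain C where C: "C \<longlonglongrightarrow> 0" "\<And>n. opbound p G (C n) (\<lambda>\<gamma>. s n \<gamma> - f \<gamma>)"
    "\<And>n. s n \<in> Cc G" "\<And>\<gamma>. \<gamma> \<notin> arrows G \<Longrightarrow> f \<gamma> = 0" using approxE[OF assms(1)] by metis
  obtain D where D: "D \<longlonglongrightarrow> 0" "\<And>n. opbound p G (D n) (\<lambda>\<gamma>. t n \<gamma> - g \<gamma>)"
    "\<And>n. t n \<in> Cc G" "\<And>\<gamma>. \<gamma> \<notin> arrows G \<Longrightarrow> g \<gamma> = 0" using approxE[OF assms(2)] by metis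
  show ?thesis
  proof (rule approxI[where C = "\<lambda>n. C n + D n"])
    show "(\<lambda>n. C n + D n) \<longlonglongrightarrow> 0" using tendsto_add[OF C(1) D(1)] by simp
    show "opbound p G (C n + D n) (\<lambda>\<gamma>. s n \<gamma> + t n \<gamma> - (f \<gamma> + g \<gamma>))" for n
      using opbound_add[OF C(2)[of n] D(2)[of n]] by (simp add: algebra_simps)
  qed (use C D add_Cc in auto)
qed

lemma approx_scale:
  assumes "approx p G s f"
  shows "approx p G (\<lambda>n \<gamma>. c * s n \<gamma>) (\<lambda>\<gamma>. c * f \<gamma>)"
proof -
  obtain C where C: "C \<longlonglongrightarrow> 0" "\<And>n. opbound p G (C n) (\<lambda>\<gamma>. s n \<gamma> - f \<gamma>)"
    "\<And>n. s n \<in> Cc G" "\<And>\<gamma>. \<gamma> \<notin> arrows G \<Longrightarrow> f \<gamma> = 0" using approxE[OF assms(1)] by metis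
  show ?thesis
  proof (rule approxI[where C = "\<lambda>n. cmod c * C n"])
    show "(\<lambda>n. cmod c * C n) \<longlonglongrightarrow> 0" using tendsto_mult_left[OF C(1), of "cmod c"] by simp
    show "opbound p G (cmod c * C n) (\<lambda>\<gamma>. c * s n \<gamma> - c * f \<gamma>)" for n
      using opbound_scale[OF C(2)[of n], of c] by (simp add: algebra_simps)
  qed (use C scale_Cc in auto)
qed

lemma approx_convolution:
  assumes "approx p G s f" "approx p G t g"
  shows "approx p G (\<lambda>n. convolution G (s n) (t n)) (convolution G f g)"
proof -
  obtain C where C: "C \<longlonglongrightarrow> 0" "\<And>n. opbound p G (C n) (\<lambda>\<gamma>. s n \<gamma> - f \<gamma>)"
    "\<And>n. s n \<in> Cc G" using approxE[OF assms(1)] by metis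
  obtain D where D: "D \<longlonglongrightarrow> 0" "\<And>n. opbound p G (D n) (\<lambda>\<gamma>. t n \<gamma> - g \<gamma>)"
    "\<And>n. t n \<in> Cc G" using approxE[OF assms(2)] by metis
  obtain M where M: "opbound p G M f" using approx_bdd[OF assms(1)] by blast
  obtain N where N: "opbound p G N g" using approx_bdd[OF assms(2)] by blast
  show ?thesis
  proof (rule approxI[where C = "\<lambda>n. C n * (D n + N) + M * D n"])
    show "(\<lambda>n. C n * (D n + N) + M * D n) \<longlonglongrightarrow> 0"
      by (rule tendsto_eq_intros C D | simp)+
    show "convolution G (s n) (t n) \<in> Cc G" for n using convolution_Cc C D by blast
    fix n
    have tn: "opbound p G (D n + N) (t n)" using opbound_plus_diff[OF D(2) N] .
    have sn: "bdd (s n)" "bdd (t n)" "bdd f" "bdd g" using C(3) Cc_bdd tn M N by blast+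
    show "opbound p G (C n * (D n + N) + M * D n) (\<lambda>\<gamma>. convolution G (s n) (t n) \<gamma> - convolution G f g \<gamma>)"
      unfolding convolution_diff[OF sn]
      by (intro opbound_add opbound_convolution C D M tn)
  qed (auto simp: convolution_def)
qed

lemma RA_add: "f \<in> RA p G \<Longrightarrow> g \<in> RA p G \<Longrightarrow> (\<lambda>\<gamma>. f \<gamma> + g \<gamma>) \<in> RA p G"
  and RA_scale: "f \<in> RA p G \<Longrightarrow> (\<lambda>\<gamma>. c * f \<gamma>) \<in> RA p G"
  and RA_convolution: "f \<in> RA p G \<Longrightarrow> g \<in> RA p G \<Longrightarrow> convolution G f g \<in> RA p G"
  using approx_add approx_scale approx_convolution unfolding RA_def by blast+

lemma approx_norm:
  assumes "approx p G s f"
  shows "(\<lambda>n. lambda_norm p G (s n)) \<longlonglongrightarrow> lambda_norm p G f"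
proof -
  obtain C where C: "C \<longlonglongrightarrow> 0" "\<And>n. opbound p G (C n) (\<lambda>\<gamma>. s n \<gamma> - f \<gamma>)"
    "\<And>n. s n \<in> Cc G" using approxE[OF assms(1)] by metis
  have f: "opbound p G (lambda_norm p G f) f" using bdd_norm approx_bdd[OF assms] by blast
  have s: "opbound p G (lambda_norm p G (s n)) (s n)" for n using bdd_norm Cc_bdd C(3) by blast
  have "norm (lambda_norm p G (s n) - lambda_norm p G f) \<le> C n" for n
    using opbound_lambda_norm(1)[OF opbound_plus_diff[OF C(2) f, of n]]
      opbound_lambda_norm(1)[OF opbound_plus_diff[OF opbound_minus_commute[OF C(2)] s, of n]] by auto
  then show ?thesis
    using Lim_null_comparison[OF always_eventually C(1), of "\<lambda>n. lambda_norm p G (s n) - lambda_norm p G f"]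
      LIM_zero_iff by blast
qed

lemma adist_Cc: "adist (Cc_algebra p G) f g = lambda_norm p G (\<lambda>\<gamma>. f \<gamma> - g \<gamma>)"
  by (simp add: adist_def Cc_algebra_def)

lemma bdd_diff: "bdd f \<Longrightarrow> bdd g \<Longrightarrow> bdd (\<lambda>\<gamma>. f \<gamma> - g \<gamma>)"
  using opbound_diff by blast

text \<open>Through this equivalence the classes of Cauchy sequences modulo null sequences are
  labelled by their limit functions.\<close>

lemma approx_iff_null:
  assumes s: "approx p G s f" and t: "\<And>n. t n \<in> Cc G"
  shows "(\<lambda>n. adist (Cc_algebra p G) (s n) (t n)) \<longlonglongrightarrow> 0 \<longleftrightarrow> approx p G t f"
proof -
  obtain C where C: "C \<longlonglongrightarrow> 0" "\<And>n. opbound p G (C n) (\<lambda>\<gamma>. s n \<gamma> - f \<gamma>)"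
    "\<And>n. s n \<in> Cc G" "\<And>\<gamma>. \<gamma> \<notin> arrows G \<Longrightarrow> f \<gamma> = 0" using approxE[OF s] by metis
  let ?d = "\<lambda>n. lambda_norm p G (\<lambda>\<gamma>. s n \<gamma> - t n \<gamma>)"
  have d: "opbound p G (?d n) (\<lambda>\<gamma>. s n \<gamma> - t n \<gamma>)" for n
    by (intro bdd_norm bdd_diff Cc_bdd C t)
  show ?thesis
    unfolding adist_Cc
  proof
    assume l: "?d \<longlonglongrightarrow> 0"
    show "approx p G t f"
    proof (rule approxI[where C = "\<lambda>n. ?d n + C n"])
      show "(\<lambda>n. ?d n + C n) \<longlonglongrightarrow> 0" using tendsto_add[OF l C(1)] by simp
      show "opbound p G (?d n + C n) (\<lambda>\<gamma>. t n \<gamma> - f \<gamma>)" for n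
        using opbound_trans_diff[OF opbound_minus_commute[OF d] C(2)] .
    qed (use t C in auto)
  next
    assume "approx p G t f"
    then obtain D where D: "D \<longlonglongrightarrow> 0" "\<And>n. opbound p G (D n) (\<lambda>\<gamma>. t n \<gamma> - f \<gamma>)"
      using approxE by metis
    have "norm (?d n) \<le> C n + D n" for n
      using opbound_lambda_norm(1)[OF opbound_trans_diff[OF C(2) opbound_minus_commute[OF D(2)]]] by simp
    then show "?d \<longlonglongrightarrow> 0"
      using Lim_null_comparison[OF always_eventually, of ?d "\<lambda>n. C n + D n"] tendsto_add[OF C(1) D(1)] by simp
  qed
qed

text \<open>Completeness of the model. A Cauchy sequence converges at every arrow because values are
  bounded by the norm, and the estimates between its members pass to the pointwise limit by
  \<open>opbound_limit\<close>, which makes the convergence one in norm.\<close>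

lemma cauchy_seqs_iff: "s \<in> cauchy_seqs (Cc_algebra p G) \<longleftrightarrow> (\<exists>f. approx p G s f)"
proof
  assume s: "s \<in> cauchy_seqs (Cc_algebra p G)"
  then have sC: "s n \<in> Cc G" for n by (auto simp: cauchy_seqs_def Cc_algebra_def)
  have b: "opbound p G (lambda_norm p G (\<lambda>\<gamma>. s m \<gamma> - s n \<gamma>)) (\<lambda>\<gamma>. s m \<gamma> - s n \<gamma>)" for m n
    by (intro bdd_norm bdd_diff Cc_bdd sC)
  have "\<exists>N. \<forall>m\<ge>N. \<forall>n\<ge>N. opbound p G e (\<lambda>\<gamma>. s m \<gamma> - s n \<gamma>)" if e: "0 < e" for e
  proof -
    obtain N where N: "\<And>m n. m \<ge> N \<Longrightarrow> n \<ge> N \<Longrightarrow> lambda_norm p G (\<lambda>\<gamma>. s m \<gamma> - s n \<gamma>) < e"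
      using s e unfolding cauchy_seqs_def mem_Collect_eq adist_Cc by meson
    then show ?thesis using opbound_mono[OF b less_imp_le[OF N]] by blast
  qed
  then have e: "\<And>e. 0 < e \<Longrightarrow> \<exists>N. \<forall>m\<ge>N. \<forall>n\<ge>N. opbound p G e (\<lambda>\<gamma>. s m \<gamma> - s n \<gamma>)" by blast
  have "convergent (\<lambda>n. s n \<gamma>)" if \<gamma>: "\<gamma> \<in> arrows G" for \<gamma>
  proof (rule Cauchy_convergent, rule CauchyI)
    fix r :: real assume r: "0 < r"
    then obtain N where N: "\<And>m n. m \<ge> N \<Longrightarrow> n \<ge> N \<Longrightarrow> opbound p G (r / 2) (\<lambda>\<gamma>. s m \<gamma> - s n \<gamma>)"
      using e[of "r / 2"] by auto
    have "norm (s m \<gamma> - s n \<gamma>) < r" if "m \<ge> N" "n \<ge> N" for m n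
      using opbound_pointwise[OF N[OF that] \<gamma>] r by simp
    then show "\<exists>N. \<forall>m\<ge>N. \<forall>n\<ge>N. norm (s m \<gamma> - s n \<gamma>) < r" by blast
  qed
  moreover define f where "f = (\<lambda>\<gamma>. if \<gamma> \<in> arrows G then lim (\<lambda>n. s n \<gamma>) else 0)"
  ultimately have lim: "(\<lambda>n. s n \<gamma>) \<longlonglongrightarrow> f \<gamma>" if "\<gamma> \<in> arrows G" for \<gamma>
    using that by (simp add: convergent_LIMSEQ_iff[symmetric])
  have f: "\<exists>N. \<forall>n\<ge>N. opbound p G r (\<lambda>\<gamma>. s n \<gamma> - f \<gamma>)" if r: "0 < r" for r
  proof -
    obtain N where N: "\<And>m n. m \<ge> N \<Longrightarrow> n \<ge> N \<Longrightarrow> opbound p G r (\<lambda>\<gamma>. s m \<gamma> - s n \<gamma>)"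
      using e[OF r] by blast
    \<comment> \<open>The sequence is shifted by \<open>N\<close> because
      \<open>opbound_limit\<close> wants the bound at every index.\<close>
    have "opbound p G r (\<lambda>\<gamma>. s n \<gamma> - f \<gamma>)" if n: "n \<ge> N" for n
    proof (rule opbound_limit[of "\<lambda>_. r" "\<lambda>m \<gamma>. s n \<gamma> - s (m + N) \<gamma>"])
      show "(\<lambda>m. s n \<gamma> - s (m + N) \<gamma>) \<longlonglongrightarrow> s n \<gamma> - f \<gamma>" if "\<gamma> \<in> arrows G" for \<gamma>
        by (intro tendsto_intros LIMSEQ_ignore_initial_segment lim that)
    qed (use N n in auto)
    then show ?thesis by blast
  qed
  obtain N where N: "opbound p G 1 (\<lambda>\<gamma>. s N \<gamma> - f \<gamma>)" using f[of 1] by auto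
  obtain M where "opbound p G M (s N)" using Cc_bdd sC by blast
  then have fb: "bdd f" using opbound_plus_diff[OF opbound_minus_commute[OF N]] by blast
  let ?C = "\<lambda>n. lambda_norm p G (\<lambda>\<gamma>. s n \<gamma> - f \<gamma>)"
  have "?C \<longlonglongrightarrow> 0"
  proof (rule LIMSEQ_I)
    fix r :: real assume r: "0 < r"
    then obtain N where N: "\<And>n. n \<ge> N \<Longrightarrow> opbound p G (r / 2) (\<lambda>\<gamma>. s n \<gamma> - f \<gamma>)" using f[of "r / 2"] by auto
    have "norm (?C n - 0) < r" if "n \<ge> N" for n
      using opbound_lambda_norm(1)[OF N[OF that]] r by simp
    then show "\<exists>N. \<forall>n\<ge>N. norm (?C n - 0) < r" by blast
  qed
  moreover have "opbound p G (?C n) (\<lambda>\<gamma>. s n \<gamma> - f \<gamma>)" for n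
    by (intro bdd_norm bdd_diff Cc_bdd sC fb)
  ultimately have "approx p G s f" using sC by (intro approxI[of s f ?C]) (auto simp: f_def)
  then show "\<exists>f. approx p G s f" by blast
next
  assume "\<exists>f. approx p G s f"
  then obtain f where f: "approx p G s f" ..
  obtain C where C: "C \<longlonglongrightarrow> 0" "\<And>n. opbound p G (C n) (\<lambda>\<gamma>. s n \<gamma> - f \<gamma>)"
    "\<And>n. s n \<in> Cc G" using approxE[OF f] by metis
  have "\<exists>N. \<forall>m\<ge>N. \<forall>n\<ge>N. adist (Cc_algebra p G) (s m) (s n) < e" if e: "0 < e" for e
  proof -
    obtain N where N: "\<And>n. n \<ge> N \<Longrightarrow> norm (C n - 0) < e / 2" using LIMSEQ_D[OF C(1), of "e / 2"] e by auto
    have "adist (Cc_algebra p G) (s m) (s n) < e" if "m \<ge> N" "n \<ge> N" for m n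
      using opbound_lambda_norm(1)[OF opbound_trans_diff[OF C(2)[of m] opbound_minus_commute[OF C(2)[of n]]]]
        N[OF that(1)] N[OF that(2)] unfolding adist_Cc by simp
    then show ?thesis by blast
  qed
  then show "s \<in> cauchy_seqs (Cc_algebra p G)"
    using C(3) by (auto simp: cauchy_seqs_def Cc_algebra_def)
qed

lemma null_equiv_iff:
  assumes "approx p G s f"
  shows "(s, t) \<in> null_equiv (Cc_algebra p G) \<longleftrightarrow> approx p G t f"
proof
  assume "(s, t) \<in> null_equiv (Cc_algebra p G)"
  then have t: "t \<in> cauchy_seqs (Cc_algebra p G)" "(\<lambda>n. adist (Cc_algebra p G) (s n) (t n)) \<longlonglongrightarrow> 0"
    by (auto simp: null_equiv_def)
  then have "t n \<in> Cc G" for n by (auto simp: cauchy_seqs_def Cc_algebra_def)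
  then show "approx p G t f" using approx_iff_null[OF assms] t(2) by blast
next
  assume t: "approx p G t f"
  then have "t n \<in> Cc G" for n by (auto simp: approx_def)
  then show "(s, t) \<in> null_equiv (Cc_algebra p G)"
    using approx_iff_null[OF assms] t assms cauchy_seqs_iff by (auto simp: null_equiv_def)
qed

definition approx_class :: "('a \<Rightarrow> complex) \<Rightarrow> (nat \<Rightarrow> 'a \<Rightarrow> complex) set" where
  "approx_class f = {s. approx p G s f}"

lemma null_class: "approx p G s f \<Longrightarrow> null_equiv (Cc_algebra p G) `` {s} = approx_class f"
  by (auto simp: approx_class_def null_equiv_iff)

lemma approx_class_nonempty: "f \<in> RA p G \<Longrightarrow> approx_class f \<noteq> {}"
  by (auto simp: RA_def approx_class_def)

text \<open>\<open>approx_class\<close> sends a function to the set of all sequences converging to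
  it, which is one class of the completion. It is injective as limits are unique, surjective as
  every Cauchy sequence has a limit function, and compatible with the operations and the norm as
  these pass to limits.\<close>

theorem reduced_algebra_iso: "isometrically_isomorphic (RA_algebra p G) (reduced_algebra p G)"
proof -
  let ?A = "Cc_algebra p G"
  have ops: "aadd ?A f g = (\<lambda>\<gamma>. f \<gamma> + g \<gamma>)" "ascale ?A c f = (\<lambda>\<gamma>. c * f \<gamma>)" "amul ?A f g = convolution G f g"
    "anorm ?A f = lambda_norm p G f" for f g c
    by (simp_all add: Cc_algebra_def)
  have bij: "bij_betw approx_class (RA p G) (acarrier (reduced_algebra p G))"
  proof (rule bij_betwI')
    fix f g assume fg: "f \<in> RA p G" "g \<in> RA p G"
    show "approx_class f = approx_class g \<longleftrightarrow> f = g"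
    proof
      assume e: "approx_class f = approx_class g"
      obtain s where "s \<in> approx_class f" using approx_class_nonempty[OF fg(1)] by blast
      then show "f = g" using approx_unique e unfolding approx_class_def by blast
    qed simp
  next
    fix f assume "f \<in> RA p G"
    then obtain s where s: "approx p G s f" by (auto simp: RA_def)
    then have "s \<in> cauchy_seqs ?A" using cauchy_seqs_iff by blast
    then show "approx_class f \<in> acarrier (reduced_algebra p G)"
      unfolding reduced_algebra_def completion_def null_class[OF s, symmetric] by (simp add: quotientI)
  next
    fix X assume "X \<in> acarrier (reduced_algebra p G)"
    then obtain s where s: "s \<in> cauchy_seqs ?A" "X = null_equiv ?A `` {s}"
      unfolding reduced_algebra_def completion_def by (auto elim: quotientE)
    then obtain f where f: "approx p G s f" using cauchy_seqs_iff by blast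
    then show "\<exists>f\<in>RA p G. X = approx_class f"
      using s(2) null_class[OF f] by (auto simp: RA_def)
  qed
  \<comment> \<open>The operations of the completion are unions over representatives; a union of
    sets that all equal \<open>Z\<close>, over nonempty index sets, is \<open>Z\<close>.\<close>
  have UN2: "(\<Union>s\<in>X. \<Union>t\<in>Y. F s t) = Z"
    if "X \<noteq> {}" "Y \<noteq> {}" "\<And>s t. s \<in> X \<Longrightarrow> t \<in> Y \<Longrightarrow> F s t = Z"
    for X Y :: "(nat \<Rightarrow> 'a \<Rightarrow> complex) set" and F and Z :: "(nat \<Rightarrow> 'a \<Rightarrow> complex) set"
    using that by blast
  have add: "approx_class (\<lambda>\<gamma>. f \<gamma> + g \<gamma>) =
      (\<Union>s\<in>approx_class f. \<Union>t\<in>approx_class g. null_equiv ?A `` {\<lambda>n. aadd ?A (s n) (t n)})"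
    if "f \<in> RA p G" "g \<in> RA p G" for f g
    unfolding ops
    by (rule UN2[symmetric]) (use approx_class_nonempty that null_class[OF approx_add[of _ f _ g]] in
        \<open>auto simp only: approx_class_def mem_Collect_eq\<close>)
  have mul: "approx_class (convolution G f g) =
      (\<Union>s\<in>approx_class f. \<Union>t\<in>approx_class g. null_equiv ?A `` {\<lambda>n. amul ?A (s n) (t n)})"
    if "f \<in> RA p G" "g \<in> RA p G" for f g
    unfolding ops
    by (rule UN2[symmetric]) (use approx_class_nonempty that null_class[OF approx_convolution[of _ f _ g]] in
        \<open>auto simp only: approx_class_def mem_Collect_eq\<close>)
  have scale: "approx_class (\<lambda>\<gamma>. c * f \<gamma>) = (\<Union>s\<in>approx_class f. null_equiv ?A `` {\<lambda>n. ascale ?A c (s n)})"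
    if "f \<in> RA p G" for f c
    using approx_class_nonempty[OF that] null_class[OF approx_scale[of _ f c]]
    unfolding ops approx_class_def by blast
  have norm: "the_elem ((\<lambda>s. lim (\<lambda>n. anorm ?A (s n))) ` approx_class f) = lambda_norm p G f"
    if "f \<in> RA p G" for f
  proof -
    have "(\<lambda>s. lim (\<lambda>n. anorm ?A (s n))) ` approx_class f = (\<lambda>s. lambda_norm p G f) ` approx_class f"
      by (rule image_cong) (auto simp: ops approx_class_def intro!: limI approx_norm)
    then show ?thesis using approx_class_nonempty[OF that] by (simp add: image_constant_conv)
  qed
  show ?thesis
    unfolding isometrically_isomorphic_def
    by (rule exI[of _ approx_class], use bij add mul scale norm in
        \<open>simp add: RA_algebra_def reduced_algebra_def completion_def\<close>)
qed

end

lemma isometrically_isomorphic_trans: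
  assumes "isometrically_isomorphic A B" "isometrically_isomorphic B C"
  shows "isometrically_isomorphic A C"
proof -
  obtain \<Phi> where P: "bij_betw \<Phi> (acarrier A) (acarrier B)"
    "\<And>a b. a \<in> acarrier A \<Longrightarrow> b \<in> acarrier A \<Longrightarrow> \<Phi> (aadd A a b) = aadd B (\<Phi> a) (\<Phi> b)"
    "\<And>c a. a \<in> acarrier A \<Longrightarrow> \<Phi> (ascale A c a) = ascale B c (\<Phi> a)"
    "\<And>a b. a \<in> acarrier A \<Longrightarrow> b \<in> acarrier A \<Longrightarrow> \<Phi> (amul A a b) = amul B (\<Phi> a) (\<Phi> b)"
    "\<And>a. a \<in> acarrier A \<Longrightarrow> anorm B (\<Phi> a) = anorm A a"
    using assms(1) unfolding isometrically_isomorphic_def by blast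
  obtain \<Psi> where Q: "bij_betw \<Psi> (acarrier B) (acarrier C)"
    "\<And>a b. a \<in> acarrier B \<Longrightarrow> b \<in> acarrier B \<Longrightarrow> \<Psi> (aadd B a b) = aadd C (\<Psi> a) (\<Psi> b)"
    "\<And>c a. a \<in> acarrier B \<Longrightarrow> \<Psi> (ascale B c a) = ascale C c (\<Psi> a)"
    "\<And>a b. a \<in> acarrier B \<Longrightarrow> b \<in> acarrier B \<Longrightarrow> \<Psi> (amul B a b) = amul C (\<Psi> a) (\<Psi> b)"
    "\<And>a. a \<in> acarrier B \<Longrightarrow> anorm C (\<Psi> a) = anorm B a"
    using assms(2) unfolding isometrically_isomorphic_def by blast
  have in_B: "\<Phi> a \<in> acarrier B" if "a \<in> acarrier A" for a using P(1) that bij_betwE by blast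
  show ?thesis
    unfolding isometrically_isomorphic_def
    by (rule exI[of _ "\<Psi> \<circ> \<Phi>"]) (use bij_betw_trans[OF P(1) Q(1)] P(2-) Q(2-) in_B in simp)
qed

text \<open>The closure assumptions supply what the bare record type \<open>normed_alg\<close> does
  not guarantee: the inverse can be evaluated at images of sums and products.\<close>

lemma isometrically_isomorphic_sym:
  assumes "isometrically_isomorphic A B"
    and "\<And>a b. a \<in> acarrier A \<Longrightarrow> b \<in> acarrier A \<Longrightarrow> aadd A a b \<in> acarrier A"
    and "\<And>c a. a \<in> acarrier A \<Longrightarrow> ascale A c a \<in> acarrier A"
    and "\<And>a b. a \<in> acarrier A \<Longrightarrow> b \<in> acarrier A \<Longrightarrow> amul A a b \<in> acarrier A"
  shows "isometrically_isomorphic B A"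
proof -
  obtain \<Phi> where P: "bij_betw \<Phi> (acarrier A) (acarrier B)"
    "\<And>a b. a \<in> acarrier A \<Longrightarrow> b \<in> acarrier A \<Longrightarrow> \<Phi> (aadd A a b) = aadd B (\<Phi> a) (\<Phi> b)"
    "\<And>c a. a \<in> acarrier A \<Longrightarrow> \<Phi> (ascale A c a) = ascale B c (\<Phi> a)"
    "\<And>a b. a \<in> acarrier A \<Longrightarrow> b \<in> acarrier A \<Longrightarrow> \<Phi> (amul A a b) = amul B (\<Phi> a) (\<Phi> b)"
    "\<And>a. a \<in> acarrier A \<Longrightarrow> anorm B (\<Phi> a) = anorm A a"
    using assms(1) unfolding isometrically_isomorphic_def by blast
  let ?\<Psi> = "the_inv_into (acarrier A) \<Phi>"
  have B: "acarrier B = \<Phi> ` acarrier A" and inj: "inj_on \<Phi> (acarrier A)"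
    using P(1) by (auto simp: bij_betw_def)
  have inv: "?\<Psi> (\<Phi> a) = a" if "a \<in> acarrier A" for a using the_inv_into_f_f[OF inj that] .
  have "?\<Psi> (aadd B (\<Phi> a) (\<Phi> b)) = aadd A a b" if "a \<in> acarrier A" "b \<in> acarrier A" for a b
    using inv[OF assms(2)[OF that]] P(2)[OF that] by simp
  moreover have "?\<Psi> (amul B (\<Phi> a) (\<Phi> b)) = amul A a b" if "a \<in> acarrier A" "b \<in> acarrier A" for a b
    using inv[OF assms(4)[OF that]] P(4)[OF that] by simp
  moreover have "?\<Psi> (ascale B c (\<Phi> a)) = ascale A c a" if "a \<in> acarrier A" for a c
    using inv[OF assms(3)[OF that]] P(3)[OF that] by simp
  ultimately show ?thesis
    unfolding isometrically_isomorphic_def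
    by (intro exI[of _ ?\<Psi>]) (use bij_betw_the_inv_into[OF P(1)] P(5) inv in \<open>auto simp: B\<close>)
qed

section \<open>Isometries near the unit are diagonal\<close>

lemma powr_sum_strict:
  fixes A B r :: real
  assumes "0 < A" "0 < B" "0 < r"
  shows "1 < r \<Longrightarrow> A powr r + B powr r < (A + B) powr r"
    and "r < 1 \<Longrightarrow> (A + B) powr r < A powr r + B powr r"
proof -
  have split: "z powr r = z * z powr (r - 1)" if "0 < z" for z
    using that powr_add[of z 1 "r - 1"] by simp
  have AB: "(A + B) powr r = A * (A + B) powr (r - 1) + B * (A + B) powr (r - 1)"
    using split[of "A + B"] assms by (simp add: distrib_right)
  show "A powr r + B powr r < (A + B) powr r" if "1 < r"
    unfolding AB split[OF assms(1)] split[OF assms(2)]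
    using assms that by (intro add_strict_mono mult_strict_left_mono powr_less_mono2) auto
  show "(A + B) powr r < A powr r + B powr r" if "r < 1"
    unfolding AB split[OF assms(1)] split[OF assms(2)]
    using assms that by (intro add_strict_mono mult_strict_left_mono powr_less_mono2_neg) auto
qed

text \<open>With \<open>r = p / 2\<close> and squared moduli, the parallelogram law says that
  \<open>s\<close> and \<open>t\<close> have mean \<open>A + B\<close>. For \<open>p > 2\<close>
  convexity of the power \<open>r\<close> and its strict superadditivity point the same way; for
  \<open>p < 2\<close> concavity and strict subadditivity do. At \<open>p = 2\<close> the inequality
  collapses to an identity.\<close>

lemma clarkson_strict:
  fixes a b :: complex
  assumes "a \<noteq> 0" "b \<noteq> 0" and p: "1 \<le> p"
  shows "2 < p \<Longrightarrow> 2 * cmod a powr p + 2 * cmod b powr p < cmod (a + b) powr p + cmod (a - b) powr p"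
    and "p < 2 \<Longrightarrow> cmod (a + b) powr p + cmod (a - b) powr p < 2 * cmod a powr p + 2 * cmod b powr p"
proof -
  define r A B s t where "r = p / 2" and "A = (cmod a)\<^sup>2" and "B = (cmod b)\<^sup>2"
    and "s = (cmod (a + b))\<^sup>2" and "t = (cmod (a - b))\<^sup>2"
  have sq: "cmod z powr p = (cmod z)\<^sup>2 powr r" for z
    by (cases "z = 0") (simp_all add: r_def powr_powr flip: powr_numeral)
  have AB: "0 < A" "0 < B" "0 \<le> s" "0 \<le> t" "0 < r" using assms by (auto simp: A_def B_def s_def t_def r_def)
  have st: "(s + t) / 2 = A + B"
    unfolding s_def t_def A_def B_def cmod_power2 by (simp add: power2_eq_square algebra_simps)
  note rw = sq[of a, folded A_def] sq[of b, folded B_def] sq[of "a + b", folded s_def] sq[of "a - b", folded t_def]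
  show "2 * cmod a powr p + 2 * cmod b powr p < cmod (a + b) powr p + cmod (a - b) powr p" if "2 < p"
  proof -
    have r: "1 < r" using that by (simp add: r_def)
    have "((s + t) / 2) powr r \<le> (s powr r + t powr r) / 2"
      using powr_convex_nonneg[of r s t "1/2"] r AB by (simp add: add_divide_distrib)
    then show ?thesis using powr_sum_strict(1)[OF AB(1,2,5) r] unfolding rw st by simp
  qed
  show "cmod (a + b) powr p + cmod (a - b) powr p < 2 * cmod a powr p + 2 * cmod b powr p" if "p < 2"
  proof -
    have r: "r < 1" using that by (simp add: r_def)
    \<comment> \<open>Concavity of the power \<open>r\<close>, obtained from convexity of the power
      \<open>1 / r\<close>, whose exponent exceeds 1.\<close>
    have "((s powr r + t powr r) / 2) powr (1 / r) \<le> (s + t) / 2"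
      using powr_convex_nonneg[of "1 / r" "s powr r" "t powr r" "1/2"] r AB
      by (simp add: add_divide_distrib powr_powr)
    then have "(((s powr r + t powr r) / 2) powr (1 / r)) powr r \<le> ((s + t) / 2) powr r"
      using AB by (intro powr_mono2) auto
    then have "(s powr r + t powr r) / 2 \<le> ((s + t) / 2) powr r"
      using AB by (simp add: powr_powr)
    then show ?thesis using powr_sum_strict(2)[OF AB(1,2,5) r] unfolding rw st by simp
  qed
qed

text \<open>The termwise defects in Clarkson's inequality have one sign and sum to 0, so each of
  them vanishes; the strict inequality forbids this where both entries are nonzero.\<close>

lemma clarkson_equality:
  fixes a b :: "'i \<Rightarrow> complex"
  assumes p: "1 \<le> p" "p \<noteq> 2" and i: "i \<in> S"
    and "((\<lambda>i. cmod (a i) powr p) has_sum A) S" "((\<lambda>i. cmod (b i) powr p) has_sum B) S"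
    and "((\<lambda>i. cmod (a i + b i) powr p) has_sum C) S" "((\<lambda>i. cmod (a i - b i) powr p) has_sum D) S"
    and "C + D = 2 * A + 2 * B"
  shows "a i = 0 \<or> b i = 0"
proof (rule ccontr)
  assume ab: "\<not> (a i = 0 \<or> b i = 0)"
  define h where "h = (\<lambda>i. cmod (a i + b i) powr p + cmod (a i - b i) powr p + - (2 * cmod (a i) powr p + 2 * cmod (b i) powr p))"
  have eq: "h j = 0" if "a j = 0 \<or> b j = 0" for j using that by (auto simp: h_def)
  have cmul: "((\<lambda>i. 2 * f i) has_sum 2 * X) S" if "(f has_sum X) S" for f :: "'i \<Rightarrow> real" and X
    using has_sum_cmult_right[OF that, of 2] by simp
  have "(h has_sum (C + D + - (2 * A + 2 * B))) S"
    unfolding h_def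
    by (intro has_sum_add has_sum_uminusI cmul assms)
  then have h: "(h has_sum 0) S" using assms(8) by simp
  show False
  proof (cases "2 < p")
    case True
    then have "0 \<le> h j" for j
      using clarkson_strict(1)[of "a j" "b j" p] p eq[of j] by (cases "a j = 0 \<or> b j = 0") (auto simp: h_def)
    then have "h i = 0" using nonneg_has_sum_le_0D[OF h order_refl _ i] by simp
    then show False using clarkson_strict(1)[of "a i" "b i" p] ab p True by (auto simp: h_def)
  next
    case False
    then have p2: "p < 2" using p by simp
    have "0 \<le> - h j" for j
      using clarkson_strict(2)[of "a j" "b j" p] p p2 eq[of j] by (cases "a j = 0 \<or> b j = 0") (auto simp: h_def)
    moreover have "((\<lambda>j. - h j) has_sum 0) S" using has_sum_uminusI[OF h] by simp
    ultimately have "- h i = 0" using nonneg_has_sum_le_0D[OF _ order_refl, of "\<lambda>j. - h j" S i] i by blast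
    then show False using clarkson_strict(2)[of "a i" "b i" p] ab p p2 by (auto simp: h_def)
  qed
qed

section \<open>Functions on the unit space and isometries near the unit\<close>

definition DA :: "real \<Rightarrow> 'a top_groupoid \<Rightarrow> ('a \<Rightarrow> complex) set" where
  "DA p G = {f \<in> RA p G. \<forall>\<gamma>. f \<gamma> \<noteq> 0 \<longrightarrow> \<gamma> \<in> units G}"

definition unit_fun :: "'a top_groupoid \<Rightarrow> 'a \<Rightarrow> complex" where
  "unit_fun G \<gamma> = (if \<gamma> \<in> units G then 1 else 0)"

text \<open>Only the algebra structure and the norm occur, so isometric isomorphisms preserve the
  set. An element and its inverse are both contractions, hence act as isometries. The difference is
  spelled as a sum with a scalar multiple to match the operations that an isomorphism
  respects.\<close>

definition near_unitaries :: "real \<Rightarrow> 'a top_groupoid \<Rightarrow> ('a \<Rightarrow> complex) set" where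
  "near_unitaries p G = {u \<in> RA p G. \<exists>v\<in>RA p G. convolution G u v = unit_fun G \<and> convolution G v u = unit_fun G \<and>
     lambda_norm p G u \<le> 1 \<and> lambda_norm p G v \<le> 1 \<and> lambda_norm p G (\<lambda>\<gamma>. u \<gamma> + (- 1) * unit_fun G \<gamma>) < 1}"

context red_grpd
begin

lemma DA_RA: "f \<in> DA p G \<Longrightarrow> f \<in> RA p G" by (simp add: DA_def)

lemma DA_units: "f \<in> DA p G \<Longrightarrow> \<gamma> \<notin> units G \<Longrightarrow> f \<gamma> = 0" by (auto simp: DA_def)

lemma continuous_restrict_units:
  fixes h :: "'a \<Rightarrow> complex"
  assumes "continuous_map (unit_top G) euclidean h"
  shows "continuous_map (gtop G) euclidean (\<lambda>\<gamma>. if \<gamma> \<in> units G then h \<gamma> else 0)"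
proof (rule continuous_map_locally_zero[OF openin_units closedin_units order_refl])
  show "continuous_map (subtopology (gtop G) (units G)) euclidean (\<lambda>\<gamma>. if \<gamma> \<in> units G then h \<gamma> else 0)"
    using assms unfolding unit_top_def by (rule continuous_map_eq) auto
qed (auto split: if_splits)

lemma DA_restrict:
  fixes h :: "'a \<Rightarrow> complex"
  assumes "continuous_map (unit_top G) euclidean h"
  shows "(\<lambda>\<gamma>. if \<gamma> \<in> units G then h \<gamma> else 0) \<in> DA p G"
  using Cc_RA[OF Cc_units[OF continuous_restrict_units[OF assms]]] by (auto simp: DA_def split: if_splits)

text \<open>The case distinction forces the value 0 off the units, where
  \<open>F (f \<gamma>) = F 0\<close> may be nonzero.\<close>

lemma DA_compose:
  assumes f: "f \<in> DA p G" and F: "continuous_on UNIV F"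
  shows "(\<lambda>\<gamma>. if \<gamma> \<in> units G then F (f \<gamma>) else 0) \<in> DA p G"
  using continuous_map_euclidean_compose[OF continuous_map_from_subtopology[OF RA_continuous[OF DA_RA[OF f]]] F]
  by (intro DA_restrict) (simp add: unit_top_def)

lemma unit_fun_DA: "unit_fun G \<in> DA p G"
  using DA_restrict[of "\<lambda>_. 1"] by (simp add: unit_fun_def[abs_def])

lemma DA_add: "f \<in> DA p G \<Longrightarrow> g \<in> DA p G \<Longrightarrow> (\<lambda>\<gamma>. f \<gamma> + g \<gamma>) \<in> DA p G"
  using RA_add[of f g] unfolding DA_def mem_Collect_eq by (metis add.right_neutral)

lemma DA_scale: "f \<in> DA p G \<Longrightarrow> (\<lambda>\<gamma>. c * f \<gamma>) \<in> DA p G"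
  using RA_scale[of f c] unfolding DA_def by auto

text \<open>In the sum only the factor sitting at a unit survives. Together with the left-hand
  version, this lets functions on the unit space localise the domain and the range of an arrow
  independently.\<close>

lemma convolution_DA_right:
  assumes "f \<in> DA p G" "\<gamma> \<in> arrows G"
  shows "convolution G n f \<gamma> = n \<gamma> * f (gdom G \<gamma>)"
proof -
  have "convolution G n f \<gamma> = n (gdiv G \<gamma> (gdom G \<gamma>)) * f (gdom G \<gamma>)"
  proof (rule convolution_single)
    fix \<tau> assume "\<tau> \<in> arrows G" "gdom G \<tau> = gdom G \<gamma>" "f \<tau> \<noteq> 0"
    then show "\<tau> = gdom G \<gamma>" using DA_units[OF assms(1), of \<tau>] dom_unit[of \<tau>] by force
  qed (use assms in auto)
  then show ?thesis using assms by simp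
qed

lemma convolution_DA_left:
  assumes "f \<in> DA p G" "\<gamma> \<in> arrows G"
  shows "convolution G f n \<gamma> = f (gran G \<gamma>) * n \<gamma>"
proof -
  have "convolution G f n \<gamma> = f (gdiv G \<gamma> \<gamma>) * n \<gamma>"
  proof (rule convolution_single)
    fix \<tau> assume "\<tau> \<in> arrows G" "gdom G \<tau> = gdom G \<gamma>" "f (gdiv G \<gamma> \<tau>) \<noteq> 0"
    then show "\<tau> = \<gamma>" using DA_units[OF assms(1)] gdiv_unit[of \<gamma> \<tau>] assms(2) by metis
  qed (use assms in auto)
  then show ?thesis by simp
qed

lemma convolution_off: "\<gamma> \<notin> arrows G \<Longrightarrow> convolution G f g \<gamma> = 0"
  by (simp add: convolution_def)

lemma convolution_unit_fun:
  assumes "f \<in> RA p G"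
  shows "convolution G f (unit_fun G) = f" "convolution G (unit_fun G) f = f"
proof -
  show "convolution G f (unit_fun G) = f"
  proof
    fix \<gamma> show "convolution G f (unit_fun G) \<gamma> = f \<gamma>"
      using convolution_DA_right[OF unit_fun_DA, of \<gamma> f] convolution_off[of \<gamma>] RA_zero[OF assms, of \<gamma>]
      by (cases "\<gamma> \<in> arrows G") (auto simp: unit_fun_def)
  qed
  show "convolution G (unit_fun G) f = f"
  proof
    fix \<gamma> show "convolution G (unit_fun G) f \<gamma> = f \<gamma>"
      using convolution_DA_left[OF unit_fun_DA, of \<gamma> f] convolution_off[of \<gamma>] RA_zero[OF assms, of \<gamma>]
      by (cases "\<gamma> \<in> arrows G") (auto simp: unit_fun_def)
  qed
qed

lemma convolution_DA:
  assumes "f \<in> DA p G" "g \<in> DA p G"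
  shows "convolution G f g = (\<lambda>\<gamma>. f \<gamma> * g \<gamma>)"
proof
  fix \<gamma> show "convolution G f g \<gamma> = f \<gamma> * g \<gamma>"
  proof (cases "\<gamma> \<in> units G")
    case True then show ?thesis using convolution_DA_right[OF assms(2), of \<gamma> f] by simp
  next
    case False
    then have "f \<gamma> = 0" using DA_units assms by blast
    then show ?thesis
      using convolution_DA_right[OF assms(2), of \<gamma> f] convolution_off[of \<gamma>] by (cases "\<gamma> \<in> arrows G") auto
  qed
qed

lemma DA_mult: "f \<in> DA p G \<Longrightarrow> g \<in> DA p G \<Longrightarrow> (\<lambda>\<gamma>. f \<gamma> * g \<gamma>) \<in> DA p G"
  using RA_convolution[OF DA_RA DA_RA, of f g] convolution_DA[of f g] by (auto simp: DA_def)

text \<open>The columns of \<open>u\<close> at the unit \<open>gdom G \<gamma>\<close> and at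
  \<open>\<gamma>\<close> span an isometric copy of the two-dimensional l^p space. \<open>u\<close>
  does not increase the norm of the vector with coordinates \<open>c\<close> and \<open>d\<close>,
  and \<open>v\<close>, which brings it back, does not increase the norm of the image; so the two
  norms agree.\<close>

lemma isometry_columns:
  assumes u: "opbound p G 1 u" and v: "opbound p G 1 v" and vu: "convolution G v u = unit_fun G"
    and g: "\<gamma> \<in> arrows G" "\<gamma> \<notin> units G"
  shows "((\<lambda>\<tau>. cmod (c * u \<tau> + d * u (gdiv G \<tau> \<gamma>)) powr p) has_sum (cmod c powr p + cmod d powr p))
    (source_fibre G (gdom G \<gamma>))"
proof -
  define x where "x = gdom G \<gamma>"
  have x: "x \<in> units G" "x \<noteq> \<gamma>" using g unfolding x_def by (auto, metis dom_units)
  have xf: "x \<in> source_fibre G x" "\<gamma> \<in> source_fibre G x" using x g by (auto simp: x_def)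
  let ?S = "source_fibre G x"
  define w where "w = (\<lambda>\<tau>. c * u \<tau> + d * u (gdiv G \<tau> \<gamma>))"
  \<comment> \<open>Coordinates \<open>c\<close> at the unit \<open>x\<close> and \<open>d\<close>
    at \<open>\<gamma>\<close>; \<open>w\<close> is the image of this vector under
    \<open>u\<close>.\<close>
  define \<xi> where "\<xi> = (\<lambda>\<sigma>. if \<sigma> = x then c else d)"
  let ?F = "{x, \<gamma>}"
  let ?B = "lpn p ?F \<xi>"
  have Bp: "?B powr p = cmod c powr p + cmod d powr p"
    using x by (simp add: lpn_powr[OF p1] \<xi>_def)
  have gx: "gdiv G \<tau> x = \<tau>" if "\<tau> \<in> ?S" for \<tau>
    using that x(1) mul_dom[of \<tau>] by simp
  have up: "lpn p E w \<le> ?B" if E: "finite E" "E \<subseteq> ?S" for E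
  proof -
    have "lpn p E w = lpn p E (\<lambda>\<tau>. \<Sum>\<sigma>\<in>?F. u (gdiv G \<tau> \<sigma>) * \<xi> \<sigma>)"
    proof (intro lpn_cong arg_cong[of _ _ cmod])
      fix \<tau> assume "\<tau> \<in> E"
      then have "gdiv G \<tau> x = \<tau>" using E gx by blast
      then show "w \<tau> = (\<Sum>\<sigma>\<in>?F. u (gdiv G \<tau> \<sigma>) * \<xi> \<sigma>)"
        using x(2) by (simp add: w_def \<xi>_def mult.commute)
    qed
    also have "\<dots> \<le> 1 * ?B"
      using opboundD[OF u x(1) E(1) _ E(2), of ?F \<xi>] xf by blast
    finally show ?thesis by simp
  qed
  note b = lp_norm_bounds[of ?S w ?B, OF up lpn_nonneg]
  have "?B = lpn p ?F (\<lambda>\<rho>. \<Sum>\<^sub>\<infinity>\<tau>\<in>?S. v (gdiv G \<rho> \<tau>) * w \<tau>)"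
  proof (intro lpn_cong arg_cong[of _ _ cmod])
    fix \<rho> assume r: "\<rho> \<in> ?F"
    then have rf: "\<rho> \<in> arrows G" "gdom G \<rho> = x" using xf by auto
    have s1: "(\<lambda>\<tau>. v (gdiv G \<rho> \<tau>) * u \<tau>) summable_on ?S"
      using convolution_summable'[OF v u rf(1)] rf(2) by simp
    have s2: "(\<lambda>\<tau>. v (gdiv G \<rho> \<tau>) * u (gdiv G \<tau> \<gamma>)) summable_on ?S"
      using convolution_summable[OF v u rf(1) g(1)] rf(2) by (simp add: x_def)
    have "(\<Sum>\<^sub>\<infinity>\<tau>\<in>?S. v (gdiv G \<rho> \<tau>) * w \<tau>) =
       (\<Sum>\<^sub>\<infinity>\<tau>\<in>?S. c * (v (gdiv G \<rho> \<tau>) * u \<tau>) + d * (v (gdiv G \<rho> \<tau>) * u (gdiv G \<tau> \<gamma>)))"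
      by (simp add: w_def algebra_simps)
    also have "\<dots> = (\<Sum>\<^sub>\<infinity>\<tau>\<in>?S. c * (v (gdiv G \<rho> \<tau>) * u \<tau>)) + (\<Sum>\<^sub>\<infinity>\<tau>\<in>?S. d * (v (gdiv G \<rho> \<tau>) * u (gdiv G \<tau> \<gamma>)))"
      by (intro infsum_add summable_on_cmult_right s1 s2)
    also have "\<dots> = c * (\<Sum>\<^sub>\<infinity>\<tau>\<in>?S. v (gdiv G \<rho> \<tau>) * u \<tau>) + d * (\<Sum>\<^sub>\<infinity>\<tau>\<in>?S. v (gdiv G \<rho> \<tau>) * u (gdiv G \<tau> \<gamma>))"
      using infsum_cmult_right[of c, OF s1] infsum_cmult_right[of d, OF s2] by simp
    also have "(\<Sum>\<^sub>\<infinity>\<tau>\<in>?S. v (gdiv G \<rho> \<tau>) * u \<tau>) = unit_fun G \<rho>"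
      using fun_cong[OF vu, of \<rho>] rf by (simp add: convolution_def)
    also have "(\<Sum>\<^sub>\<infinity>\<tau>\<in>?S. v (gdiv G \<rho> \<tau>) * u (gdiv G \<tau> \<gamma>)) = unit_fun G (gdiv G \<rho> \<gamma>)"
      using convolution_gdiv[of \<rho> \<gamma> v u] rf g by (simp add: vu x_def)
    also have "c * unit_fun G \<rho> + d * unit_fun G (gdiv G \<rho> \<gamma>) = \<xi> \<rho>"
    proof (cases "\<rho> = x")
      case True
      then have "gdiv G \<rho> \<gamma> \<notin> units G" using gdiv_unit[of \<rho> \<gamma>] rf g x x_def by metis
      then show ?thesis using True x by (simp add: unit_fun_def \<xi>_def)
    next
      case False
      then have "\<rho> = \<gamma>" using r by simp
      then show ?thesis using False g by (simp add: unit_fun_def \<xi>_def)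
    qed
    finally show "\<xi> \<rho> = (\<Sum>\<^sub>\<infinity>\<tau>\<in>?S. v (gdiv G \<rho> \<tau>) * w \<tau>)" by simp
  qed
  also have "\<dots> \<le> 1 * lp_norm p ?S w"
    by (rule apply_bound[OF v x(1)]) (use xf b(3) in auto)
  finally have "lp_norm p ?S w = ?B" using b(2) by simp
  then have "lp_norm p ?S w powr p = cmod c powr p + cmod d powr p" using Bp by simp
  moreover have "lp_norm p ?S w powr p = (\<Sum>\<^sub>\<infinity>\<tau>\<in>?S. cmod (w \<tau>) powr p)"
    using p1 by (simp add: lp_norm_def powr_powr infsum_nonneg)
  ultimately have "((\<lambda>\<tau>. cmod (w \<tau>) powr p) has_sum (cmod c powr p + cmod d powr p)) ?S"
    using has_sum_infsum[OF b(1)] by simp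
  then show ?thesis by (simp only: w_def x_def)
qed

text \<open>Row \<open>\<gamma>\<close> holds \<open>u \<gamma>\<close> in the column of the unit
  \<open>gdom G \<gamma>\<close> and the value of \<open>u\<close> at the unit
  \<open>gran G \<gamma>\<close> in column \<open>\<gamma>\<close>. One of them is 0 by the equality
  case of Clarkson, and the second is not, being at distance less than 1 from 1.\<close>

lemma near_unitaries_DA:
  assumes p2: "p \<noteq> 2" and u: "u \<in> near_unitaries p G"
  shows "u \<in> DA p G"
proof -
  obtain v where uv: "u \<in> RA p G" "v \<in> RA p G" "convolution G v u = unit_fun G" "lambda_norm p G u \<le> 1"
    "lambda_norm p G v \<le> 1" and d: "lambda_norm p G (\<lambda>\<gamma>. u \<gamma> + (- 1) * unit_fun G \<gamma>) < 1"
    using u unfolding near_unitaries_def by blast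
  have b: "opbound p G 1 u" "opbound p G 1 v"
    using opbound_mono[OF RA_norm] uv by blast+
  have ub: "u \<gamma> \<noteq> 0" if "\<gamma> \<in> units G" for \<gamma>
  proof -
    have "(\<lambda>\<gamma>. u \<gamma> + (- 1) * unit_fun G \<gamma>) \<in> RA p G"
      by (intro RA_add RA_scale uv DA_RA unit_fun_DA)
    from opbound_pointwise[OF RA_norm[OF this], of \<gamma>] have "cmod (u \<gamma> - 1) < 1"
      using that d by (simp add: unit_fun_def)
    then show ?thesis by auto
  qed
  have "u \<gamma> = 0" if g: "\<gamma> \<in> arrows G" "\<gamma> \<notin> units G" for \<gamma>
  proof -
    note h = isometry_columns[OF b uv(3) g]
    \<comment> \<open>The sums 1, 1, 2, 2 belong to the coefficient pairs (1, 0), (0, 1), (1, 1) and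
      (1, -1); they satisfy \<open>2 + 2 = 2 * 1 + 2 * 1\<close>.\<close>
    have "u \<gamma> = 0 \<or> u (gdiv G \<gamma> \<gamma>) = 0"
    proof (rule clarkson_equality[OF p1 p2, of \<gamma> _ u 1 "\<lambda>\<tau>. u (gdiv G \<tau> \<gamma>)" 1 2 2])
      show "\<gamma> \<in> source_fibre G (gdom G \<gamma>)" using g by simp
      show "((\<lambda>\<tau>. cmod (u \<tau>) powr p) has_sum 1) (source_fibre G (gdom G \<gamma>))"
        using h[of 1 0] by simp
      show "((\<lambda>\<tau>. cmod (u (gdiv G \<tau> \<gamma>)) powr p) has_sum 1) (source_fibre G (gdom G \<gamma>))"
        using h[of 0 1] by simp
      show "((\<lambda>\<tau>. cmod (u \<tau> + u (gdiv G \<tau> \<gamma>)) powr p) has_sum 2) (source_fibre G (gdom G \<gamma>))"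
        using h[of 1 1] by simp
      show "((\<lambda>\<tau>. cmod (u \<tau> - u (gdiv G \<tau> \<gamma>)) powr p) has_sum 2) (source_fibre G (gdom G \<gamma>))"
        using h[of 1 "-1"] by simp
    qed simp
    then show ?thesis using ub[of "gran G \<gamma>"] g by simp
  qed
  then show ?thesis using uv(1) RA_zero[OF uv(1)] unfolding DA_def by blast
qed

lemma opbound_DA:
  assumes "f \<in> DA p G" "0 \<le> M" "\<And>x. x \<in> units G \<Longrightarrow> cmod (f x) \<le> M"
  shows "opbound p G M f"
proof (rule opbound_bisection)
  show "inj_on (gdom G) (units G)" "inj_on (gran G) (units G)"
    using bisection_units by (auto simp: bisection_def)
  show "cmod (f \<gamma>) \<le> M" for \<gamma> using assms DA_units[OF assms(1), of \<gamma>] by (cases "\<gamma> \<in> units G") auto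
qed (use assms DA_units[OF assms(1)] in auto)

text \<open>A real \<open>g\<close> is, up to the sign \<open>s\<close>, the imaginary part of a
  unimodular function with positive real part. Its inverse is its conjugate, given by the opposite
  sign, and the bound 1/2 on \<open>g\<close> keeps it close to the unit.\<close>

lemma DA_half_bounded_near_unitary:
  fixes s :: real
  assumes g: "g \<in> DA p G" "\<And>x. x \<in> units G \<Longrightarrow> g x \<in> \<real> \<and> cmod (g x) \<le> 1 / 2" and s: "s = 1 \<or> s = - 1"
  shows "(\<lambda>\<gamma>. if \<gamma> \<in> units G then of_real (sqrt (1 - (Re (g \<gamma>))\<^sup>2)) + \<i> * of_real (s * Re (g \<gamma>)) else 0) \<in> near_unitaries p G"
proof -
  define F where "F = (\<lambda>s z. complex_of_real (sqrt (1 - (Re z)\<^sup>2)) + \<i> * of_real (s * Re z))"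
  define u where "u = (\<lambda>s \<gamma>. if \<gamma> \<in> units G then F s (g \<gamma>) else 0)"
  have uD: "u s \<in> DA p G" for s
    unfolding u_def F_def by (intro DA_compose g(1) continuous_intros)
  have sq: "(sqrt (1 - (Re (g x))\<^sup>2))\<^sup>2 = 1 - (Re (g x))\<^sup>2" "3 / 4 \<le> sqrt (1 - (Re (g x))\<^sup>2)" if "x \<in> units G" for x
  proof -
    have "\<bar>Re (g x)\<bar> \<le> 1 / 2" using g(2)[OF that] abs_Re_le_cmod order_trans by blast
    then have "(Re (g x))\<^sup>2 \<le> (1 / 2)\<^sup>2" by (metis abs_ge_zero power2_abs power_mono)
    then have *: "(Re (g x))\<^sup>2 \<le> 1 / 4" by (simp add: power2_eq_square)
    then show "(sqrt (1 - (Re (g x))\<^sup>2))\<^sup>2 = 1 - (Re (g x))\<^sup>2" by simp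
    show "3 / 4 \<le> sqrt (1 - (Re (g x))\<^sup>2)" by (rule real_le_rsqrt) (use * in \<open>simp add: power2_eq_square\<close>)
  qed
  have nF: "cmod (F s (g x)) = 1" if "s = 1 \<or> s = - 1" "x \<in> units G" for s x
    using that sq(1)[OF that(2)] by (auto simp: F_def cmod_def)
  have nu: "lambda_norm p G (u s) \<le> 1" if "s = 1 \<or> s = - 1" for s
    by (rule opbound_lambda_norm(1)[OF opbound_DA[OF uD]]) (use nF[OF that] in \<open>auto simp: u_def\<close>)
  have inv: "convolution G (u s) (u (- s)) = unit_fun G" if "s = 1 \<or> s = - 1" for s
  proof -
    have "F s (g x) * F (- s) (g x) = 1" if x: "x \<in> units G" for x
      using \<open>s = 1 \<or> s = - 1\<close> sq(1)[OF x]
      by (auto simp: F_def complex_eq_iff power2_eq_square)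
    then show ?thesis unfolding convolution_DA[OF uD uD] by (auto simp: u_def unit_fun_def)
  qed
  have D: "(\<lambda>\<gamma>. u s \<gamma> + (- 1) * unit_fun G \<gamma>) \<in> DA p G"
    by (intro DA_add DA_scale uD unit_fun_DA)
  \<comment> \<open>The squared distance is \<open>2 - 2 * ?q\<close>, and
    \<open>?q \<ge> 3 / 4\<close> makes it at most 1/2, which is below
    \<open>(3 / 4)\<^sup>2\<close>.\<close>
  have "cmod (F s (g x) - 1) \<le> 3 / 4" if x: "x \<in> units G" for x
  proof -
    let ?q = "sqrt (1 - (Re (g x))\<^sup>2)"
    have "(cmod (F s (g x) - 1))\<^sup>2 = (?q - 1)\<^sup>2 + (Re (g x))\<^sup>2"
      using s by (auto simp: F_def cmod_power2)
    also have "\<dots> = 2 - 2 * ?q" using sq(1)[OF x] by (simp add: power2_eq_square algebra_simps)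
    also have "\<dots> \<le> (3 / 4)\<^sup>2" using sq(2)[OF x] by (simp add: power2_eq_square)
    finally show ?thesis by (rule power2_le_imp_le) simp
  qed
  then have "lambda_norm p G (\<lambda>\<gamma>. u s \<gamma> + (- 1) * unit_fun G \<gamma>) \<le> 3 / 4"
    by (intro opbound_lambda_norm(1)[OF opbound_DA[OF D]]) (auto simp: u_def unit_fun_def)
  then have "u s \<in> near_unitaries p G"
    unfolding near_unitaries_def using DA_RA[OF uD] nu[of s] nu[of "- s"] inv[of s] inv[of "- s"] s
    by (auto intro!: bexI[of _ "u (- s)"])
  then show ?thesis unfolding u_def F_def .
qed

text \<open>Every function on the unit space is a linear combination of four near unitaries: its
  real and imaginary parts are scaled down to modulus at most 1/2, and each scaled part is the
  difference of two conjugate unimodular functions divided by \<open>2 * \<i>\<close>. The form is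
  that of an induction rule.\<close>

lemma DA_span:
  assumes f: "f \<in> DA p G" 
    and add: "\<And>f g. f \<in> RA p G \<Longrightarrow> g \<in> RA p G \<Longrightarrow> P f \<Longrightarrow> P g \<Longrightarrow> P (\<lambda>\<gamma>. f \<gamma> + g \<gamma>)"
    and scale: "\<And>f c. f \<in> RA p G \<Longrightarrow> P f \<Longrightarrow> P (\<lambda>\<gamma>. c * f \<gamma>)"
    and U: "\<And>u. u \<in> near_unitaries p G \<Longrightarrow> P u"
  shows "P f"
proof -
  have half: "P g" if g: "g \<in> DA p G" "\<And>x. x \<in> units G \<Longrightarrow> g x \<in> \<real> \<and> cmod (g x) \<le> 1 / 2" for g
  proof -
    let ?u = "\<lambda>s \<gamma>. if \<gamma> \<in> units G then of_real (sqrt (1 - (Re (g \<gamma>))\<^sup>2)) + \<i> * of_real (s * Re (g \<gamma>)) else 0"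
    have u: "?u 1 \<in> near_unitaries p G" "?u (-1) \<in> near_unitaries p G"
      using DA_half_bounded_near_unitary[OF g] by blast+
    then have uR: "?u 1 \<in> RA p G" "?u (-1) \<in> RA p G" by (auto simp: near_unitaries_def)
    have "P (\<lambda>\<gamma>. (- \<i> / 2) * ?u 1 \<gamma> + (\<i> / 2) * ?u (-1) \<gamma>)"
      by (intro add scale U u RA_scale uR)
    also have "(\<lambda>\<gamma>. (- \<i> / 2) * ?u 1 \<gamma> + (\<i> / 2) * ?u (-1) \<gamma>) = g"
    proof
      fix \<gamma> show "(- \<i> / 2) * ?u 1 \<gamma> + (\<i> / 2) * ?u (-1) \<gamma> = g \<gamma>"
        using g(2)[of \<gamma>] DA_units[OF g(1), of \<gamma>]
        by (auto simp: complex_eq_iff complex_is_Real_iff)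
    qed
    finally show ?thesis .
  qed
  obtain M where M: "opbound p G M f" using RA_bdd DA_RA f by blast
  \<comment> \<open>Twice a bound for \<open>f\<close>, with 1 added so that \<open>N\<close> is
    positive even if \<open>M = 0\<close>.\<close>
  define N where "N = 2 * (M + 1)"
  have M0: "0 \<le> M" using opbound_nonneg[OF M] .
  have N0: "N > 0" using M0 by (simp add: N_def)
  let ?g = "\<lambda>h :: complex \<Rightarrow> real. \<lambda>\<gamma>. if \<gamma> \<in> units G then complex_of_real (h (f \<gamma>) / N) else 0"
  have g: "?g h \<in> DA p G \<and> P (?g h)" if h: "continuous_on UNIV h" "\<And>z. \<bar>h z\<bar> \<le> cmod z" for h
  proof
    have "continuous_on UNIV (\<lambda>z. complex_of_real (h z / N))"
      using h(1) N0 by (intro continuous_intros) auto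
    from DA_compose[OF f this] show D: "?g h \<in> DA p G" .
    have "cmod (?g h x) \<le> 1 / 2" if x: "x \<in> units G" for x
    proof -
      have "\<bar>h (f x)\<bar> \<le> M" using h(2)[of "f x"] opbound_pointwise[OF M, of x] x by simp
      then have "\<bar>h (f x)\<bar> / N \<le> 1 / 2" using N0 by (simp add: N_def divide_le_eq)
      then show ?thesis using x N0 by (simp add: norm_divide)
    qed
    moreover have "?g h x \<in> \<real>" for x by (simp del: of_real_divide)
    ultimately show "P (?g h)" by (intro half D) blast
  qed
  have re: "?g Re \<in> DA p G \<and> P (?g Re)" and im: "?g Im \<in> DA p G \<and> P (?g Im)"
    using g[of Re] g[of Im] abs_Re_le_cmod abs_Im_le_cmod
      linear_continuous_on[OF bounded_linear_Re] linear_continuous_on[OF bounded_linear_Im] by blast+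
  have "P (\<lambda>\<gamma>. of_real N * ?g Re \<gamma> + (of_real N * \<i>) * ?g Im \<gamma>)"
    by (intro add scale RA_scale DA_RA conjunct1[OF re] conjunct1[OF im] conjunct2[OF re] conjunct2[OF im])
  also have "(\<lambda>\<gamma>. of_real N * ?g Re \<gamma> + (of_real N * \<i>) * ?g Im \<gamma>) = f"
  proof
    fix \<gamma> show "of_real N * ?g Re \<gamma> + (of_real N * \<i>) * ?g Im \<gamma> = f \<gamma>"
      using N0 DA_units[OF f, of \<gamma>] by (auto simp: complex_eq_iff)
  qed
  finally show ?thesis .
qed

end

section \<open>The homeomorphism of the unit spaces\<close>

context red_grpd
begin

lemma DA_separate:
  assumes "openin (unit_top G) V" "x \<in> V"
  obtains f where "f \<in> DA p G" "f x = 1" "\<And>z. f z \<noteq> 0 \<Longrightarrow> z \<in> V"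
proof -
  have x: "x \<in> units G" using assms openin_subset by fastforce
  have c1: "closedin (unit_top G) (units G - V)"
    using openin_closedin_eq[of "unit_top G" V] assms by simp
  have c2: "closedin (unit_top G) {x}"
    using closedin_Hausdorff_singleton[OF Hausdorff_units] x by simp
  have dj: "disjnt (units G - V) {x}" using assms by (auto simp: disjnt_def)
  obtain q :: "'a \<Rightarrow> real" where q: "continuous_map (unit_top G) euclideanreal q"
    "q ` (units G - V) \<subseteq> {0}" "q ` {x} \<subseteq> {1}"
    by (rule Urysohn_lemma_alt[OF normal_units c1 c2 dj])
  have "continuous_map (unit_top G) euclidean (\<lambda>z. complex_of_real (q z))"
    by (rule continuous_map_euclidean_compose[OF q(1)]) (intro continuous_intros)
  from DA_restrict[OF this] show ?thesis
    by (rule that) (use x q in \<open>auto split: if_splits\<close>)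
qed

lemma openin_support:
  assumes "f \<in> RA p G"
  shows "openin (gtop G) {\<gamma>. f \<gamma> \<noteq> 0}"
proof -
  have "{\<gamma>. f \<gamma> \<noteq> 0} = {\<gamma> \<in> topspace (gtop G). f \<gamma> \<in> - {0}}" using RA_zero[OF assms] by auto
  then show ?thesis
    using openin_continuous_map_preimage[OF RA_continuous[OF assms], of "- {0}"]
    by (simp add: open_Compl)
qed

lemma openin_unit_support:
  assumes "f \<in> DA p G"
  shows "openin (unit_top G) {\<gamma>. f \<gamma> \<noteq> 0}"
  using openin_support[OF DA_RA[OF assms]] assms
  unfolding unit_top_def by (auto simp: openin_open_subtopology openin_units DA_def)

lemma DA_eq_points:
  assumes "x \<in> units G" "z \<in> units G" "\<And>f. f \<in> DA p G \<Longrightarrow> f x = f z"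
  shows "x = z"
proof (rule ccontr)
  assume ne: "x \<noteq> z"
  have "closedin (unit_top G) {z}"
    using closedin_Hausdorff_singleton[OF Hausdorff_units] assms by simp
  then have "openin (unit_top G) (units G - {z})"
    using openin_diff[OF openin_topspace, of "unit_top G" "{z}"] by simp
  moreover have "x \<in> units G - {z}" using ne assms by simp
  ultimately obtain f where "f \<in> DA p G" "f x = 1" "f z = 0"
    using DA_separate[of "units G - {z}" x] by blast
  then show False using assms(3)[of f] by simp
qed

lemma DA_inverse:
  assumes "e \<in> DA p G" "\<And>x. x \<in> units G \<Longrightarrow> e x \<noteq> 0"
  obtains e' where "e' \<in> DA p G" "\<And>x. x \<in> units G \<Longrightarrow> e x * e' x = 1"
proof -
  have "continuous_map (unit_top G) euclidean e"
    using RA_continuous[OF DA_RA[OF assms(1)]] by (simp add: unit_top_def continuous_map_from_subtopology)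
  then have "continuous_map (unit_top G) euclidean (\<lambda>x. inverse (e x))"
    using assms(2) unfolding continuous_map_atin limitin_canonical_iff by (auto intro: tendsto_inverse)
  from DA_restrict[OF this] show ?thesis by (rule that) (use assms(2) in auto)
qed

end

text \<open>The inverse \<open>\<Psi>\<close> is a parameter so that the two groupoids can change
  places. The homomorphism laws are assumed for \<open>\<Phi>\<close> and derived for
  \<open>\<Psi>\<close> in \<open>sym\<close>.\<close>

locale alg_iso = G: red_grpd G p + H: red_grpd H p
  for G :: "'a top_groupoid" and H :: "'b top_groupoid" and p :: real +
  fixes \<Phi> :: "('a \<Rightarrow> complex) \<Rightarrow> 'b \<Rightarrow> complex" and \<Psi> :: "('b \<Rightarrow> complex) \<Rightarrow> 'a \<Rightarrow> complex"
  assumes closed: "f \<in> RA p G \<Longrightarrow> \<Phi> f \<in> RA p H" "g \<in> RA p H \<Longrightarrow> \<Psi> g \<in> RA p G"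
    and inverse: "f \<in> RA p G \<Longrightarrow> \<Psi> (\<Phi> f) = f" "g \<in> RA p H \<Longrightarrow> \<Phi> (\<Psi> g) = g"
    and add: "f \<in> RA p G \<Longrightarrow> f' \<in> RA p G \<Longrightarrow> \<Phi> (\<lambda>\<gamma>. f \<gamma> + f' \<gamma>) = (\<lambda>\<eta>. \<Phi> f \<eta> + \<Phi> f' \<eta>)"
    and scale: "f \<in> RA p G \<Longrightarrow> \<Phi> (\<lambda>\<gamma>. c * f \<gamma>) = (\<lambda>\<eta>. c * \<Phi> f \<eta>)"
    and mult: "f \<in> RA p G \<Longrightarrow> f' \<in> RA p G \<Longrightarrow> \<Phi> (convolution G f f') = convolution H (\<Phi> f) (\<Phi> f')"
    and norm: "f \<in> RA p G \<Longrightarrow> lambda_norm p H (\<Phi> f) = lambda_norm p G f"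
    and p2: "p \<noteq> 2"
begin

lemma sym: "alg_iso H G p \<Psi> \<Phi>"
proof (unfold_locales)
  fix f f' c assume f: "f \<in> RA p H"
  obtain g where g: "g \<in> RA p G" "f = \<Phi> g" using f closed inverse by metis
  show "\<Psi> (\<lambda>\<gamma>. c * f \<gamma>) = (\<lambda>\<eta>. c * \<Psi> f \<eta>)"
    using scale[OF g(1)] inverse(1)[OF G.RA_scale[OF g(1)]] inverse(1)[OF g(1)] by (simp add: g(2))
  show "lambda_norm p G (\<Psi> f) = lambda_norm p H f"
    using norm[OF g(1)] inverse(1)[OF g(1)] by (simp add: g(2))
  assume f': "f' \<in> RA p H"
  obtain g' where g': "g' \<in> RA p G" "f' = \<Phi> g'" using f' closed inverse by metis
  show "\<Psi> (\<lambda>\<gamma>. f \<gamma> + f' \<gamma>) = (\<lambda>\<eta>. \<Psi> f \<eta> + \<Psi> f' \<eta>)"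
    using add[OF g(1) g'(1)] inverse(1)[OF G.RA_add[OF g(1) g'(1)]] inverse(1)[OF g(1)] inverse(1)[OF g'(1)]
    by (simp add: g(2) g'(2)) 
  show "\<Psi> (convolution H f f') = convolution G (\<Psi> f) (\<Psi> f')"
    using mult[OF g(1) g'(1)] inverse(1)[OF G.RA_convolution[OF g(1) g'(1)]] inverse(1)[OF g(1)] inverse(1)[OF g'(1)]
    by (simp add: g(2) g'(2))
qed (use closed inverse p2 in auto)

lemma zero: "\<Phi> (\<lambda>_. 0) = (\<lambda>_. 0)"
  using scale[OF G.Cc_RA[OF G.zero_Cc], of 0] by simp

text \<open>By surjectivity \<open>unit_fun H\<close> is itself an image, so the image of
  \<open>unit_fun G\<close> is a left unit for it; this forces the two to be equal.\<close>

lemma unit: "\<Phi> (unit_fun G) = unit_fun H"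
proof -
  have G1: "unit_fun G \<in> RA p G" and H1: "unit_fun H \<in> RA p H"
    using G.DA_RA G.unit_fun_DA H.DA_RA H.unit_fun_DA by blast+
  have "convolution H (\<Phi> (unit_fun G)) (\<Phi> (\<Psi> (unit_fun H))) = \<Phi> (\<Psi> (unit_fun H))"
    using mult[OF G1 closed(2)[OF H1]] G.convolution_unit_fun(2)[OF closed(2)[OF H1]] by simp
  then show ?thesis
    using inverse(2)[OF H1] H.convolution_unit_fun(1)[OF closed(1)[OF G1]] by simp
qed

lemma near_unitaries: "u \<in> near_unitaries p G \<Longrightarrow> \<Phi> u \<in> near_unitaries p H"
proof -
  assume "u \<in> near_unitaries p G"
  then obtain v where v: "u \<in> RA p G" "v \<in> RA p G" "convolution G u v = unit_fun G" "convolution G v u = unit_fun G"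
     "lambda_norm p G u \<le> 1" "lambda_norm p G v \<le> 1" "lambda_norm p G (\<lambda>\<gamma>. u \<gamma> + (- 1) * unit_fun G \<gamma>) < 1"
    unfolding near_unitaries_def by blast
  have G1: "unit_fun G \<in> RA p G" using G.DA_RA G.unit_fun_DA by blast
  have "\<Phi> (\<lambda>\<gamma>. u \<gamma> + (- 1) * unit_fun G \<gamma>) = (\<lambda>\<gamma>. \<Phi> u \<gamma> + (- 1) * unit_fun H \<gamma>)"
    using add[OF v(1) G.RA_scale[OF G1, of "-1"]] scale[OF G1, of "-1"] unit by simp
  then have "lambda_norm p H (\<lambda>\<gamma>. \<Phi> u \<gamma> + (- 1) * unit_fun H \<gamma>) < 1"
    using norm[OF G.RA_add[OF v(1) G.RA_scale[OF G1, of "-1"]]] v(7) by simp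
  moreover have "convolution H (\<Phi> u) (\<Phi> v) = unit_fun H" "convolution H (\<Phi> v) (\<Phi> u) = unit_fun H"
    using mult[OF v(1,2)] mult[OF v(2,1)] v(3,4) unit by auto
  ultimately show ?thesis
    unfolding near_unitaries_def using v closed norm by auto
qed

lemma DA:
  assumes "f \<in> DA p G"
  shows "\<Phi> f \<in> DA p H"
  using assms
proof (rule G.DA_span)
  fix u assume "u \<in> near_unitaries p G"
  then show "\<Phi> u \<in> DA p H" using near_unitaries H.near_unitaries_DA p2 by blast
qed (simp_all add: add scale H.DA_add H.DA_scale)

lemma DA_mult:
  assumes "f \<in> DA p G" "g \<in> DA p G"
  shows "\<Phi> (\<lambda>\<gamma>. f \<gamma> * g \<gamma>) = (\<lambda>\<eta>. \<Phi> f \<eta> * \<Phi> g \<eta>)"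
  using mult[OF G.DA_RA G.DA_RA, OF assms] G.convolution_DA[OF assms] H.convolution_DA[OF DA DA, OF assms] by simp

text \<open>Evaluating \<open>\<Phi> f\<close> at \<open>y\<close> is a character on the continuous
  functions of a compact space. Were it not evaluation at a point, finitely many functions in its
  kernel would have no common zero, and the sum of their squared moduli would be an invertible
  element of the kernel.\<close>

lemma character:
  assumes y: "y \<in> units H"
  shows "\<exists>x\<in>units G. \<forall>f\<in>DA p G. \<Phi> f y = f x"
proof (rule ccontr)
  assume no: "\<not> ?thesis"
  define Z where "Z = {g \<in> DA p G. \<Phi> g y = 0}"
  have "\<exists>g\<in>Z. g x \<noteq> 0" if x: "x \<in> units G" for x
  proof -
    obtain f where f: "f \<in> DA p G" "\<Phi> f y \<noteq> f x" using no x by blast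
    let ?g = "\<lambda>\<gamma>. f \<gamma> + (- \<Phi> f y) * unit_fun G \<gamma>"
    have "\<Phi> ?g = (\<lambda>\<eta>. \<Phi> f \<eta> + (- \<Phi> f y) * unit_fun H \<eta>)"
      using add[OF G.DA_RA[OF f(1)] G.RA_scale[OF G.DA_RA[OF G.unit_fun_DA], of "- \<Phi> f y"]]
        scale[OF G.DA_RA[OF G.unit_fun_DA], of "- \<Phi> f y"] unit by simp
    then have "\<Phi> ?g y = 0" using y by (simp add: unit_fun_def)
    moreover have "?g \<in> DA p G" by (intro G.DA_add G.DA_scale G.unit_fun_DA f)
    ultimately have "?g \<in> Z" unfolding Z_def mem_Collect_eq by (intro conjI)
    moreover have "?g x \<noteq> 0" using f(2) x by (simp add: unit_fun_def)
    ultimately show ?thesis by (intro bexI[of _ ?g])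
  qed
  then have cov: "units G \<subseteq> \<Union> ((\<lambda>g. {\<gamma>. g \<gamma> \<noteq> 0}) ` Z)" by blast
  have op: "openin (unit_top G) U" if "U \<in> (\<lambda>g. {\<gamma>. g \<gamma> \<noteq> 0}) ` Z" for U
    using that G.openin_unit_support by (auto simp: Z_def)
  obtain \<F> where F: "finite \<F>" "\<F> \<subseteq> (\<lambda>g. {\<gamma>. g \<gamma> \<noteq> 0}) ` Z" "units G \<subseteq> \<Union> \<F>"
    using G.compact[unfolded compact_space_alt G.topspace_unit_top, rule_format, of "(\<lambda>g. {\<gamma>. g \<gamma> \<noteq> 0}) ` Z"]
      op cov by meson
  obtain I where "I \<subseteq> Z" "finite I" "\<F> = (\<lambda>g. {\<gamma>. g \<gamma> \<noteq> 0}) ` I"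
    using finite_subset_image[OF F(1,2)] by blast
  then have I: "finite I" "I \<subseteq> Z" "units G \<subseteq> \<Union> ((\<lambda>g. {\<gamma>. g \<gamma> \<noteq> 0}) ` I)"
    using F(3) by simp_all
  have "\<exists>e\<in>DA p G. \<Phi> e y = 0 \<and> (\<forall>x. 0 \<le> Re (e x)) \<and> (\<forall>x. \<forall>g\<in>I. g x \<noteq> 0 \<longrightarrow> 0 < Re (e x))"
    using I(1,2)
  proof (induction I)
    case empty
    have "(\<lambda>_. 0) \<in> DA p G" using G.DA_scale[OF G.unit_fun_DA, of 0] by simp
    then show ?case using zero by (intro bexI[of _ "\<lambda>_. 0"]) auto
  next
    case (insert g I)
    have "I \<subseteq> Z" using insert.prems by simp
    from insert.IH[OF this]
    obtain e where e: "e \<in> DA p G" "\<Phi> e y = 0" "\<And>x. 0 \<le> Re (e x)" "\<And>x g. g \<in> I \<Longrightarrow> g x \<noteq> 0 \<Longrightarrow> 0 < Re (e x)"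
      by metis
    have g: "g \<in> DA p G" "\<Phi> g y = 0" using insert.prems by (auto simp: Z_def)
    have gc: "(\<lambda>\<gamma>. if \<gamma> \<in> units G then cnj (g \<gamma>) else 0) \<in> DA p G"
      by (intro G.DA_compose g continuous_intros)
    moreover have "(\<lambda>\<gamma>. if \<gamma> \<in> units G then cnj (g \<gamma>) else 0) = (\<lambda>\<gamma>. cnj (g \<gamma>))"
      using G.DA_units[OF g(1)] by auto
    ultimately have gc: "(\<lambda>\<gamma>. cnj (g \<gamma>)) \<in> DA p G" by simp
    \<comment> \<open>The new term stays in the kernel by multiplicativity, because \<open>g\<close>
      is in it; \<open>\<Phi>\<close> is not known to commute with conjugation.\<close>
    let ?e = "\<lambda>\<gamma>. e \<gamma> + cnj (g \<gamma>) * g \<gamma>"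
    have "?e \<in> DA p G" by (intro G.DA_add G.DA_mult e g gc)
    moreover have "\<Phi> ?e = (\<lambda>\<eta>. \<Phi> e \<eta> + \<Phi> (\<lambda>\<gamma>. cnj (g \<gamma>)) \<eta> * \<Phi> g \<eta>)"
      using add[OF G.DA_RA G.DA_RA, OF e(1) G.DA_mult[OF gc g(1)]] DA_mult[OF gc g(1)] by simp
    then have "\<Phi> ?e y = 0" using e g by simp
    moreover have R: "Re (?e x) = Re (e x) + (cmod (g x))\<^sup>2" for x
      unfolding cmod_power2 by (simp add: power2_eq_square)
    moreover have "0 < Re (?e x)" if "g' \<in> insert g I" "g' x \<noteq> 0" for g' x
      unfolding R using that e(3)[of x] e(4)[of g' x] by (auto intro: add_nonneg_pos add_pos_nonneg)
    moreover have "0 \<le> Re (?e x)" for x unfolding R using e(3)[of x] by simp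
    ultimately show ?case by (intro bexI[of _ ?e]) blast+
  qed
  then obtain e where e: "e \<in> DA p G" "\<Phi> e y = 0" "\<And>x g. g \<in> I \<Longrightarrow> g x \<noteq> 0 \<Longrightarrow> 0 < Re (e x)" by metis
  have "e x \<noteq> 0" if "x \<in> units G" for x using I(3) e(3)[of _ x] that by fastforce
  then obtain e' where e': "e' \<in> DA p G" "\<And>x. x \<in> units G \<Longrightarrow> e x * e' x = 1"
    using G.DA_inverse[OF e(1)] by blast
  have "(\<lambda>\<gamma>. e \<gamma> * e' \<gamma>) = unit_fun G"
    using e'(2) G.DA_units[OF e(1)] by (auto simp: unit_fun_def)
  then have "\<Phi> e y * \<Phi> e' y = unit_fun H y" using DA_mult[OF e(1) e'(1)] unit by (metis (no_types))
  then show False using e(2) y by (simp add: unit_fun_def)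
qed

text \<open>The direction is reversed, as for spectra of function algebras: a homomorphism from
  functions on \<open>G\<close> to functions on \<open>H\<close> sends units of \<open>H\<close> to
  units of \<open>G\<close>. The choice is unique because functions separate units.\<close>

definition spec :: "'b \<Rightarrow> 'a" where
  "spec y = (SOME x. x \<in> units G \<and> (\<forall>f\<in>DA p G. \<Phi> f y = f x))"

lemma spec:
  assumes "y \<in> units H"
  shows "spec y \<in> units G" "f \<in> DA p G \<Longrightarrow> \<Phi> f y = f (spec y)"
proof -
  have "spec y \<in> units G \<and> (\<forall>f\<in>DA p G. \<Phi> f y = f (spec y))"
    unfolding spec_def by (rule someI_ex) (use character[OF assms] in blast)
  then show "spec y \<in> units G" "f \<in> DA p G \<Longrightarrow> \<Phi> f y = f (spec y)" by auto
qed

text \<open>Evaluating \<open>g\<close> at the composite of the two point maps amounts to evaluating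
  \<open>\<Phi> (\<Psi> g)\<close>, and functions on the unit space separate its points.\<close>

lemma spec_inverse:
  assumes "y \<in> units H"
  shows "alg_iso.spec H p \<Psi> (spec y) = y"
proof -
  interpret S: alg_iso H G p \<Psi> \<Phi> by (rule sym)
  show ?thesis
  proof (rule H.DA_eq_points)
    show "S.spec (spec y) \<in> units H" using S.spec spec assms by blast
    fix g assume g: "g \<in> DA p H"
    then have "g (S.spec (spec y)) = \<Psi> g (spec y)" using S.spec(2)[OF spec(1)[OF assms] g] by simp
    also have "\<dots> = \<Phi> (\<Psi> g) y" using spec(2)[OF assms S.DA[OF g]] by simp
    also have "\<dots> = g y" using inverse H.DA_RA[OF g] by simp
    finally show "g (S.spec (spec y)) = g y" .
  qed (rule assms)
qed

lemma spec_inj: "y \<in> units H \<Longrightarrow> z \<in> units H \<Longrightarrow> spec y = spec z \<longleftrightarrow> y = z"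
  using spec_inverse by metis

text \<open>By Urysohn's lemma the nonvanishing sets of functions form a base of the unit space, and
  the preimage of such a set is the nonvanishing set of the image function.\<close>

lemma spec_continuous: "continuous_map (unit_top H) (unit_top G) spec"
  unfolding continuous_map_def
proof (intro conjI allI impI)
  show "spec \<in> topspace (unit_top H) \<rightarrow> topspace (unit_top G)" using spec(1) by simp
  fix V assume V: "openin (unit_top G) V"
  show "openin (unit_top H) {y \<in> topspace (unit_top H). spec y \<in> V}"
  proof (subst openin_subopen, clarify)
    fix y assume y: "y \<in> topspace (unit_top H)" "spec y \<in> V"
    obtain f where f: "f \<in> DA p G" "f (spec y) = 1" "\<And>z. f z \<noteq> 0 \<Longrightarrow> z \<in> V"
      using G.DA_separate[OF V y(2)] by metis
    let ?T = "{\<eta>. \<Phi> f \<eta> \<noteq> 0}"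
    have T: "openin (unit_top H) ?T" using H.openin_unit_support[OF DA[OF f(1)]] .
    moreover have "?T \<subseteq> {y \<in> topspace (unit_top H). spec y \<in> V}"
    proof
      fix z assume z: "z \<in> ?T"
      then have zu: "z \<in> units H" using openin_subset[OF T] by auto
      then show "z \<in> {y \<in> topspace (unit_top H). spec y \<in> V}" using z spec(2)[OF zu f(1)] f(3) by simp
    qed
    moreover have "y \<in> ?T" using y(1) spec(2)[OF _ f(1), of y] f(2) by simp
    ultimately show "\<exists>T. openin (unit_top H) T \<and> y \<in> T \<and> T \<subseteq> {y \<in> topspace (unit_top H). spec y \<in> V}" by blast
  qed
qed

end

section \<open>Reconstruction of the groupoid\<close>

context etale_grpd
begin

text \<open>Two distinct arrows of \<open>W\<close> with a common domain have disjoint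
  neighbourhoods whose domains overlap in a nonempty open set. By density it contains some
  \<open>z\<close> with trivial isotropy, the domain of an arrow \<open>a\<close> in one
  neighbourhood and \<open>b\<close> in the other. Their ranges agree by assumption, so
  \<open>b\<inverse>a\<close> lies in the isotropy group of \<open>z\<close>; hence
  \<open>a = b\<close>, against disjointness.\<close>

lemma principal_inj_dom:
  assumes tp: "topologically_principal G" and W: "openin (gtop G) W"
    and same: "\<And>\<gamma> \<sigma>. \<gamma> \<in> W \<Longrightarrow> \<sigma> \<in> W \<Longrightarrow> gdom G \<gamma> = gdom G \<sigma> \<Longrightarrow> gran G \<gamma> = gran G \<sigma>"
  shows "inj_on (gdom G) W"
proof (rule inj_onI, rule ccontr)
  fix \<gamma> \<sigma> assume g: "\<gamma> \<in> W" "\<sigma> \<in> W" "gdom G \<gamma> = gdom G \<sigma>" "\<gamma> \<noteq> \<sigma>"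
  have OG: "W \<subseteq> arrows G" using W openin_subset by blast
  obtain A B where AB: "openin (gtop G) A" "openin (gtop G) B" "\<gamma> \<in> A" "\<sigma> \<in> B" "disjnt A B"
    using Hausdorff[unfolded Hausdorff_space_def, rule_format, of \<gamma> \<sigma>] g OG by blast
  let ?T = "gdom G ` (A \<inter> W) \<inter> gdom G ` (B \<inter> W)"
  have T: "openin (gtop G) ?T" using AB W openin_dom_image by blast
  have Tu: "?T \<subseteq> units G" using OG by auto
  have "gdom G \<gamma> \<in> gdom G ` (A \<inter> W)" "gdom G \<sigma> \<in> gdom G ` (B \<inter> W)" using g(1,2) AB(3,4) by blast+
  then have x: "gdom G \<gamma> \<in> ?T" using g(3) by simp
  have cl: "gdom G \<gamma> \<in> unit_top G closure_of {x \<in> units G. isotropy G x = {x}}"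
    using tp x Tu unfolding topologically_principal_def by blast
  have "openin (unit_top G) ?T"
    using T Tu unfolding unit_top_def by (simp add: openin_open_subtopology openin_units)
  then obtain z where z: "isotropy G z = {z}" "z \<in> ?T"
    using cl[unfolded in_closure_of, THEN conjunct2, rule_format, of ?T] x by auto
  obtain a where a: "a \<in> A \<inter> W" "gdom G a = z" using z(2) by auto
  obtain b where b: "b \<in> B \<inter> W" "gdom G b = z" using z(2) by auto
  note ab = a(1) b(1) a(2) b(2)
  have abG: "a \<in> arrows G" "b \<in> arrows G" using ab(1,2) OG by auto
  have r: "gran G a = gran G b" using same[of a b] ab by simp
  have "gmul G (ginv G b) a \<in> isotropy G z"
    unfolding isotropy_def using ab(3,4) abG r by simp
  then have "gmul G (ginv G b) a = z" using z(1) by simp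
  then have "gmul G b z = a"
    using mul_inv_cancel(1)[of "ginv G b" a] abG r by simp
  moreover have "gmul G b z = b" using ab(4) abG(2) by auto
  ultimately show False using ab(1,2) AB(5) by (auto simp: disjnt_def)
qed

text \<open>Inversion exchanges domain and range, so the domain version is applied to the set of
  inverses of \<open>W\<close>.\<close>

lemma principal_inj_ran:
  assumes tp: "topologically_principal G" and W: "openin (gtop G) W"
    and same: "\<And>\<gamma> \<sigma>. \<gamma> \<in> W \<Longrightarrow> \<sigma> \<in> W \<Longrightarrow> gran G \<gamma> = gran G \<sigma> \<Longrightarrow> gdom G \<gamma> = gdom G \<sigma>"
  shows "inj_on (gran G) W"
proof -
  have OG: "W \<subseteq> arrows G" using W openin_subset by blast
  let ?O = "{\<gamma> \<in> arrows G. ginv G \<gamma> \<in> W}"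
  have inj: "inj_on (gdom G) ?O"
  proof (rule principal_inj_dom[OF tp openin_continuous_map_preimage[OF continuous_inv W]])
    fix \<gamma> \<sigma> assume a: "\<gamma> \<in> ?O" "\<sigma> \<in> ?O" "gdom G \<gamma> = gdom G \<sigma>"
    then show "gran G \<gamma> = gran G \<sigma>" using same[of "ginv G \<gamma>" "ginv G \<sigma>"] by simp
  qed
  show ?thesis
  proof (rule inj_onI)
    fix \<gamma> \<sigma> assume a: "\<gamma> \<in> W" "\<sigma> \<in> W" "gran G \<gamma> = gran G \<sigma>"
    then have aG: "\<gamma> \<in> arrows G" "\<sigma> \<in> arrows G" using OG by auto
    then have "ginv G \<gamma> \<in> ?O" "ginv G \<sigma> \<in> ?O" "gdom G (ginv G \<gamma>) = gdom G (ginv G \<sigma>)"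
      using a by simp_all
    then have "ginv G \<gamma> = ginv G \<sigma>" using inj_onD[OF inj] by blast
    then show "\<gamma> = \<sigma>" using aG inv_inv by metis
  qed
qed

end

section \<open>Images of bump functions on bisections\<close>

locale principal_alg_iso = alg_iso +
  assumes tpG: "topologically_principal G" and tpH: "topologically_principal H"
begin

lemma principal_sym: "principal_alg_iso H G p \<Psi> \<Phi>"
  using sym tpG tpH by (simp add: principal_alg_iso_def principal_alg_iso_axioms_def)

text \<open>The conditions treat \<open>n\<close> and \<open>\<Phi> n\<close> alike, hence transfer
  to the inverse isomorphism, and they survive convolution. Compactness of supports is left out
  because it is not known to pass to \<open>\<Phi> n\<close>.\<close>

definition partial_bisection :: "('a \<Rightarrow> complex) \<Rightarrow> bool" where
  "partial_bisection n \<longleftrightarrow> n \<in> RA p G \<and>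
     inj_on (gdom G) {\<gamma>. n \<gamma> \<noteq> 0} \<and> inj_on (gran G) {\<gamma>. n \<gamma> \<noteq> 0} \<and>
     inj_on (gdom H) {\<eta>. \<Phi> n \<eta> \<noteq> 0} \<and> inj_on (gran H) {\<eta>. \<Phi> n \<eta> \<noteq> 0} \<and>
     (\<forall>\<gamma> \<eta>. n \<gamma> \<noteq> 0 \<and> \<Phi> n \<eta> \<noteq> 0 \<longrightarrow>
        (gdom G \<gamma> = spec (gdom H \<eta>) \<longleftrightarrow> gran G \<gamma> = spec (gran H \<eta>)))"

lemma partial_bisectionD:
  assumes "partial_bisection n"
  shows "n \<in> RA p G" "\<Phi> n \<in> RA p H"
    and "n \<gamma> \<noteq> 0 \<Longrightarrow> \<gamma> \<in> arrows G" "\<Phi> n \<eta> \<noteq> 0 \<Longrightarrow> \<eta> \<in> arrows H"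
    and "n \<gamma> \<noteq> 0 \<Longrightarrow> n \<sigma> \<noteq> 0 \<Longrightarrow> gdom G \<gamma> = gdom G \<sigma> \<Longrightarrow> \<gamma> = \<sigma>"
    and "n \<gamma> \<noteq> 0 \<Longrightarrow> n \<sigma> \<noteq> 0 \<Longrightarrow> gran G \<gamma> = gran G \<sigma> \<Longrightarrow> \<gamma> = \<sigma>"
    and "\<Phi> n \<eta> \<noteq> 0 \<Longrightarrow> \<Phi> n \<zeta> \<noteq> 0 \<Longrightarrow> gdom H \<eta> = gdom H \<zeta> \<Longrightarrow> \<eta> = \<zeta>"
    and "\<Phi> n \<eta> \<noteq> 0 \<Longrightarrow> \<Phi> n \<zeta> \<noteq> 0 \<Longrightarrow> gran H \<eta> = gran H \<zeta> \<Longrightarrow> \<eta> = \<zeta>"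
    and "n \<gamma> \<noteq> 0 \<Longrightarrow> \<Phi> n \<eta> \<noteq> 0 \<Longrightarrow> gdom G \<gamma> = spec (gdom H \<eta>) \<longleftrightarrow> gran G \<gamma> = spec (gran H \<eta>)"
proof -
  show n: "n \<in> RA p G" using assms by (simp add: partial_bisection_def)
  then show n': "\<Phi> n \<in> RA p H" by (rule closed)
  show "n \<gamma> \<noteq> 0 \<Longrightarrow> \<gamma> \<in> arrows G" "\<Phi> n \<eta> \<noteq> 0 \<Longrightarrow> \<eta> \<in> arrows H"
    using G.RA_zero[OF n] H.RA_zero[OF n'] by blast+
qed (use assms in \<open>auto simp: partial_bisection_def inj_on_def\<close>)

text \<open>Compactness of \<open>K\<close> makes the set \<open>?P\<close> of its pairs of end
  points closed. A pair outside \<open>?P\<close> therefore has a whole rectangle outside it, and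
  the two test functions on the unit space are supported in the sides of this rectangle.\<close>

lemma support_image:
  assumes b: "b \<in> RA p G" and K: "compactin (gtop G) K" "\<And>\<gamma>. b \<gamma> \<noteq> 0 \<Longrightarrow> \<gamma> \<in> K"
    and e: "\<Phi> b \<eta> \<noteq> 0"
  obtains \<gamma> where "\<gamma> \<in> K" "gdom G \<gamma> = spec (gdom H \<eta>)" "gran G \<gamma> = spec (gran H \<eta>)"
proof -
  have eH: "\<eta> \<in> arrows H" using e H.RA_zero[OF closed(1)[OF b]] by blast
  let ?x = "spec (gdom H \<eta>)" and ?y = "spec (gran H \<eta>)"
  have xy: "?x \<in> units G" "?y \<in> units G" using spec(1) eH by simp_all
  let ?U = "prod_topology (unit_top G) (unit_top G)"
  let ?P = "(\<lambda>\<gamma>. (gdom G \<gamma>, gran G \<gamma>)) ` K"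
  have "compactin ?U ?P"
    by (rule image_compactin[OF K(1)]) (intro continuous_map_pairedI G.continuous_dom_unit G.continuous_ran_unit)
  moreover have "Hausdorff_space ?U" using G.Hausdorff_units Hausdorff_space_prod_topology by blast
  ultimately have P: "closedin ?U ?P" using compactin_imp_closedin by blast
  have "(?x, ?y) \<in> ?P"
  proof (rule ccontr)
    assume n: "(?x, ?y) \<notin> ?P"
    define Q where "Q = topspace ?U - ?P"
    have oQ: "openin ?U Q" unfolding Q_def using P openin_diff[OF openin_topspace] by blast
    have inQ: "(?x, ?y) \<in> Q" using n xy by (simp add: Q_def)
    obtain V W where VW: "openin (unit_top G) V" "openin (unit_top G) W" "?x \<in> V" "?y \<in> W"
       "V \<times> W \<subseteq> Q"
      using openin_prod_topology_alt[THEN iffD1, OF oQ, rule_format, OF inQ] by blast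
    obtain f where f: "f \<in> DA p G" "f ?x = 1" "\<And>z. f z \<noteq> 0 \<Longrightarrow> z \<in> V"
      using G.DA_separate[OF VW(1,3)] by metis
    obtain g where g: "g \<in> DA p G" "g ?y = 1" "\<And>z. g z \<noteq> 0 \<Longrightarrow> z \<in> W"
      using G.DA_separate[OF VW(2,4)] by metis
    let ?c = "convolution G g (convolution G b f)"
    have "?c = (\<lambda>_. 0)"
    proof
      fix \<gamma> show "?c \<gamma> = 0"
      proof (cases "\<gamma> \<in> arrows G")
        case True
        have "g (gran G \<gamma>) * (b \<gamma> * f (gdom G \<gamma>)) = 0"
        proof (rule ccontr)
          assume "\<not> ?thesis"
          then have "\<gamma> \<in> K" "gdom G \<gamma> \<in> V" "gran G \<gamma> \<in> W" using K(2) f(3) g(3) by auto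
          then have "(gdom G \<gamma>, gran G \<gamma>) \<in> V \<times> W" "(gdom G \<gamma>, gran G \<gamma>) \<in> ?P" by auto
          then show False using VW(5) unfolding Q_def by blast
        qed
        then show ?thesis
          using G.convolution_DA_left[OF g(1) True] G.convolution_DA_right[OF f(1) True] by simp
      qed (rule G.convolution_off)
    qed
    then have "\<Phi> ?c \<eta> = 0" using zero by simp
    moreover have "\<Phi> ?c = convolution H (\<Phi> g) (convolution H (\<Phi> b) (\<Phi> f))"
      using mult G.RA_convolution G.DA_RA f(1) g(1) b by simp
    ultimately have "\<Phi> g (gran H \<eta>) * (\<Phi> b \<eta> * \<Phi> f (gdom H \<eta>)) = 0"
      using H.convolution_DA_left[OF DA[OF g(1)] eH] H.convolution_DA_right[OF DA[OF f(1)] eH] by simp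
    then show False
      using e spec(2)[of "gdom H \<eta>" f] spec(2)[of "gran H \<eta>" g] f g eH by simp
  qed
  then show ?thesis using that by auto
qed

text \<open>Through \<open>spec\<close>, every arrow in the support of the image has the two end
  points of some arrow in \<open>K\<close>, and in \<open>K\<close> either end determines the arrow.
  So on that support equal domains are equivalent to equal ranges, which topological principality of
  \<open>H\<close> sharpens to injectivity.\<close>

lemma bump:
  assumes "openin (gtop G) W" "\<gamma> \<in> W"
  obtains b where "partial_bisection b" "b \<gamma> \<noteq> 0" "\<And>\<sigma>. b \<sigma> \<noteq> 0 \<Longrightarrow> \<sigma> \<in> W"
proof -
  obtain k :: "'a \<Rightarrow> real" and K U where k:
    "continuous_map (gtop G) euclidean k" "\<And>\<sigma>. 0 \<le> k \<sigma>" "0 < k \<gamma>"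
    "\<And>\<sigma>. k \<sigma> \<noteq> 0 \<Longrightarrow> \<sigma> \<in> K" and K: "compactin (gtop G) K" "K \<subseteq> U" "U \<subseteq> W" and U: "bisection G U"
    using G.real_bump[OF assms] by metis
  define b where "b = (\<lambda>\<sigma>. complex_of_real (k \<sigma>))"
  have bK: "\<sigma> \<in> K" if "b \<sigma> \<noteq> 0" for \<sigma> using that k(4) by (auto simp: b_def)
  have "continuous_map (gtop G) euclidean b"
    unfolding b_def by (rule continuous_map_euclidean_compose[OF k(1)]) (intro continuous_intros)
  then have b: "b \<in> RA p G" using G.Cc_RA[OF G.CcI[OF _ K(1) bK]] by blast
  have injU: "inj_on (gdom G) U" "inj_on (gran G) U" using U by (auto simp: bisection_def)
  have KU: "\<sigma> = \<tau>" if "\<sigma> \<in> K" "\<tau> \<in> K" "gdom G \<sigma> = gdom G \<tau> \<or> gran G \<sigma> = gran G \<tau>" for \<sigma> \<tau>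
    using that injU K(2) by (auto dest: inj_onD)
  let ?O = "{\<eta>. \<Phi> b \<eta> \<noteq> 0}"
  have opO: "openin (gtop H) ?O" using H.openin_support[OF closed(1)[OF b]] .
  have OH: "?O \<subseteq> arrows H" using opO openin_subset by blast
  have im: "\<exists>\<sigma>\<in>K. gdom G \<sigma> = spec (gdom H \<eta>) \<and> gran G \<sigma> = spec (gran H \<eta>)" if "\<eta> \<in> ?O" for \<eta>
    using support_image[OF b K(1) bK] that by (metis (mono_tags, lifting) mem_Collect_eq)
  have same: "gdom H \<eta> = gdom H \<zeta> \<longleftrightarrow> gran H \<eta> = gran H \<zeta>" if o: "\<eta> \<in> ?O" "\<zeta> \<in> ?O" for \<eta> \<zeta>
  proof -
    obtain \<sigma> where s: "\<sigma> \<in> K" "gdom G \<sigma> = spec (gdom H \<eta>)" "gran G \<sigma> = spec (gran H \<eta>)" using im[OF o(1)] by blast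
    obtain \<tau> where t: "\<tau> \<in> K" "gdom G \<tau> = spec (gdom H \<zeta>)" "gran G \<tau> = spec (gran H \<zeta>)" using im[OF o(2)] by blast
    have u: "gdom H \<eta> \<in> units H" "gran H \<eta> \<in> units H" "gdom H \<zeta> \<in> units H" "gran H \<zeta> \<in> units H"
      using o OH by auto
    have "gdom G \<sigma> = gdom G \<tau> \<longleftrightarrow> gran G \<sigma> = gran G \<tau>" using KU[OF s(1) t(1)] by blast
    then show ?thesis using s t spec_inj u by simp
  qed
  have "partial_bisection b"
    unfolding partial_bisection_def
  proof (intro conjI allI impI b)
    show "inj_on (gdom G) {\<gamma>. b \<gamma> \<noteq> 0}" "inj_on (gran G) {\<gamma>. b \<gamma> \<noteq> 0}"
      using KU bK by (auto simp: inj_on_def)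
    show "inj_on (gdom H) ?O" by (rule H.principal_inj_dom[OF tpH opO]) (use same in blast)
    show "inj_on (gran H) ?O" by (rule H.principal_inj_ran[OF tpH opO]) (use same in blast)
    fix \<gamma> \<eta> assume a: "b \<gamma> \<noteq> 0 \<and> \<Phi> b \<eta> \<noteq> 0"
    then obtain \<sigma> where s: "\<sigma> \<in> K" "gdom G \<sigma> = spec (gdom H \<eta>)" "gran G \<sigma> = spec (gran H \<eta>)" using im by blast
    have "gdom G \<gamma> = gdom G \<sigma> \<longleftrightarrow> gran G \<gamma> = gran G \<sigma>" using KU[OF bK s(1)] a by blast
    then show "gdom G \<gamma> = spec (gdom H \<eta>) \<longleftrightarrow> gran G \<gamma> = spec (gran H \<eta>)" using s by simp
  qed
  moreover have "b \<gamma> \<noteq> 0" using k(3) by (simp add: b_def)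
  ultimately show ?thesis using that bK K by blast
qed

lemma partial_bisection_transfer:
  assumes "partial_bisection n"
  shows "principal_alg_iso.partial_bisection H G p \<Psi> (\<Phi> n)"
proof -
  interpret S: principal_alg_iso H G p \<Psi> \<Phi> by (rule principal_sym)
  note n = partial_bisectionD[OF assms]
  have "\<Psi> (\<Phi> n) = n" using inverse n(1) by simp
  moreover have "gdom H \<eta> = S.spec (gdom G \<gamma>) \<longleftrightarrow> gran H \<eta> = S.spec (gran G \<gamma>)"
    if "\<Phi> n \<eta> \<noteq> 0" "n \<gamma> \<noteq> 0" for \<eta> \<gamma>
  proof -
    have u: "gdom H \<eta> \<in> units H" "gran H \<eta> \<in> units H" "gdom G \<gamma> \<in> units G" "gran G \<gamma> \<in> units G"
      using n(3,4) that by auto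
    have "gdom H \<eta> = S.spec (gdom G \<gamma>) \<longleftrightarrow> gdom G \<gamma> = spec (gdom H \<eta>)"
      using spec_inverse[OF u(1)] S.spec_inverse[OF u(3)] by metis
    moreover have "gran H \<eta> = S.spec (gran G \<gamma>) \<longleftrightarrow> gran G \<gamma> = spec (gran H \<eta>)"
      using spec_inverse[OF u(2)] S.spec_inverse[OF u(4)] by metis
    ultimately show ?thesis using n(9) that by simp
  qed
  ultimately show ?thesis
    using assms n(2) unfolding S.partial_bisection_def partial_bisection_def by simp
qed

text \<open>Matching the domains is enough, since \<open>n\<close> then matches the ranges. A
  relation is easier to handle than a map because its symmetry in the two groupoids is direct; that
  it is the graph of a bijection is derived afterwards.\<close>

definition corr :: "'a \<Rightarrow> 'b \<Rightarrow> bool" where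
  "corr \<gamma> \<eta> \<longleftrightarrow> gdom G \<gamma> = spec (gdom H \<eta>) \<and> (\<exists>n. partial_bisection n \<and> n \<gamma> \<noteq> 0 \<and> \<Phi> n \<eta> \<noteq> 0)"

lemma corrD:
  assumes "corr \<gamma> \<eta>"
  shows "\<gamma> \<in> arrows G" "\<eta> \<in> arrows H" "gdom G \<gamma> = spec (gdom H \<eta>)" "gran G \<gamma> = spec (gran H \<eta>)"
  using assms partial_bisectionD(3,4,9) unfolding corr_def by blast+

lemma corr_imp_sym:
  assumes "corr \<gamma> \<eta>" shows "principal_alg_iso.corr H G p \<Psi> \<eta> \<gamma>"
proof -
  interpret S: principal_alg_iso H G p \<Psi> \<Phi> by (rule principal_sym)
  obtain n where n: "partial_bisection n" "n \<gamma> \<noteq> 0" "\<Phi> n \<eta> \<noteq> 0" using assms by (auto simp: corr_def)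
  have "gdom H \<eta> = S.spec (gdom G \<gamma>)" using corrD[OF assms] spec_inverse[of "gdom H \<eta>"] by simp
  moreover have "\<Psi> (\<Phi> n) = n" using inverse partial_bisectionD(1)[OF n(1)] by simp
  ultimately show ?thesis
    unfolding S.corr_def using n partial_bisection_transfer[OF n(1)] by (intro conjI exI[of _ "\<Phi> n"]) simp_all
qed

lemma corr_sym: "principal_alg_iso.corr H G p \<Psi> \<eta> \<gamma> \<longleftrightarrow> corr \<gamma> \<eta>"
  using corr_imp_sym principal_alg_iso.corr_imp_sym[OF principal_sym] by blast

text \<open>
  If \<open>b\<close> is supported near \<open>\<gamma>\<inverse>\<close>, then \<open>b * n\<close> lives on the unit space and is nonzero
  at the domain of \<open>\<gamma>\<close>; both properties survive the isomorphism, and the second one produces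
  an arrow in the support of the image of \<open>n\<close>.
\<close>

lemma corr_witness:
  assumes n: "partial_bisection n" "n \<gamma> \<noteq> 0" and b: "partial_bisection b" "b (ginv G \<gamma>) \<noteq> 0"
    and supp: "\<And>\<sigma>. b \<sigma> \<noteq> 0 \<Longrightarrow> n (ginv G \<sigma>) \<noteq> 0"
  obtains \<eta> where "corr \<gamma> \<eta>" "\<Phi> n \<eta> \<noteq> 0" "\<Phi> b (ginv H \<eta>) \<noteq> 0"
proof -
  note nD = partial_bisectionD[OF n(1)] and bD = partial_bisectionD[OF b(1)]
  have g: "\<gamma> \<in> arrows G" using nD n(2) by blast
  let ?c = "convolution G b n" and ?x = "gdom G \<gamma>"
  have x: "?x \<in> units G" "?x \<in> arrows G" using g by auto
  \<comment> \<open>If the sum at \<open>\<sigma>\<close> has a nonzero term at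
    \<open>\<tau>\<close>, then \<open>\<tau>\<sigma>\<inverse>\<close> and \<open>\<tau>\<close>
    both lie in the support of \<open>n\<close> and have the same range. They are equal, which makes
    \<open>\<sigma>\<close> the domain of \<open>\<tau>\<close>.\<close>
  have c: "?c \<in> DA p G"
    unfolding DA_def
  proof (intro CollectI conjI allI impI G.RA_convolution nD(1) bD(1))
    fix \<sigma> assume nz: "?c \<sigma> \<noteq> 0"
    obtain \<tau> where t: "\<sigma> \<in> arrows G" "\<tau> \<in> arrows G" "gdom G \<tau> = gdom G \<sigma>" "b (gdiv G \<sigma> \<tau>) \<noteq> 0" "n \<tau> \<noteq> 0"
      using G.convolution_nonzero[OF nz] by metis
    have i: "ginv G (gdiv G \<sigma> \<tau>) = gdiv G \<tau> \<sigma>"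
      using G.inv_mul[of \<sigma> "ginv G \<tau>"] t by simp
    have "n (gdiv G \<tau> \<sigma>) \<noteq> 0" using supp[OF t(4)] i by simp
    moreover have "gran G (gdiv G \<tau> \<sigma>) = gran G \<tau>" using t by simp
    ultimately have e: "gdiv G \<tau> \<sigma> = \<tau>" using nD(6) t(5) by blast
    have "gdiv G \<tau> (gdom G \<tau>) = \<tau>" using t(2) G.inv_unit[of "gdom G \<tau>"] by simp
    then have "\<sigma> = gdom G \<tau>"
      using G.gdiv_inj2[of \<tau> \<sigma> "gdom G \<tau>"] e t by simp
    then show "\<sigma> \<in> units G" using t(2) by simp
  qed
  have "?c ?x = b (gdiv G ?x \<gamma>) * n \<gamma>"
  proof (rule G.convolution_single)
    fix \<tau> assume "gdom G \<tau> = gdom G ?x" "n \<tau> \<noteq> 0"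
    then show "\<tau> = \<gamma>" using nD(5)[of \<tau> \<gamma>] n(2) g by simp
  qed (use g in auto)
  moreover have "gdiv G ?x \<gamma> = ginv G \<gamma>"
    using g G.ran_mul_self[of "ginv G \<gamma>"] by simp
  ultimately have cx: "?c ?x \<noteq> 0" using b(2) n(2) by simp
  interpret S: principal_alg_iso H G p \<Psi> \<Phi> by (rule principal_sym)
  define y where "y = S.spec ?x"
  have y: "y \<in> units H" "spec y = ?x" using S.spec(1) S.spec_inverse x by (simp_all add: y_def)
  have "\<Phi> ?c y \<noteq> 0" using spec(2)[OF y(1) c] y(2) cx by simp
  then have nz: "convolution H (\<Phi> b) (\<Phi> n) y \<noteq> 0" using mult[OF bD(1) nD(1)] by simp
  obtain \<eta> where e: "\<eta> \<in> arrows H" "gdom H \<eta> = gdom H y" "\<Phi> b (gdiv H y \<eta>) \<noteq> 0" "\<Phi> n \<eta> \<noteq> 0"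
    using H.convolution_nonzero[OF nz] by metis
  have "gdiv H y \<eta> = ginv H \<eta>"
    using e(1,2) y(1) H.ran_mul_self[of "ginv H \<eta>"] by simp
  moreover have "corr \<gamma> \<eta>" unfolding corr_def using e y n by auto
  ultimately show ?thesis using that e by simp
qed

lemma openin_inv_support: "n \<in> RA p G \<Longrightarrow> openin (gtop G) {\<sigma> \<in> arrows G. n (ginv G \<sigma>) \<noteq> 0}"
  using openin_continuous_map_preimage[OF G.continuous_inv G.openin_support] by simp

text \<open>The auxiliary bump function is placed inside the inverse of the support of
  \<open>n\<close>, so that its product with \<open>n\<close> is forced onto the unit space.\<close>

lemma corr_support:
  assumes "partial_bisection n" "n \<gamma> \<noteq> 0"
  obtains \<eta> where "corr \<gamma> \<eta>" "\<Phi> n \<eta> \<noteq> 0"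
proof -
  note n = partial_bisectionD[OF assms(1)]
  have g: "\<gamma> \<in> arrows G" using n assms by blast
  obtain b where b: "partial_bisection b" "b (ginv G \<gamma>) \<noteq> 0"
     "\<And>\<sigma>. b \<sigma> \<noteq> 0 \<Longrightarrow> \<sigma> \<in> {\<sigma> \<in> arrows G. n (ginv G \<sigma>) \<noteq> 0}"
    using bump[OF openin_inv_support[OF n(1)], of "ginv G \<gamma>"] g assms(2) by auto
  show ?thesis
    by (rule corr_witness[OF assms b(1,2)]) (use b(3) that in auto)
qed

lemma corr_total: assumes "\<gamma> \<in> arrows G" obtains \<eta> where "corr \<gamma> \<eta>"
proof -
  obtain n where "partial_bisection n" "n \<gamma> \<noteq> 0" using bump[OF openin_topspace assms] by metis
  then show ?thesis using corr_support that by metis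
qed

text \<open>The witnesses \<open>n\<close> and \<open>m\<close> may be unrelated, so they are
  compared through one bump function \<open>b\<close> supported in the inverses of both supports.
  The inverses of \<open>\<eta>\<close> and \<open>\<zeta>\<close> then both lie in the support of
  \<open>\<Phi> b\<close> and have the same range.\<close>

lemma corr_unique:
  assumes "corr \<gamma> \<eta>" "corr \<gamma> \<zeta>" shows "\<eta> = \<zeta>"
proof -
  obtain n where n: "partial_bisection n" "n \<gamma> \<noteq> 0" "\<Phi> n \<eta> \<noteq> 0" using assms(1) by (auto simp: corr_def)
  obtain m where m: "partial_bisection m" "m \<gamma> \<noteq> 0" "\<Phi> m \<zeta> \<noteq> 0" using assms(2) by (auto simp: corr_def)
  note nD = partial_bisectionD[OF n(1)] and mD = partial_bisectionD[OF m(1)]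
  have g: "\<gamma> \<in> arrows G" "\<eta> \<in> arrows H" "\<zeta> \<in> arrows H" using assms corrD by blast+
  let ?W = "{\<sigma> \<in> arrows G. n (ginv G \<sigma>) \<noteq> 0} \<inter> {\<sigma> \<in> arrows G. m (ginv G \<sigma>) \<noteq> 0}"
  have W: "openin (gtop G) ?W" using openin_inv_support nD(1) mD(1) by blast
  have gW: "ginv G \<gamma> \<in> ?W" using g n(2) m(2) by simp
  obtain b where b: "partial_bisection b" "b (ginv G \<gamma>) \<noteq> 0" and bW: "\<And>\<sigma>. b \<sigma> \<noteq> 0 \<Longrightarrow> \<sigma> \<in> ?W"
    by (rule bump[OF W gW]) (rule that)
  \<comment> \<open>Within a single image support the partner of \<open>\<gamma>\<close> is
    determined by its domain; this identifies the arrow delivered by \<open>corr_witness\<close>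
    with the given one.\<close>
  have dom: "\<xi> = \<theta>" if "partial_bisection k" "corr \<gamma> \<xi>" "corr \<gamma> \<theta>" "\<Phi> k \<xi> \<noteq> 0" "\<Phi> k \<theta> \<noteq> 0" for k \<xi> \<theta>
  proof -
    have "gdom H \<xi> \<in> units H" "gdom H \<theta> \<in> units H" "spec (gdom H \<xi>) = spec (gdom H \<theta>)"
      using corrD[OF that(2)] corrD[OF that(3)] by auto
    then show ?thesis using partial_bisectionD(7)[OF that(1)] that(4,5) spec_inj by blast
  qed
  obtain \<eta>' where "corr \<gamma> \<eta>'" "\<Phi> n \<eta>' \<noteq> 0" "\<Phi> b (ginv H \<eta>') \<noteq> 0"
    using corr_witness[OF n(1,2) b] bW by blast
  then have be: "\<Phi> b (ginv H \<eta>) \<noteq> 0" using dom[OF n(1) _ assms(1) _ n(3)] by blast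
  obtain \<zeta>' where "corr \<gamma> \<zeta>'" "\<Phi> m \<zeta>' \<noteq> 0" "\<Phi> b (ginv H \<zeta>') \<noteq> 0"
    using corr_witness[OF m(1,2) b] bW by blast
  then have bz: "\<Phi> b (ginv H \<zeta>) \<noteq> 0" using dom[OF m(1) _ assms(2) _ m(3)] by blast
  have "gdom H \<eta> = gdom H \<zeta>"
    using corrD[OF assms(1)] corrD[OF assms(2)] spec_inj[of "gdom H \<eta>" "gdom H \<zeta>"] by simp
  then have "gran H (ginv H \<eta>) = gran H (ginv H \<zeta>)" using g by simp
  then have "ginv H \<eta> = ginv H \<zeta>" using partial_bisectionD(8)[OF b(1) be bz] by blast
  then show ?thesis using g H.inv_inv by metis
qed

text \<open>No cancellation can occur: injectivity of the domain on the support of \<open>n'\<close>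
  leaves a single term in the sum.\<close>

lemma convolution_support:
  assumes "partial_bisection n" "n \<gamma> \<noteq> 0" "n' \<sigma> \<noteq> 0" "partial_bisection n'" "gdom G \<gamma> = gran G \<sigma>"
  shows "convolution G n n' (gmul G \<gamma> \<sigma>) \<noteq> 0"
proof -
  have a: "\<gamma> \<in> arrows G" "\<sigma> \<in> arrows G" using partial_bisectionD(3) assms by blast+
  have "convolution G n n' (gmul G \<gamma> \<sigma>) = n (gdiv G (gmul G \<gamma> \<sigma>) \<sigma>) * n' \<sigma>"
  proof (rule G.convolution_single)
    fix \<tau> assume "gdom G \<tau> = gdom G (gmul G \<gamma> \<sigma>)" "n' \<tau> \<noteq> 0"
    then show "\<tau> = \<sigma>" using partial_bisectionD(5)[OF assms(4)] assms(3,5) a by simp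
  qed (use a assms(5) in auto)
  then show ?thesis using a assms by simp
qed

lemma partial_bisection_factor:
  assumes nz: "convolution G n n' \<gamma> \<noteq> 0"
  obtains \<sigma> \<tau> where "\<sigma> \<in> arrows G" "\<tau> \<in> arrows G" "gdom G \<sigma> = gran G \<tau>" "\<gamma> = gmul G \<sigma> \<tau>" "n \<sigma> \<noteq> 0" "n' \<tau> \<noteq> 0"
    "gdom G \<gamma> = gdom G \<tau>" "gran G \<gamma> = gran G \<sigma>"
proof -
  obtain \<tau> where t: "\<gamma> \<in> arrows G" "\<tau> \<in> arrows G" "gdom G \<tau> = gdom G \<gamma>" "n (gdiv G \<gamma> \<tau>) \<noteq> 0" "n' \<tau> \<noteq> 0"
    using G.convolution_nonzero[OF nz] by metis
  show ?thesis by (rule that[of "gdiv G \<gamma> \<tau>" \<tau>]) (use t in auto)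
qed

text \<open>Arrows in the support of a product factor through the two supports, and end points are
  chased through the middle unit: matching domains of \<open>\<tau>\<close> and
  \<open>\<tau>'\<close> give matching ranges, which are the domains of \<open>\<sigma>\<close> and
  \<open>\<sigma>'\<close>, and conversely.\<close>

lemma partial_bisection_convolution:
  assumes n: "partial_bisection n" "partial_bisection n'"
  shows "partial_bisection (convolution G n n')"
proof -
  interpret S: principal_alg_iso H G p \<Psi> \<Phi> by (rule principal_sym)
  note D = partial_bisectionD[OF n(1)] and D' = partial_bisectionD[OF n(2)]
  have m: "\<Phi> (convolution G n n') = convolution H (\<Phi> n) (\<Phi> n')" using mult D(1) D'(1) by blast
  show ?thesis
    unfolding partial_bisection_def m
  proof (intro conjI allI impI G.RA_convolution D(1) D'(1) inj_onI)
    fix \<gamma> \<gamma>'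
    assume g: "\<gamma> \<in> {\<gamma>. convolution G n n' \<gamma> \<noteq> 0}" "\<gamma>' \<in> {\<gamma>. convolution G n n' \<gamma> \<noteq> 0}"
    obtain \<sigma> \<tau> where s: "gdom G \<sigma> = gran G \<tau>" "\<gamma> = gmul G \<sigma> \<tau>" "n \<sigma> \<noteq> 0" "n' \<tau> \<noteq> 0"
      "gdom G \<gamma> = gdom G \<tau>" "gran G \<gamma> = gran G \<sigma>" using partial_bisection_factor g(1) by blast
    obtain \<sigma>' \<tau>' where t: "gdom G \<sigma>' = gran G \<tau>'" "\<gamma>' = gmul G \<sigma>' \<tau>'" "n \<sigma>' \<noteq> 0" "n' \<tau>' \<noteq> 0"
      "gdom G \<gamma>' = gdom G \<tau>'" "gran G \<gamma>' = gran G \<sigma>'" using partial_bisection_factor g(2) by blast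
    show "gdom G \<gamma> = gdom G \<gamma>' \<Longrightarrow> \<gamma> = \<gamma>'"
      using s t D(5)[of \<sigma> \<sigma>'] D'(5)[of \<tau> \<tau>'] by simp
    show "gran G \<gamma> = gran G \<gamma>' \<Longrightarrow> \<gamma> = \<gamma>'"
      using s t D(6)[of \<sigma> \<sigma>'] D'(6)[of \<tau> \<tau>'] by metis
  next
    fix \<gamma> \<gamma>'
    assume g: "\<gamma> \<in> {\<gamma>. convolution H (\<Phi> n) (\<Phi> n') \<gamma> \<noteq> 0}" "\<gamma>' \<in> {\<gamma>. convolution H (\<Phi> n) (\<Phi> n') \<gamma> \<noteq> 0}"
    obtain \<sigma> \<tau> where s: "gdom H \<sigma> = gran H \<tau>" "\<gamma> = gmul H \<sigma> \<tau>" "\<Phi> n \<sigma> \<noteq> 0" "\<Phi> n' \<tau> \<noteq> 0"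
      "gdom H \<gamma> = gdom H \<tau>" "gran H \<gamma> = gran H \<sigma>" using S.partial_bisection_factor g(1) by blast
    obtain \<sigma>' \<tau>' where t: "gdom H \<sigma>' = gran H \<tau>'" "\<gamma>' = gmul H \<sigma>' \<tau>'" "\<Phi> n \<sigma>' \<noteq> 0" "\<Phi> n' \<tau>' \<noteq> 0"
      "gdom H \<gamma>' = gdom H \<tau>'" "gran H \<gamma>' = gran H \<sigma>'" using S.partial_bisection_factor g(2) by blast
    show "gdom H \<gamma> = gdom H \<gamma>' \<Longrightarrow> \<gamma> = \<gamma>'"
      using s t D(7)[of \<sigma> \<sigma>'] D'(7)[of \<tau> \<tau>'] by simp
    show "gran H \<gamma> = gran H \<gamma>' \<Longrightarrow> \<gamma> = \<gamma>'"
      using s t D(8)[of \<sigma> \<sigma>'] D'(8)[of \<tau> \<tau>'] by metis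
  next
    fix \<gamma> \<eta> assume g: "convolution G n n' \<gamma> \<noteq> 0 \<and> convolution H (\<Phi> n) (\<Phi> n') \<eta> \<noteq> 0"
    obtain \<sigma> \<tau> where s: "gdom G \<sigma> = gran G \<tau>" "n \<sigma> \<noteq> 0" "n' \<tau> \<noteq> 0"
      "gdom G \<gamma> = gdom G \<tau>" "gran G \<gamma> = gran G \<sigma>" using partial_bisection_factor g by blast
    obtain \<sigma>' \<tau>' where t: "gdom H \<sigma>' = gran H \<tau>'" "\<Phi> n \<sigma>' \<noteq> 0" "\<Phi> n' \<tau>' \<noteq> 0"
      "gdom H \<eta> = gdom H \<tau>'" "gran H \<eta> = gran H \<sigma>'" using S.partial_bisection_factor g by blast
    show "gdom G \<gamma> = spec (gdom H \<eta>) \<longleftrightarrow> gran G \<gamma> = spec (gran H \<eta>)"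
      using D(9)[OF s(2) t(2)] D'(9)[OF s(3) t(3)] s t by simp
  qed
qed

text \<open>The convolution of the two witnesses is a witness for the product, since it is nonzero
  at the product arrow in both groupoids.\<close>

lemma corr_mult:
  assumes "corr \<gamma> \<eta>" "corr \<sigma> \<zeta>" "gdom G \<gamma> = gran G \<sigma>"
  shows "gdom H \<eta> = gran H \<zeta>" "corr (gmul G \<gamma> \<sigma>) (gmul H \<eta> \<zeta>)"
proof -
  interpret S: principal_alg_iso H G p \<Psi> \<Phi> by (rule principal_sym)
  note a = corrD[OF assms(1)] and b = corrD[OF assms(2)]
  show d: "gdom H \<eta> = gran H \<zeta>"
    using a b assms(3) spec_inj[of "gdom H \<eta>" "gran H \<zeta>"] by simp
  obtain n where n: "partial_bisection n" "n \<gamma> \<noteq> 0" "\<Phi> n \<eta> \<noteq> 0" using assms(1) by (auto simp: corr_def)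
  obtain m where m: "partial_bisection m" "m \<sigma> \<noteq> 0" "\<Phi> m \<zeta> \<noteq> 0" using assms(2) by (auto simp: corr_def)
  have "convolution G n m (gmul G \<gamma> \<sigma>) \<noteq> 0"
    using convolution_support n m assms(3) by blast
  moreover have "convolution H (\<Phi> n) (\<Phi> m) (gmul H \<eta> \<zeta>) \<noteq> 0"
    using S.convolution_support[OF partial_bisection_transfer[OF n(1)] n(3) m(3) partial_bisection_transfer[OF m(1)] d] .
  moreover have "\<Phi> (convolution G n m) = convolution H (\<Phi> n) (\<Phi> m)"
    using mult partial_bisectionD(1) n m by blast
  moreover have "gdom G (gmul G \<gamma> \<sigma>) = spec (gdom H (gmul H \<eta> \<zeta>))"
    using a b d assms(3) by simp
  ultimately show "corr (gmul G \<gamma> \<sigma>) (gmul H \<eta> \<zeta>)"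
    unfolding corr_def using partial_bisection_convolution[OF n(1) m(1)] by auto
qed

section \<open>The isomorphism of groupoids\<close>

definition arrow_map :: "'a \<Rightarrow> 'b" where
  "arrow_map \<gamma> = (SOME \<eta>. corr \<gamma> \<eta>)"

lemma corr_arrow_map: "\<gamma> \<in> arrows G \<Longrightarrow> corr \<gamma> (arrow_map \<gamma>)"
  unfolding arrow_map_def by (metis corr_total someI)

lemma arrow_map_hom: "groupoid_hom G H arrow_map"
  unfolding groupoid_hom_def
proof (intro conjI)
  show "arrow_map ` arrows G \<subseteq> arrows H" using corr_arrow_map corrD(2) by blast
  show "\<forall>(\<gamma>, \<sigma>)\<in>gcomp G. (arrow_map \<gamma>, arrow_map \<sigma>) \<in> gcomp H \<and>
      arrow_map (gmul G \<gamma> \<sigma>) = gmul H (arrow_map \<gamma>) (arrow_map \<sigma>)"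
  proof clarify
    fix \<gamma> \<sigma> assume "(\<gamma>, \<sigma>) \<in> gcomp G"
    then have a: "\<gamma> \<in> arrows G" "\<sigma> \<in> arrows G" "gdom G \<gamma> = gran G \<sigma>" using G.comp_iff by auto
    note c = corr_arrow_map[OF a(1)] corr_arrow_map[OF a(2)]
    note m = corr_mult[OF c a(3)]
    have "arrow_map (gmul G \<gamma> \<sigma>) = gmul H (arrow_map \<gamma>) (arrow_map \<sigma>)"
      using corr_unique[OF corr_arrow_map[OF corrD(1)[OF m(2)]] m(2)] .
    then show "(arrow_map \<gamma>, arrow_map \<sigma>) \<in> gcomp H \<and>
      arrow_map (gmul G \<gamma> \<sigma>) = gmul H (arrow_map \<gamma>) (arrow_map \<sigma>)"
      using H.comp_iff m(1) corrD(2)[OF c(1)] corrD(2)[OF c(2)] by simp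
  qed
qed

text \<open>On the open set where \<open>n\<close> is nonzero, the map is the domain, followed by
  the homeomorphism \<open>S.spec\<close> of unit spaces and by the section of the bisection on
  which \<open>\<Phi> n\<close> is nonzero. By \<open>bump\<close> such sets cover all
  arrows.\<close>

lemma arrow_map_continuous: "continuous_map (gtop G) (gtop H) arrow_map"
proof (rule pasting_lemma[where I = "Collect partial_bisection" and T = "\<lambda>n. {\<gamma>. n \<gamma> \<noteq> 0}" and f = "\<lambda>_. arrow_map"])
  interpret S: principal_alg_iso H G p \<Psi> \<Phi> by (rule principal_sym)
  fix n assume "n \<in> Collect partial_bisection"
  then have n: "partial_bisection n" by simp
  note D = partial_bisectionD[OF n]
  let ?O = "{\<gamma>. n \<gamma> \<noteq> 0}" and ?O' = "{\<eta>. \<Phi> n \<eta> \<noteq> 0}"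
  show "openin (gtop G) ?O" using G.openin_support[OF D(1)] .
  have B: "bisection H ?O'"
    using n H.openin_support[OF D(2)] unfolding bisection_def partial_bisection_def by blast
  have im: "arrow_map \<gamma> \<in> ?O'" "gdom H (arrow_map \<gamma>) = S.spec (gdom G \<gamma>)" if g: "\<gamma> \<in> ?O" for \<gamma>
  proof -
    obtain \<eta> where e: "corr \<gamma> \<eta>" "\<Phi> n \<eta> \<noteq> 0" using corr_support[OF n] g by blast
    have a: "arrow_map \<gamma> = \<eta>" using corr_unique[OF corr_arrow_map[OF corrD(1)[OF e(1)]] e(1)] .
    show "arrow_map \<gamma> \<in> ?O'" using a e by simp
    show "gdom H (arrow_map \<gamma>) = S.spec (gdom G \<gamma>)"
      using a corrD[OF e(1)] spec_inverse[of "gdom H \<eta>"] by simp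
  qed
  have sub: "S.spec (gdom G \<gamma>) \<in> gdom H ` ?O'" if "\<gamma> \<in> ?O" for \<gamma>
    using im[OF that] by (metis image_eqI)
  have "continuous_map (gtop G) (unit_top H) (S.spec \<circ> gdom G)"
    by (rule continuous_map_compose[OF G.continuous_dom_unit S.spec_continuous])
  then have "continuous_map (gtop G) (gtop H) (S.spec \<circ> gdom G)"
    unfolding unit_top_def continuous_map_in_subtopology by blast
  then have "continuous_map (subtopology (gtop G) ?O) (subtopology (gtop H) (gdom H ` ?O')) (S.spec \<circ> gdom G)"
    using sub by (intro continuous_map_into_subtopology continuous_map_from_subtopology) auto
  from continuous_map_compose[OF this H.section_of(1)[OF B]]
  show "continuous_map (subtopology (gtop G) ?O) (gtop H) arrow_map"
  proof (rule continuous_map_eq)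
    fix \<gamma> assume "\<gamma> \<in> topspace (subtopology (gtop G) ?O)"
    then have "\<gamma> \<in> ?O" by simp
    then show "(H.section_of ?O' \<circ> (S.spec \<circ> gdom G)) \<gamma> = arrow_map \<gamma>"
      using H.section_of(2)[OF B im(1)] im(2) by simp
  qed
next
  fix \<gamma> assume "\<gamma> \<in> arrows G"
  then show "\<exists>n. n \<in> Collect partial_bisection \<and> \<gamma> \<in> {\<gamma>. n \<gamma> \<noteq> 0} \<and> arrow_map \<gamma> = arrow_map \<gamma>"
    using bump[OF openin_topspace] by (metis (mono_tags, lifting) mem_Collect_eq)
qed simp

text \<open>\<open>corr\<close> is the same relation read from either side, so the map built from
  the inverse algebra isomorphism inverts \<open>arrow_map\<close>.\<close>

theorem groupoids_isomorphic: "top_groupoid_isomorphic G H"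
proof -
  interpret S: principal_alg_iso H G p \<Psi> \<Phi> by (rule principal_sym)
  have "S.arrow_map (arrow_map \<gamma>) = \<gamma>" if "\<gamma> \<in> arrows G" for \<gamma>
  proof -
    have c: "S.corr (arrow_map \<gamma>) \<gamma>" using corr_sym corr_arrow_map[OF that] by blast
    then show ?thesis using S.corr_unique[OF S.corr_arrow_map[OF S.corrD(1)[OF c]] c] by blast
  qed
  moreover have "arrow_map (S.arrow_map \<eta>) = \<eta>" if "\<eta> \<in> arrows H" for \<eta>
  proof -
    have c: "corr (S.arrow_map \<eta>) \<eta>" using corr_sym S.corr_arrow_map[OF that] by blast
    then show ?thesis using corr_unique[OF corr_arrow_map[OF corrD(1)[OF c]] c] by blast
  qed
  ultimately have "homeomorphic_maps (gtop G) (gtop H) arrow_map S.arrow_map"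
    unfolding homeomorphic_maps_def using arrow_map_continuous S.arrow_map_continuous by blast
  then show ?thesis
    unfolding top_groupoid_isomorphic_def using arrow_map_hom S.arrow_map_hom by blast
qed

end

section \<open>Isomorphic groupoids have isometrically isomorphic algebras\<close>

locale red_grpd_iso = G: red_grpd G p + H: red_grpd H p
  for G :: "'a top_groupoid" and H :: "'b top_groupoid" and p :: real +
  fixes \<phi> :: "'a \<Rightarrow> 'b" and \<psi> :: "'b \<Rightarrow> 'a"
  assumes homeo: "homeomorphic_maps (gtop G) (gtop H) \<phi> \<psi>"
    and hom: "groupoid_hom G H \<phi>" and hom': "groupoid_hom H G \<psi>"
begin

lemma red_grpd_iso_sym: "red_grpd_iso H G p \<psi> \<phi>"
  by unfold_locales (use homeo hom hom' homeomorphic_maps_sym in blast)+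

lemma maps:
  shows "\<gamma> \<in> arrows G \<Longrightarrow> \<phi> \<gamma> \<in> arrows H" "\<eta> \<in> arrows H \<Longrightarrow> \<psi> \<eta> \<in> arrows G"
    and "\<gamma> \<in> arrows G \<Longrightarrow> \<psi> (\<phi> \<gamma>) = \<gamma>" "\<eta> \<in> arrows H \<Longrightarrow> \<phi> (\<psi> \<eta>) = \<eta>"
  using homeo hom hom' unfolding homeomorphic_maps_def groupoid_hom_def by blast+

lemma map_mul:
  assumes "\<eta> \<in> arrows H" "\<zeta> \<in> arrows H" "gdom H \<eta> = gran H \<zeta>"
  shows "gdom G (\<psi> \<eta>) = gran G (\<psi> \<zeta>)" "\<psi> (gmul H \<eta> \<zeta>) = gmul G (\<psi> \<eta>) (\<psi> \<zeta>)"
proof -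
  have "(\<eta>, \<zeta>) \<in> gcomp H" using assms H.comp_iff by blast
  then have "(\<psi> \<eta>, \<psi> \<zeta>) \<in> gcomp G \<and> \<psi> (gmul H \<eta> \<zeta>) = gmul G (\<psi> \<eta>) (\<psi> \<zeta>)"
    using hom' unfolding groupoid_hom_def by blast
  then show "gdom G (\<psi> \<eta>) = gran G (\<psi> \<zeta>)" "\<psi> (gmul H \<eta> \<zeta>) = gmul G (\<psi> \<eta>) (\<psi> \<zeta>)"
    using G.comp_iff by blast+
qed

text \<open>Units are idempotent, \<open>\<psi>\<close> preserves products, and an idempotent arrow
  is a unit by cancellation.\<close>

lemma map_unit: assumes "y \<in> units H" shows "\<psi> y \<in> units G"
proof -
  have y: "y \<in> arrows H" "gdom H y = gran H y" "gmul H y y = y"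
    using assms H.mul_dom[of y] by simp_all
  note m = map_mul[OF y(1) y(1) y(2)]
  have a: "\<psi> y \<in> arrows G" using maps y by blast
  have "gmul G (\<psi> y) (\<psi> y) = gmul G (\<psi> y) (gdom G (\<psi> y))" using m(2) y(3) a by simp
  then have "\<psi> y = gdom G (\<psi> y)"
    using G.left_cancel[of "\<psi> y" "\<psi> y" "gdom G (\<psi> y)"] a m(1) by simp
  then show ?thesis using a G.dom_units by metis
qed

lemma map_dom: assumes "\<eta> \<in> arrows H" shows "gdom G (\<psi> \<eta>) = \<psi> (gdom H \<eta>)"
  using map_mul(1)[of \<eta> "gdom H \<eta>"] map_unit[of "gdom H \<eta>"] assms by simp

lemma map_inv: assumes "\<eta> \<in> arrows H" shows "\<psi> (ginv H \<eta>) = ginv G (\<psi> \<eta>)"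
proof -
  have i: "ginv H \<eta> \<in> arrows H" "gdom H (ginv H \<eta>) = gran H \<eta>" using assms by simp_all
  note m = map_mul[OF i(1) assms i(2)]
  have a: "\<psi> \<eta> \<in> arrows G" "\<psi> (ginv H \<eta>) \<in> arrows G" using maps i assms by blast+
  have "gmul G (\<psi> (ginv H \<eta>)) (\<psi> \<eta>) = gmul G (ginv G (\<psi> \<eta>)) (\<psi> \<eta>)"
    using m(2) map_dom[OF assms] by simp
  then show ?thesis using G.right_cancel[of "\<psi> \<eta>" "\<psi> (ginv H \<eta>)" "ginv G (\<psi> \<eta>)"] a m(1) by simp
qed

lemma map_gdiv:
  assumes "\<eta> \<in> arrows H" "\<zeta> \<in> arrows H" "gdom H \<eta> = gdom H \<zeta>"
  shows "\<psi> (gdiv H \<eta> \<zeta>) = gdiv G (\<psi> \<eta>) (\<psi> \<zeta>)"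
  using map_mul(2)[of \<eta> "ginv H \<zeta>"] map_inv assms by simp

lemma bij_fibre:
  assumes "y \<in> units H"
  shows "bij_betw \<psi> (source_fibre H y) (source_fibre G (\<psi> y))"
proof -
  interpret S: red_grpd_iso H G p \<psi> \<phi> by (rule red_grpd_iso_sym)
  show ?thesis
  proof (rule bij_betw_byWitness[where f' = \<phi>])
    show "\<psi> ` source_fibre H y \<subseteq> source_fibre G (\<psi> y)" using maps map_dom by auto
    show "\<phi> ` source_fibre G (\<psi> y) \<subseteq> source_fibre H y" 
      using maps S.map_dom maps(4)[of y] assms by auto
  qed (use maps in auto)
qed

text \<open>Composition is with the inverse \<open>\<psi>\<close>, so functions on \<open>G\<close>
  become functions on \<open>H\<close>. The value off the arrows is prescribed because
  \<open>\<psi>\<close> is arbitrary there.\<close>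

definition pullback :: "('a \<Rightarrow> complex) \<Rightarrow> 'b \<Rightarrow> complex" where
  "pullback f \<eta> = (if \<eta> \<in> arrows H then f (\<psi> \<eta>) else 0)"

lemma pullback_pullback:
  assumes "\<And>\<gamma>. \<gamma> \<notin> arrows G \<Longrightarrow> f \<gamma> = 0"
  shows "red_grpd_iso.pullback G \<phi> (pullback f) = f"
proof -
  interpret S: red_grpd_iso H G p \<psi> \<phi> by (rule red_grpd_iso_sym)
  show ?thesis
  proof
    fix \<gamma> show "S.pullback (pullback f) \<gamma> = f \<gamma>"
      using assms[of \<gamma>] maps(1,3)[of \<gamma>] by (simp add: S.pullback_def pullback_def)
  qed
qed

lemma pullback_Cc: assumes "f \<in> Cc G" shows "pullback f \<in> Cc H"
proof -
  obtain K where K: "compactin (gtop G) K" "\<And>\<gamma>. f \<gamma> \<noteq> 0 \<Longrightarrow> \<gamma> \<in> K"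
    "continuous_map (gtop G) euclidean f" using G.CcE[OF assms] by blast
  show ?thesis
  proof (rule H.CcI)
    have "continuous_map (gtop H) euclidean (f \<circ> \<psi>)"
      using continuous_map_compose[OF _ K(3), of "gtop H" \<psi>] homeo unfolding homeomorphic_maps_def by blast
    then show "continuous_map (gtop H) euclidean (pullback f)"
      by (rule continuous_map_eq) (simp add: pullback_def)
    show "compactin (gtop H) (\<phi> ` K)"
      using image_compactin[OF K(1), of "gtop H" \<phi>] homeo unfolding homeomorphic_maps_def by blast
    show "\<eta> \<in> \<phi> ` K" if "pullback f \<eta> \<noteq> 0" for \<eta>
      using that K(2)[of "\<psi> \<eta>"] maps(4)[of \<eta>] by (auto simp: pullback_def split: if_splits intro!: image_eqI[of _ _ "\<psi> \<eta>"])
  qed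
qed

text \<open>The matrices of \<open>pullback f\<close> are those of \<open>f\<close> with rows and
  columns relabelled by \<open>\<psi>\<close>, which is a bijection between fibres.\<close>

lemma pullback_opbound: assumes f: "opbound p G C f" shows "opbound p H C (pullback f)"
proof (rule opboundI)
  show "0 \<le> C" using f by (rule opbound_nonneg)
  fix y E F \<xi>
  assume a: "y \<in> units H" "finite E" "finite F" "E \<subseteq> source_fibre H y" "F \<subseteq> source_fibre H y"
  note bij = bij_fibre[OF a(1)]
  have inj: "inj_on \<psi> E" "inj_on \<psi> F"
    using bij a inj_on_subset unfolding bij_betw_def by blast+
  have sub: "\<psi> ` E \<subseteq> source_fibre G (\<psi> y)" "\<psi> ` F \<subseteq> source_fibre G (\<psi> y)"
    using bij a unfolding bij_betw_def by blast+
  have fib: "\<eta> \<in> arrows H" "gdom H \<eta> = y" if "\<eta> \<in> E \<union> F" for \<eta> using that a by auto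
  have re: "lpn p (\<psi> ` A) k = lpn p A (\<lambda>\<eta>. k (\<psi> \<eta>))" if "inj_on \<psi> A" for A k
    using that by (simp add: lpn_def sum.reindex)
  have "lpn p E (\<lambda>\<eta>. \<Sum>\<zeta>\<in>F. pullback f (gdiv H \<eta> \<zeta>) * \<xi> \<zeta>) =
      lpn p E (\<lambda>\<eta>. \<Sum>\<sigma>\<in>\<psi> ` F. f (gdiv G (\<psi> \<eta>) \<sigma>) * \<xi> (\<phi> \<sigma>))"
  proof (intro lpn_cong arg_cong[of _ _ cmod])
    fix \<eta> assume e: "\<eta> \<in> E"
    have "pullback f (gdiv H \<eta> \<zeta>) * \<xi> \<zeta> = f (gdiv G (\<psi> \<eta>) (\<psi> \<zeta>)) * \<xi> (\<phi> (\<psi> \<zeta>))" if z: "\<zeta> \<in> F" for \<zeta>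
    proof -
      have ez: "\<eta> \<in> arrows H" "\<zeta> \<in> arrows H" "gdom H \<eta> = gdom H \<zeta>" using fib[of \<eta>] fib[of \<zeta>] e z by simp_all
      show ?thesis using map_gdiv[OF ez] H.gdiv_closed(1)[OF ez] maps(4)[OF ez(2)] by (simp add: pullback_def)
    qed
    then show "(\<Sum>\<zeta>\<in>F. pullback f (gdiv H \<eta> \<zeta>) * \<xi> \<zeta>) = (\<Sum>\<sigma>\<in>\<psi> ` F. f (gdiv G (\<psi> \<eta>) \<sigma>) * \<xi> (\<phi> \<sigma>))"
      by (simp add: sum.reindex[OF inj(2)])
  qed
  also have "\<dots> = lpn p (\<psi> ` E) (\<lambda>\<gamma>. \<Sum>\<sigma>\<in>\<psi> ` F. f (gdiv G \<gamma> \<sigma>) * \<xi> (\<phi> \<sigma>))"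
    by (simp add: re[OF inj(1)])
  also have "\<dots> \<le> C * lpn p (\<psi> ` F) (\<lambda>\<sigma>. \<xi> (\<phi> \<sigma>))"
    using opboundD[OF f map_unit[OF a(1)] _ _ sub, of "\<lambda>\<sigma>. \<xi> (\<phi> \<sigma>)"] a(2,3) by simp
  also have "lpn p (\<psi> ` F) (\<lambda>\<sigma>. \<xi> (\<phi> \<sigma>)) = lpn p F \<xi>"
    unfolding re[OF inj(2)] by (rule lpn_cong) (use fib maps(4) in auto)
  finally show "lpn p E (\<lambda>\<eta>. \<Sum>\<zeta>\<in>F. pullback f (gdiv H \<eta> \<zeta>) * \<xi> \<zeta>) \<le> C * lpn p F \<xi>" .
qed

lemma pullback_RA: assumes "f \<in> RA p G" shows "pullback f \<in> RA p H"
proof -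
  obtain s where s: "approx p G s f" using assms by (auto simp: RA_def)
  obtain C where C: "C \<longlonglongrightarrow> 0" "\<And>n. opbound p G (C n) (\<lambda>\<gamma>. s n \<gamma> - f \<gamma>)" "\<And>n. s n \<in> Cc G"
    using G.approxE[OF s] by metis
  have "approx p H (\<lambda>n. pullback (s n)) (pullback f)"
  proof (rule H.approxI[OF _ _ C(1)])
    show "pullback (s n) \<in> Cc H" for n using pullback_Cc C(3) by blast
    show "opbound p H (C n) (\<lambda>\<eta>. pullback (s n) \<eta> - pullback f \<eta>)" for n
      by (rule H.opbound_cong[OF pullback_opbound[OF C(2)]]) (simp add: pullback_def)
  qed (simp add: pullback_def)
  then show ?thesis by (auto simp: RA_def)
qed

text \<open>The reverse inequality is this one for the inverse isomorphism of groupoids.\<close>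

lemma pullback_norm_le: "f \<in> RA p G \<Longrightarrow> lambda_norm p H (pullback f) \<le> lambda_norm p G f"
  using H.opbound_lambda_norm(1) pullback_opbound G.RA_norm by blast

lemma pullback_convolution:
  "pullback (convolution G f g) = convolution H (pullback f) (pullback g)"
proof
  fix \<eta> show "pullback (convolution G f g) \<eta> = convolution H (pullback f) (pullback g) \<eta>"
  proof (cases "\<eta> \<in> arrows H")
    case True
    then have u: "gdom H \<eta> \<in> units H" by simp
    have "(\<Sum>\<^sub>\<infinity>\<zeta>\<in>source_fibre H (gdom H \<eta>). pullback f (gdiv H \<eta> \<zeta>) * pullback g \<zeta>) =
       (\<Sum>\<^sub>\<infinity>\<zeta>\<in>source_fibre H (gdom H \<eta>). f (gdiv G (\<psi> \<eta>) (\<psi> \<zeta>)) * g (\<psi> \<zeta>))"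
    proof (rule infsum_cong)
      fix \<zeta> assume "\<zeta> \<in> source_fibre H (gdom H \<eta>)"
      then have z: "\<zeta> \<in> arrows H" "gdom H \<eta> = gdom H \<zeta>" by simp_all
      show "pullback f (gdiv H \<eta> \<zeta>) * pullback g \<zeta> = f (gdiv G (\<psi> \<eta>) (\<psi> \<zeta>)) * g (\<psi> \<zeta>)"
        using map_gdiv[OF True z] H.gdiv_closed(1)[OF True z] z(1) by (simp add: pullback_def)
    qed
    also have "\<dots> = (\<Sum>\<^sub>\<infinity>\<sigma>\<in>source_fibre G (\<psi> (gdom H \<eta>)). f (gdiv G (\<psi> \<eta>) \<sigma>) * g \<sigma>)"
      by (rule infsum_reindex_bij_betw[OF bij_fibre[OF u]])
    finally show ?thesis
      using True maps(2) map_dom by (simp add: convolution_def pullback_def)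
  qed (simp add: pullback_def convolution_def)
qed

theorem pullback_isometric: "isometrically_isomorphic (RA_algebra p G) (RA_algebra p H)"
proof -
  interpret S: red_grpd_iso H G p \<psi> \<phi> by (rule red_grpd_iso_sym)
  have inv: "S.pullback (pullback f) = f" if "f \<in> RA p G" for f
    using pullback_pullback G.RA_zero[OF that] by blast
  have inv': "pullback (S.pullback f) = f" if "f \<in> RA p H" for f
    using S.pullback_pullback H.RA_zero[OF that] by blast
  have bij: "bij_betw pullback (RA p G) (RA p H)"
    by (rule bij_betw_byWitness[where f' = S.pullback]) (use inv inv' pullback_RA S.pullback_RA in auto)
  have "lambda_norm p H (pullback f) = lambda_norm p G f" if "f \<in> RA p G" for f
    using pullback_norm_le[OF that] S.pullback_norm_le[OF pullback_RA[OF that]] inv[OF that] by simp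
  moreover have "pullback (\<lambda>\<gamma>. f \<gamma> + g \<gamma>) = (\<lambda>\<eta>. pullback f \<eta> + pullback g \<eta>)"
    "pullback (\<lambda>\<gamma>. c * f \<gamma>) = (\<lambda>\<eta>. c * pullback f \<eta>)" for f g c
    by (auto simp: pullback_def)
  ultimately show ?thesis
    unfolding isometrically_isomorphic_def RA_algebra_def using bij pullback_convolution
    by (intro exI[of _ pullback]) simp
qed

end

lemma (in red_grpd) RA_algebra_closed:
  "a \<in> acarrier (RA_algebra p G) \<Longrightarrow> b \<in> acarrier (RA_algebra p G) \<Longrightarrow> aadd (RA_algebra p G) a b \<in> acarrier (RA_algebra p G)"
  "a \<in> acarrier (RA_algebra p G) \<Longrightarrow> ascale (RA_algebra p G) c a \<in> acarrier (RA_algebra p G)"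
  "a \<in> acarrier (RA_algebra p G) \<Longrightarrow> b \<in> acarrier (RA_algebra p G) \<Longrightarrow> amul (RA_algebra p G) a b \<in> acarrier (RA_algebra p G)"
  by (simp_all add: RA_algebra_def RA_add RA_scale RA_convolution)

lemma (in red_grpd) reduced_algebra_iso_sym: "isometrically_isomorphic (reduced_algebra p G) (RA_algebra p G)"
  using isometrically_isomorphic_sym[OF reduced_algebra_iso] RA_algebra_closed by blast

theorem corollary5p6:
  fixes G :: "'a top_groupoid" and H :: "'b top_groupoid" and p :: real
  assumes "topological_groupoid G" and "Hausdorff_space (gtop G)" and "etale G"
    and "topologically_principal G" and "compact_space (unit_top G)"
    and "topological_groupoid H" and "Hausdorff_space (gtop H)" and "etale H"
    and "topologically_principal H" and "compact_space (unit_top H)"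
    and "1 \<le> p" and "p \<noteq> 2"
  shows "isometrically_isomorphic (reduced_algebra p G) (reduced_algebra p H) \<longleftrightarrow>
         top_groupoid_isomorphic G H"
proof -
  have "groupoid G" "groupoid H" using assms by (auto simp: topological_groupoid_def)
  then interpret G: red_grpd G p + H: red_grpd H p
    using assms by unfold_locales auto
  show ?thesis
  proof
    assume "isometrically_isomorphic (reduced_algebra p G) (reduced_algebra p H)"
    \<comment> \<open>In the function models the elements have values at arrows and supports, on
      which the reconstruction rests.\<close>
    then have "isometrically_isomorphic (RA_algebra p G) (RA_algebra p H)"
      using G.reduced_algebra_iso H.reduced_algebra_iso_sym isometrically_isomorphic_trans by metis
    then obtain \<Phi> where P: "bij_betw \<Phi> (RA p G) (RA p H)"
      "\<And>f g. f \<in> RA p G \<Longrightarrow> g \<in> RA p G \<Longrightarrow> \<Phi> (\<lambda>\<gamma>. f \<gamma> + g \<gamma>) = (\<lambda>\<gamma>. \<Phi> f \<gamma> + \<Phi> g \<gamma>)"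
      "\<And>c f. f \<in> RA p G \<Longrightarrow> \<Phi> (\<lambda>\<gamma>. c * f \<gamma>) = (\<lambda>\<gamma>. c * \<Phi> f \<gamma>)"
      "\<And>f g. f \<in> RA p G \<Longrightarrow> g \<in> RA p G \<Longrightarrow> \<Phi> (convolution G f g) = convolution H (\<Phi> f) (\<Phi> g)"
      "\<And>f. f \<in> RA p G \<Longrightarrow> lambda_norm p H (\<Phi> f) = lambda_norm p G f"
      unfolding isometrically_isomorphic_def RA_algebra_def by auto
    interpret principal_alg_iso G H p \<Phi> "the_inv_into (RA p G) \<Phi>"
    proof unfold_locales
      show "\<Phi> f \<in> RA p H" if "f \<in> RA p G" for f using P(1) that bij_betwE by blast
      show "the_inv_into (RA p G) \<Phi> g \<in> RA p G" if "g \<in> RA p H" for g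
        using bij_betw_the_inv_into[OF P(1)] that bij_betwE by blast
      show "the_inv_into (RA p G) \<Phi> (\<Phi> f) = f" if "f \<in> RA p G" for f
        using P(1) that by (simp add: bij_betw_def the_inv_into_f_f)
      show "\<Phi> (the_inv_into (RA p G) \<Phi> g) = g" if "g \<in> RA p H" for g
        using f_the_inv_into_f_bij_betw[OF P(1)] that by blast
    qed (use P(2-) assms in auto)
    show "top_groupoid_isomorphic G H" by (rule groupoids_isomorphic)
  next
    assume "top_groupoid_isomorphic G H"
    then obtain \<phi> \<psi> where "homeomorphic_maps (gtop G) (gtop H) \<phi> \<psi>" "groupoid_hom G H \<phi>" "groupoid_hom H G \<psi>"
      unfolding top_groupoid_isomorphic_def by blast
    then interpret red_grpd_iso G H p \<phi> \<psi> by unfold_locales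
    show "isometrically_isomorphic (reduced_algebra p G) (reduced_algebra p H)"
      using G.reduced_algebra_iso_sym pullback_isometric H.reduced_algebra_iso isometrically_isomorphic_trans by metis
  qed
qed

end
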